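(* Let $G=\mathrm{SU}(5)$ and $H=\mathrm{S}(\mathrm{U}(2)\times \mathrm{U}(2))=\{A\in \mathrm{U}(2)\times \mathrm{U}(2):\det A=1\}$, embedded block-diagonally in $G$ (in rows and columns $2,3$ and $4,5$, with entry $1$ in position $(1,1)$). Let $\mathfrak{g}=\mathfrak{su}(5)$, let $\mathfrak{h}$ be the Lie algebra of $H$, let $Q(X,Y)=-\operatorname{trace}(XY)$ on $\mathfrak{g}$, and let $\mathfrak{m}$ be the $Q$-orthogonal complement of $\mathfrak{h}$ in $\mathfrak{g}$. Decompose $\mathfrak{m}=\mathfrak{n}\oplus\mathfrak{p}$, $\mathfrak{n}=\operatorname{span}_{\mathbb R}\{w\}$, $\mathfrak{p}=\mathfrak{m}_{01}\oplus\mathfrak{m}_{02}\oplus\mathfrak{m}_{12}$, with $w$, the subspaces $\mathfrak{m}_{ij}$ and the map $X\mapsto\bar X$ on $\mathfrak{p}$ as defined in the context. (1) If a $G$-invariant Riemannian metric on $G/H$ is a geodesic orbit metric, then, up to homothety (multiplication by a positive constant), its metric endomorphism with respect to $Q$ is $$\Lambda_\mu=\begin{pmatrix}\mu\,\mathrm{Id}|_{\mathfrak{n}} & 0\\ 0& \mathrm{Id}|_{\mathfrak{p}}\end{pmatrix}$$ for some $\mu>0$. (2) For $\mu>0$, the $G$-invariant metric on $G/H$ with metric endomorphism $\Lambda_\mu$ is a geodesic orbit metric if and only if for all $X_{01}\in\mathfrak{m}_{01}$, $X_{02}\in\mathfrak{m}_{02}$, $X_{12}\in\mathfrak{m}_{12}$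 there exists $a\in\mathfrak{h}$ such that $$[a,X_{01}]+5(1-\mu)\overline{X_{01}}=0,\qquad [a,X_{02}]+5(1-\mu)\overline{X_{02}}=0,\qquad [a,X_{12}]=0.$$
   Context: Metric endomorphisms: $\mathfrak{m}$ is identified with the tangent space of $G/H$ at $o=eH$. $G$-invariant Riemannian metrics on $G/H$ correspond bijectively to $\operatorname{Ad}_H$-invariant inner products $\langle\cdot,\cdot\rangle$ on $\mathfrak{m}$, and these correspond bijectively to endomorphisms $\Lambda$ of $\mathfrak{m}$ (the metric endomorphism) that are $Q$-symmetric, positive definite and commute with $\operatorname{Ad}_h|_{\mathfrak{m}}$ for all $h\in H$, via $\langle X,Y\rangle=Q(\Lambda X,Y)$. Geodesic orbit metric: a $G$-invariant metric on $G/H$ is a geodesic orbit (g.o.) metric if every geodesic through a point $p$ has the form $\gamma(t)=\exp(tX)\cdot p$ for some $X\in\mathfrak{g}$. Basis notation: let $E_{ab}$ be the complex $5\times5$ matrix with $1$ in entry $(a,b)$ and $0$ elsewhere, and set, for $a<b$, $e_{ab}=E_{ab}-E_{ba}$ and $f_{ab}=\sqrt{-1}(E_{ab}+E_{ba})$; also $f_{aa}=\sqrt{-1}E_{aa}$. Then $$\mathfrak{h}=\operatorname{span}_{\mathbb R}\{f_{22}-f_{33},e_{23},f_{23},f_{44}-f_{55},e_{45},f_{45}, f_{22}+f_{33}-f_{44}-f_{55}\},$$ $$w=4f_{11}-f_{22}-f_{33}-f_{44}-f_{55},$$ $$\mathfrak{m}_{01}=\operatorname{span}_{\mathbb R}\{e_{12},f_{12},e_{13},f_{13}\},\quad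 \mathfrak{m}_{02}=\operatorname{span}_{\mathbb R}\{e_{14},f_{14},e_{15},f_{15}\},$$ $$\mathfrak{m}_{12}=\operatorname{span}_{\mathbb R}\{e_{24},f_{24},e_{25},f_{25},e_{34},f_{34},e_{35},f_{35}\}.$$ Bar map: for $X=\sum_{1\le i<j\le5}(c_{ij}e_{ij}+d_{ij}f_{ij})$ with real $c_{ij},d_{ij}$, set $\bar X=\sum_{1\le i<j\le5}(-d_{ij}e_{ij}+c_{ij}f_{ij})$. *)

theory Defs
  imports "HOL-Analysis.Analysis"
begin

(* The multiplication "*" on this type is entrywise; the matrix product is "**". *)
type_synonym cmat5 = "complex^5^5"

subsection \<open>Groups\<close>

definition conj_transpose :: "complex^'n^'m \<Rightarrow> complex^'m^'n" where
  "conj_transpose A = (\<chi> i j. cnj (A $ j $ i))"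

definition unitary_group :: "(complex^'n^'n) set" where
  "unitary_group = {A. conj_transpose A ** A = mat 1}"

definition SU5 :: "cmat5 set" where
  "SU5 = {A \<in> unitary_group. det A = 1}"

definition block_embed :: "complex^2^2 \<Rightarrow> complex^2^2 \<Rightarrow> cmat5" where
  "block_embed A B = vector
    [vector [1, 0, 0, 0, 0],
     vector [0, A$1$1, A$1$2, 0, 0],
     vector [0, A$2$1, A$2$2, 0, 0],
     vector [0, 0, 0, B$1$1, B$1$2],
     vector [0, 0, 0, B$2$1, B$2$2]]"

definition SU2U2 :: "cmat5 set" where
  "SU2U2 = {block_embed A B | A B.
     A \<in> unitary_group \<and> B \<in> unitary_group \<and> det (block_embed A B) = 1}"

definition mexp :: "cmat5 \<Rightarrow> cmat5" where
  "mexp A = (\<Sum>k. (1 / fact k) *\<^sub>R ((\<lambda>M. A ** M) ^^ k) (mat 1))"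

definition lie_bracket :: "cmat5 \<Rightarrow> cmat5 \<Rightarrow> cmat5" where
  "lie_bracket X Y = X ** Y - Y ** X"

definition conjugate_by :: "cmat5 \<Rightarrow> cmat5 \<Rightarrow> cmat5" where
  "conjugate_by g X = g ** X ** matrix_inv g"


subsection \<open>Lie algebras and the decomposition of the isotropy complement\<close>

(* Indices are natural numbers in {1..5}; in the index type 5 the number 5 coincides with 0. *)
definition E_mat :: "nat \<Rightarrow> nat \<Rightarrow> cmat5" where
  "E_mat a b = (\<chi> i j. if i = of_nat a \<and> j = of_nat b then 1 else 0)"

definition e_mat :: "nat \<Rightarrow> nat \<Rightarrow> cmat5" where
  "e_mat a b = E_mat a b - E_mat b a"

(* The diagonal case is not the specialisation of the off-diagonal one. *)
definition f_mat :: "nat \<Rightarrow> nat \<Rightarrow> cmat5" where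
  "f_mat a b = (\<chi> i j. \<i> * (if a = b then E_mat a a else E_mat a b + E_mat b a) $ i $ j)"

definition su5 :: "cmat5 set" where
  "su5 = {X. conj_transpose X = - X \<and> trace X = 0}"

definition \<hh> :: "cmat5 set" where
  "\<hh> = span {f_mat 2 2 - f_mat 3 3, e_mat 2 3, f_mat 2 3,
             f_mat 4 4 - f_mat 5 5, e_mat 4 5, f_mat 4 5,
             f_mat 2 2 + f_mat 3 3 - f_mat 4 4 - f_mat 5 5}"

(* The trace of a product of two elements of su5 is real. *)
definition Q_form :: "cmat5 \<Rightarrow> cmat5 \<Rightarrow> real" where
  "Q_form X Y = - Re (trace (X ** Y))"

definition \<mm> :: "cmat5 set" where
  "\<mm> = {X \<in> su5. \<forall>Y\<in>\<hh>. Q_form X Y = 0}"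

definition w_vec :: cmat5 where
  "w_vec = 4 *\<^sub>R f_mat 1 1 - f_mat 2 2 - f_mat 3 3 - f_mat 4 4 - f_mat 5 5"

definition \<nn> :: "cmat5 set" where
  "\<nn> = span {w_vec}"

definition \<mm>01 :: "cmat5 set" where
  "\<mm>01 = span {e_mat 1 2, f_mat 1 2, e_mat 1 3, f_mat 1 3}"

definition \<mm>02 :: "cmat5 set" where
  "\<mm>02 = span {e_mat 1 4, f_mat 1 4, e_mat 1 5, f_mat 1 5}"

definition \<mm>12 :: "cmat5 set" where
  "\<mm>12 = span {e_mat 2 4, f_mat 2 4, e_mat 2 5, f_mat 2 5,
              e_mat 3 4, f_mat 3 4, e_mat 3 5, f_mat 3 5}"

definition \<pp> :: "cmat5 set" where
  "\<pp> = {X + Y + Z | X Y Z. X \<in> \<mm>01 \<and> Y \<in> \<mm>02 \<and> Z \<in> \<mm>12}"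

(* For i < j the coefficients of e_mat i j and f_mat i j in an element X of the span of
   these matrices are the real and the imaginary part of the entry (i, j) of X. *)
definition bar :: "cmat5 \<Rightarrow> cmat5" where
  "bar X = (\<Sum>j\<in>{1..5}. \<Sum>i\<in>{1..<j}.
     - Im (X $ of_nat i $ of_nat j) *\<^sub>R e_mat i j
     + Re (X $ of_nat i $ of_nat j) *\<^sub>R f_mat i j)"

definition m_part :: "cmat5 \<Rightarrow> cmat5" where
  "m_part X = (THE U. U \<in> \<mm> \<and> X - U \<in> \<hh>)"

definition Lambda :: "real \<Rightarrow> cmat5 \<Rightarrow> cmat5" where
  "Lambda \<mu> X = (THE Z. \<exists>U\<in>\<nn>. \<exists>V\<in>\<pp>. X = U + V \<and> Z = \<mu> *\<^sub>R U + V)"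


subsection \<open>The homogeneous space and its invariant metrics\<close>

definition left_coset :: "cmat5 \<Rightarrow> cmat5 set" where
  "left_coset g = {g ** h | h. h \<in> SU2U2}"

definition translate :: "cmat5 \<Rightarrow> cmat5 set \<Rightarrow> cmat5 set" where
  "translate a p = (\<lambda>x. a ** x) ` p"

definition inner_product_on :: "cmat5 set \<Rightarrow> (cmat5 \<Rightarrow> cmat5 \<Rightarrow> real) \<Rightarrow> bool" where
  "inner_product_on V b \<longleftrightarrow>
     (\<forall>X\<in>V. \<forall>Y\<in>V. \<forall>Z\<in>V. b (X + Y) Z = b X Z + b Y Z) \<and>
     (\<forall>c. \<forall>X\<in>V. \<forall>Y\<in>V. b (c *\<^sub>R X) Y = c * b X Y) \<and>
     (\<forall>X\<in>V. \<forall>Y\<in>V. b X Y = b Y X) \<and>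
     (\<forall>X\<in>V. X \<noteq> 0 \<longrightarrow> b X X > 0)"

(* Let pi be the projection of the group onto the coset space.  Every tangent vector at the
   coset of g is d pi (g ** X) for exactly one X in \<mm>, and B g X Y is the value of the metric
   on the vectors given by X and Y.  Replacing the representative g by g ** h replaces X by
   conjugate_by (matrix_inv h) X: the second clause says that B is a well-defined tensor on the
   coset space.  The left translation by a takes the vector (g, X) to (a ** g, X): the third
   clause is invariance under the group.  It makes B constant in g, so smoothness is automatic. *)
definition invariant_metric :: "(cmat5 \<Rightarrow> cmat5 \<Rightarrow> cmat5 \<Rightarrow> real) \<Rightarrow> bool" where
  "invariant_metric B \<longleftrightarrow>
     (\<forall>g\<in>SU5. inner_product_on \<mm> (B g)) \<and>
     (\<forall>g\<in>SU5. \<forall>h\<in>SU2U2. \<forall>X\<in>\<mm>. \<forall>Y\<in>\<mm>.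
        B (g ** h) (conjugate_by (matrix_inv h) X) (conjugate_by (matrix_inv h) Y) = B g X Y) \<and>
     (\<forall>a\<in>SU5. \<forall>g\<in>SU5. \<forall>X\<in>\<mm>. \<forall>Y\<in>\<mm>. B (a ** g) X Y = B g X Y)"

definition metric_endomorphism ::
    "(cmat5 \<Rightarrow> cmat5 \<Rightarrow> cmat5 \<Rightarrow> real) \<Rightarrow> cmat5 \<Rightarrow> cmat5" where
  "metric_endomorphism B X = (THE Z. Z \<in> \<mm> \<and> (\<forall>Y\<in>\<mm>. B (mat 1) X Y = Q_form Z Y))"

definition metric_of_endomorphism ::
    "(cmat5 \<Rightarrow> cmat5) \<Rightarrow> cmat5 \<Rightarrow> cmat5 \<Rightarrow> cmat5 \<Rightarrow> real" where
  "metric_of_endomorphism L g X Y = Q_form (L X) Y"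


subsection \<open>Geodesics\<close>

(* Exponential coordinates centred at the coset of g: a local parametrisation of the coset
   space by a neighbourhood of 0 in \<mm>. *)
definition exp_chart :: "cmat5 \<Rightarrow> cmat5 \<Rightarrow> cmat5 set" where
  "exp_chart g X = left_coset (g ** mexp X)"

(* The derivative of exp_chart g at X in direction u, as the element of \<mm> that represents it
   with respect to the representative g ** mexp X. *)
definition exp_chart_deriv :: "cmat5 \<Rightarrow> cmat5 \<Rightarrow> cmat5" where
  "exp_chart_deriv X u =
     m_part (matrix_inv (mexp X) ** vector_derivative (\<lambda>s. mexp (X + s *\<^sub>R u)) (at 0))"

definition chart_metric ::
    "(cmat5 \<Rightarrow> cmat5 \<Rightarrow> cmat5 \<Rightarrow> real) \<Rightarrow> cmat5 \<Rightarrow> cmat5 \<Rightarrow> cmat5 \<Rightarrow> cmat5 \<Rightarrow> real" where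
  "chart_metric B g X u v = B (g ** mexp X) (exp_chart_deriv X u) (exp_chart_deriv X v)"

(* Christoffel symbol of the first kind, (d_u b(v,z) + d_v b(u,z) - d_z b(u,v)) / 2, of a metric
   tensor b given in coordinates on a vector space. *)
definition christoffel ::
    "('a::real_vector \<Rightarrow> 'a \<Rightarrow> 'a \<Rightarrow> real) \<Rightarrow> 'a \<Rightarrow> 'a \<Rightarrow> 'a \<Rightarrow> 'a \<Rightarrow> real" where
  "christoffel b x u v z =
     (deriv (\<lambda>s. b (x + s *\<^sub>R u) v z) 0
      + deriv (\<lambda>s. b (x + s *\<^sub>R v) u z) 0
      - deriv (\<lambda>s. b (x + s *\<^sub>R z) u v) 0) / 2"

(* The covariant acceleration (Levi-Civita connection) of a curve at a point with coordinates x,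
   velocity x' and second derivative x'', paired with z. *)
definition covariant_acceleration ::
    "('a::real_vector \<Rightarrow> 'a \<Rightarrow> 'a \<Rightarrow> real) \<Rightarrow> 'a \<Rightarrow> 'a \<Rightarrow> 'a \<Rightarrow> 'a \<Rightarrow> real" where
  "covariant_acceleration b x x' x'' z = b x x'' z + christoffel b x x' x' z"

(* The covariant acceleration does not depend on the chart.  At each time t0 it is computed in
   exponential coordinates centred at the point c t0. *)
definition geodesic ::
    "(cmat5 \<Rightarrow> cmat5 \<Rightarrow> cmat5 \<Rightarrow> real) \<Rightarrow> real set \<Rightarrow> (real \<Rightarrow> cmat5 set) \<Rightarrow> bool" where
  "geodesic B I c \<longleftrightarrow> open I \<and> is_interval I \<and>
     (\<forall>t0\<in>I. \<exists>g\<in>SU5. \<exists>\<epsilon>>0. \<exists>x x' x''. ball t0 \<epsilon> \<subseteq> I \<and> x t0 = 0 \<and>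
        (\<forall>t\<in>ball t0 \<epsilon>. x t \<in> \<mm> \<and> c t = exp_chart g (x t) \<and>
           (x has_vector_derivative x' t) (at t) \<and> (x' has_vector_derivative x'' t) (at t)) \<and>
        (\<forall>z\<in>\<mm>. covariant_acceleration (chart_metric B g) (x t0) (x' t0) (x'' t0) z = 0))"

definition geodesic_orbit :: "(cmat5 \<Rightarrow> cmat5 \<Rightarrow> cmat5 \<Rightarrow> real) \<Rightarrow> bool" where
  "geodesic_orbit B \<longleftrightarrow>
     (\<forall>I c. geodesic B I c \<and> 0 \<in> I \<longrightarrow>
        (\<exists>X\<in>su5. \<forall>t\<in>I. c t = translate (mexp (t *\<^sub>R X)) (c 0)))"

end

theory Submission
  imports Defs
begin

text \<open>
  Let \<open>L\<close> be the metric endomorphism.  A curve \<open>g(t) H\<close> whose lift is horizontal, \<open>g' = g v\<close> with \<open>v\<close> in \<open>\<mm>\<close>,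
  is a geodesic if and only if \<open>L v' = [L v, v]\<close> modulo \<open>\<hh>\<close>, a quadratic differential equation, so every
  vector in \<open>\<mm>\<close> is the initial velocity of a geodesic up to scaling.  If this geodesic is homogeneous, comparing
  its two lifts gives \<open>a \<in> \<hh>\<close> with \<open>L [a, X] = [L X, X]\<close> modulo \<open>\<hh>\<close>.

  By Schur's lemma \<open>L\<close> is a scalar on \<open>\<nn>\<close> and on each \<open>\<mm>ij\<close>.  Testing the condition on \<open>X = e12 + e14\<close> and on
  \<open>X = e12 + e24\<close> shows that the scalars on the \<open>\<mm>ij\<close> agree.  For \<open>Lambda \<mu>\<close>, testing it on
  \<open>X = w + e12 + e13 + e24 + 2 e35\<close> forces \<open>\<mu> = 1\<close>, and the same vectors show that the algebraic condition of the
  second part holds only for \<open>\<mu> = 1\<close>.  Conversely \<open>\<mu> = 1\<close> is the normal metric: along a geodesic the momentum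
  \<open>J = Ad_g v\<close> is constant, and then \<open>exp (- t J) c(t)\<close> is constant in the coset space, which is embedded in a
  vector space by \<open>g H \<mapsto> (g E11, g P2 g^{-1})\<close>.
\<close>

subsection \<open>The exponential map of a finite-dimensional algebra\<close>

text \<open>A geodesic is defined by asking, at every time, for a twice differentiable coordinate
  curve in a chart centred at that time. To certify a horizontal lift one must therefore solve
  \<open>g(t) H = g(t0) exp(x(t)) H\<close> for a twice differentiable \<open>x\<close> in
  \<open>\<mm>\<close>. The inverse function theorem is applied to the tangent map of suitable
  coordinates, which over the dual numbers is again a product of exponentials. In the other
  direction, a geodesic comes with unrelated representatives at different times, so whatever is
  differentiated must not depend on them. At the centre of a chart the metric is needed to first
  order only, through the term \<open>- [X, U] / 2\<close> of the logarithmic derivative of exp;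
  this is the source of the bracket in the geodesic equation. Schur's lemma is made explicit: one
  diagonal element of \<open>\<hh>\<close> splits \<open>\<mm>\<close> into the line of
  \<open>w\<close> and eight planes, and two rotations join the planes of each
  \<open>\<mm>ij\<close>. The factor 5 in the second part is the difference 4 - (-1) of the
  eigenvalues of \<open>w\<close> divided by \<open>\<i>\<close>.\<close>

lemma vector_derivative_zero_imp_eq:
  assumes "\<And>t. (f has_vector_derivative 0) (at t)"
  shows "f t = f s"
proof -
  have "(f has_vector_derivative 0) (at t within UNIV)" for t
    using assms by simp
  then obtain c where "\<And>t. f t = c"
    using has_vector_derivative_zero_constant[of UNIV f] by auto
  then show ?thesis
    by simp
qed

text \<open>Abstract because it is instantiated by the 5 by 5 matrices and, for differentiating a
  second time, by the dual numbers over such an algebra. The product is only bounded bilinear: the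
  Euclidean norm on pairs is not submultiplicative in general, which is why a constant
  \<open>K\<close> accompanies the estimates.\<close>

locale euclidean_algebra =
  fixes mult :: "'a::euclidean_space \<Rightarrow> 'a \<Rightarrow> 'a" (infixl "\<odot>" 70)
    and one :: 'a
  assumes mult: "bounded_bilinear (\<odot>)"
    and assoc: "A \<odot> B \<odot> C = A \<odot> (B \<odot> C)"
    and one_left [simp]: "one \<odot> A = A"
    and one_right [simp]: "A \<odot> one = A"
begin

sublocale mult: bounded_bilinear "(\<odot>)"
  by (rule mult)

definition pw :: "nat \<Rightarrow> 'a \<Rightarrow> 'a" where
  "pw k A = ((\<lambda>M. A \<odot> M) ^^ k) one"

text \<open>The Leibniz rule for the \<open>k\<close>-th power: without commutativity the derivative
  is a sum of \<open>k\<close> words containing \<open>U\<close> once, and it collapses to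
  \<open>k A^(k-1) U\<close> when \<open>U\<close> commutes with \<open>A\<close>.\<close>

primrec dpw :: "nat \<Rightarrow> 'a \<Rightarrow> 'a \<Rightarrow> 'a" where
  "dpw 0 A U = 0"
| "dpw (Suc k) A U = U \<odot> pw k A + A \<odot> dpw k A U"

definition ex :: "'a \<Rightarrow> 'a" where
  "ex A = (\<Sum>k. (1 / fact k) *\<^sub>R pw k A)"

definition dex :: "'a \<Rightarrow> 'a \<Rightarrow> 'a" where
  "dex A U = (\<Sum>k. (1 / fact k) *\<^sub>R dpw k A U)"

lemma pw_0 [simp]: "pw 0 A = one"
  and pw_Suc: "pw (Suc k) A = A \<odot> pw k A"
  by (simp_all add: pw_def)

lemma pw_has_derivative: "(pw k has_derivative dpw k A) (at A)"
proof (induction k)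
  case 0
  have "pw 0 = (\<lambda>A. one)" "dpw 0 A = (\<lambda>U. 0)"
    by auto
  then show ?case
    by simp
next
  case (Suc k)
  have "((\<lambda>A. A \<odot> pw k A) has_derivative (\<lambda>U. A \<odot> dpw k A U + U \<odot> pw k A)) (at A)"
    by (rule mult.FDERIV[OF has_derivative_ident Suc])
  moreover have "pw (Suc k) = (\<lambda>A. A \<odot> pw k A)"
    by (auto simp: pw_Suc)
  ultimately show ?case
    by (simp add: add.commute)
qed

lemma norm_bounds:
  obtains K where "K > 0" "\<And>A B. norm (A \<odot> B) \<le> K * norm A * norm B"
    "\<And>A k. norm (pw k A) \<le> norm one * (K * norm A) ^ k"
    "\<And>A U k. norm (dpw (Suc k) A U) \<le> real (Suc k) * (norm one * K * norm U * (K * norm A) ^ k)"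
proof -
  obtain K where K: "K > 0" "\<And>A B. norm (A \<odot> B) \<le> norm A * norm B * K"
    using mult.pos_bounded by blast
  have m: "norm (A \<odot> B) \<le> K * norm A * norm B" for A B
    using K(2)[of A B] by (simp add: mult_ac)
  have p: "norm (pw k A) \<le> norm one * (K * norm A) ^ k" for A k
  proof (induction k)
    case (Suc k)
    have "norm (pw (Suc k) A) \<le> K * norm A * norm (pw k A)"
      by (simp add: pw_Suc m)
    also have "\<dots> \<le> K * norm A * (norm one * (K * norm A) ^ k)"
      using Suc K by (intro mult_left_mono) auto
    finally show ?case
      by (simp add: mult_ac)
  qed auto
  have d: "norm (dpw (Suc k) A U) \<le> real (Suc k) * (norm one * K * norm U * (K * norm A) ^ k)" for A U k
  proof (induction k)
    case 0
    show ?case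
      using m[of U one] by (simp add: mult_ac mult.zero_right)
  next
    case (Suc k)
    have "norm (dpw (Suc (Suc k)) A U) \<le> norm (U \<odot> pw (Suc k) A) + norm (A \<odot> dpw (Suc k) A U)"
      by (metis dpw.simps(2) norm_triangle_ineq)
    also have "\<dots> \<le> K * norm U * norm (pw (Suc k) A) + K * norm A * norm (dpw (Suc k) A U)"
      by (intro add_mono m)
    also have "\<dots> \<le> K * norm U * (norm one * (K * norm A) ^ Suc k)
        + K * norm A * (real (Suc k) * (norm one * K * norm U * (K * norm A) ^ k))"
      using K Suc p[of "Suc k" A] by (intro add_mono mult_left_mono) auto
    also have "\<dots> = real (Suc (Suc k)) * (norm one * K * norm U * (K * norm A) ^ Suc k)"
      by (simp add: algebra_simps)
    finally show ?case .
  qed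
  show ?thesis
    using that[OF K(1) m p d] by blast
qed

lemma summable_ex: "summable (\<lambda>k. (1 / fact k) *\<^sub>R pw k A)"
proof -
  obtain K where K: "\<And>A k. norm (pw k A) \<le> norm one * (K * norm A) ^ k"
    using norm_bounds by metis
  have "summable (\<lambda>k. norm one * (inverse (fact k) * (K * norm A) ^ k))"
    by (intro summable_mult summable_exp)
  then show ?thesis
    by (rule summable_comparison_test'[where N = 0])
      (use K[of _ A] in \<open>auto simp: divide_simps mult_ac\<close>)
qed

text \<open>The coefficients \<open>b k\<close> depend on the radius \<open>r\<close> alone: this
  uniformity is what termwise differentiation on a ball requires.\<close>

lemma dpw_bound:
  obtains b where "summable b" "\<And>k A U. norm A \<le> r \<Longrightarrow> norm ((1 / fact k) *\<^sub>R dpw k A U) \<le> b k * norm U"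
proof -
  obtain K where K: "K > 0" "\<And>A U k. norm (dpw (Suc k) A U) \<le> real (Suc k) * (norm one * K * norm U * (K * norm A) ^ k)"
    using norm_bounds by metis
  \<comment> \<open>One factor of each word is \<open>U\<close>, and the number \<open>k\<close> of
    words cancels against \<open>fact k\<close>; hence the exponential series shifted by one index,
    with constant term zero.\<close>
  define b where "b k = (case k of 0 \<Rightarrow> 0 | Suc k \<Rightarrow> norm one * K * (inverse (fact k) * (K * r) ^ k))" for k
  have "summable (\<lambda>k. b (Suc k))"
    unfolding b_def nat.case by (intro summable_mult summable_exp)
  then have s: "summable b"
    by (subst (asm) summable_Suc_iff)
  have "norm ((1 / fact k) *\<^sub>R dpw k A U) \<le> b k * norm U" if "norm A \<le> r" for k A U
  proof (cases k)
    case 0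
    then show ?thesis
      by (simp add: b_def)
  next
    case (Suc j)
    have r: "norm A \<ge> 0" "r \<ge> 0"
      using that norm_ge_zero[of A] by linarith+
    have f: "1 / fact (Suc j) * real (Suc j) = (1 / fact j :: real)"
      by (simp add: field_simps del: of_nat_Suc)
    have "norm ((1 / fact k) *\<^sub>R dpw k A U) = (1 / fact (Suc j)) * norm (dpw (Suc j) A U)"
      using Suc by simp
    also have "\<dots> \<le> (1 / fact (Suc j)) * (real (Suc j) * (norm one * K * norm U * (K * norm A) ^ j))"
      by (intro mult_left_mono K(2)) auto
    also have "\<dots> = (1 / fact j) * (norm one * K * norm U * (K * norm A) ^ j)"
      by (subst mult.assoc[symmetric], subst f) simp
    also have "\<dots> \<le> (1 / fact j) * (norm one * K * norm U * (K * r) ^ j)"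
      using r K that by (intro mult_left_mono power_mono) auto
    also have "\<dots> = b k * norm U"
      using Suc by (simp add: b_def field_simps)
    finally show ?thesis .
  qed
  with s that show ?thesis
    by blast
qed

lemma summable_dex: "summable (\<lambda>k. (1 / fact k) *\<^sub>R dpw k A U)"
proof -
  obtain b where b: "summable b" "\<And>k B U. norm B \<le> norm A \<Longrightarrow> norm ((1 / fact k) *\<^sub>R dpw k B U) \<le> b k * norm U"
    using dpw_bound[of "norm A"] by metis
  have "summable (\<lambda>k. b k * norm U)"
    using b(1) by (rule summable_mult2)
  then show ?thesis
    by (rule summable_comparison_test'[where N = 0]) (use b(2)[of A] in auto)
qed

lemma ex_has_derivative: "(ex has_derivative dex A) (at A)"
proof -
  define r where "r = norm A + 1"
  let ?S = "ball 0 r :: 'a set"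
  obtain b where b: "summable b" "\<And>k B U. norm B \<le> r \<Longrightarrow> norm ((1 / fact k) *\<^sub>R dpw k B U) \<le> b k * norm U"
    using dpw_bound[of r] by metis
  have "\<exists>g. \<forall>x\<in>?S. (\<lambda>k. (1 / fact k) *\<^sub>R pw k x) sums (g x) \<and> (g has_derivative dex x) (at x within ?S)"
  proof (rule has_derivative_series)
    show "((\<lambda>x. (1 / fact n) *\<^sub>R pw n x) has_derivative (\<lambda>h. (1 / fact n) *\<^sub>R dpw n x h)) (at x within ?S)" for n x
      by (intro has_derivative_scaleR_right has_derivative_at_withinI[OF pw_has_derivative])
    show "(\<lambda>k. (1 / fact k) *\<^sub>R pw k 0) sums ex 0"
      unfolding ex_def using summable_ex by (rule summable_sums)
    fix e :: real
    assume "e > 0"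
    then obtain N where N: "\<And>n. n \<ge> N \<Longrightarrow> norm (\<Sum>i. b (i + n)) < e"
      using suminf_exist_split[OF _ b(1)] by blast
    show "\<forall>\<^sub>F n in sequentially. \<forall>x\<in>?S. \<forall>h. norm ((\<Sum>i<n. (1 / fact i) *\<^sub>R dpw i x h) - dex x h) \<le> e * norm h"
      unfolding eventually_sequentially
    proof (intro exI allI impI ballI)
      fix n x h
      assume n: "n \<ge> N" and x: "x \<in> ?S"
      have bx: "norm ((1 / fact k) *\<^sub>R dpw k x h) \<le> b k * norm h" for k
        using x by (intro b(2)) auto
      have sb: "summable (\<lambda>i. b (i + n) * norm h)"
        using b(1) by (intro summable_mult2) simp
      have "norm ((\<Sum>i<n. (1 / fact i) *\<^sub>R dpw i x h) - dex x h) = norm (\<Sum>i. (1 / fact (i + n)) *\<^sub>R dpw (i + n) x h)"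
        using suminf_minus_initial_segment[OF summable_dex, where k = n]
        by (simp add: dex_def norm_minus_commute)
      also have "\<dots> \<le> (\<Sum>i. b (i + n) * norm h)"
        using bx sb by (intro norm_suminf_le) auto
      also have "\<dots> = (\<Sum>i. b (i + n)) * norm h"
        using b(1) by (intro suminf_mult2[symmetric]) simp
      also have "\<dots> \<le> e * norm h"
        using N[OF n] by (intro mult_right_mono) auto
      finally show "norm ((\<Sum>i<n. (1 / fact i) *\<^sub>R dpw i x h) - dex x h) \<le> e * norm h" .
    qed
  qed (auto simp: r_def add_nonneg_pos)
  then obtain g where g: "\<forall>x\<in>?S. (\<lambda>k. (1 / fact k) *\<^sub>R pw k x) sums (g x) \<and> (g has_derivative dex x) (at x within ?S)"
    by (rule exE)
  have A: "A \<in> ?S"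
    by (simp add: r_def)
  have d: "(g has_derivative dex A) (at A)"
    using bspec[OF g A] at_within_open[OF A] by simp
  have e: "g x = ex x" if "x \<in> ?S" for x
    using bspec[OF g that] unfolding ex_def by (metis sums_unique)
  show ?thesis
    by (rule has_derivative_transform_within_open[OF d open_ball A e])
qed

lemma linear_dex: "linear (dex A)"
  using ex_has_derivative has_derivative_linear by blast

lemma pw_zero: "pw k 0 = (if k = 0 then one else 0)"
  by (cases k) (auto simp: pw_Suc mult.zero_left)

lemma ex_zero [simp]: "ex 0 = one"
  unfolding ex_def pw_zero
  by (subst suminf_finite[where N = "{0}"]) auto

lemma dpw_zero: "dpw k 0 U = (if k = 1 then U else 0)"
  by (cases k) (auto simp: pw_zero mult.zero_left mult.zero_right)

lemma dex_zero [simp]: "dex 0 U = U"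
  unfolding dex_def dpw_zero
  by (subst suminf_finite[where N = "{1}"]) auto

lemma pw_commute: "A \<odot> B = B \<odot> A \<Longrightarrow> pw k A \<odot> B = B \<odot> pw k A"
proof (induction k)
  case (Suc k)
  have "pw (Suc k) A \<odot> B = A \<odot> (B \<odot> pw k A)"
    using Suc by (simp add: pw_Suc assoc)
  also have "\<dots> = B \<odot> pw (Suc k) A"
    using Suc(2) by (simp add: pw_Suc flip: assoc)
  finally show ?case .
qed auto

lemma ex_commute:
  assumes "A \<odot> B = B \<odot> A"
  shows "ex A \<odot> B = B \<odot> ex A"
proof -
  have "ex A \<odot> B = (\<Sum>k. (1 / fact k) *\<^sub>R pw k A \<odot> B)"
    unfolding ex_def by (intro bounded_linear.suminf[OF mult.bounded_linear_left] summable_ex)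
  also have "\<dots> = (\<Sum>k. B \<odot> ((1 / fact k) *\<^sub>R pw k A))"
    by (simp add: mult.scaleR_left mult.scaleR_right pw_commute[OF assms])
  also have "\<dots> = B \<odot> ex A"
    unfolding ex_def by (intro bounded_linear.suminf[OF mult.bounded_linear_right, symmetric] summable_ex)
  finally show ?thesis .
qed

lemma pw_scaleR: "pw k (t *\<^sub>R A) = t ^ k *\<^sub>R pw k A"
  by (induction k) (auto simp: pw_Suc mult.scaleR_left mult.scaleR_right)

lemma dpw_self: "dpw k (t *\<^sub>R A) A = (real k * t ^ (k - 1)) *\<^sub>R pw k A"
proof (induction k)
  case (Suc k)
  \<comment> \<open>For \<open>k = 0\<close> the truncated exponent \<open>k - 1\<close> is
    harmless, since the factor \<open>real k\<close> vanishes; hence the case split.\<close>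
  have "t * (real k * t ^ (k - 1)) = real k * t ^ k" "real k * t ^ (k - 1) * t = real k * t ^ k"
    by (cases k; simp)+
  then show ?case
    unfolding dpw.simps Suc
    by (simp add: pw_Suc pw_scaleR mult.scaleR_left mult.scaleR_right scaleR_add_left distrib_right)
qed auto

lemma dex_self: "dex (t *\<^sub>R A) A = A \<odot> ex (t *\<^sub>R A)"
proof -
  have "(\<lambda>k. (1 / fact k) *\<^sub>R pw k (t *\<^sub>R A)) sums ex (t *\<^sub>R A)"
    unfolding ex_def by (intro summable_sums summable_ex)
  then have 1: "(\<lambda>k. A \<odot> ((1 / fact k) *\<^sub>R pw k (t *\<^sub>R A))) sums (A \<odot> ex (t *\<^sub>R A))"
    by (rule mult.bounded_linear_right[THEN bounded_linear.sums])
  have "(\<lambda>k. (1 / fact (Suc k)) *\<^sub>R dpw (Suc k) (t *\<^sub>R A) A) sums (dex (t *\<^sub>R A) A)"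
    using summable_dex[of "t *\<^sub>R A" A, THEN summable_sums]
    by (subst sums_Suc_iff) (simp add: dex_def)
  moreover have "(1 / fact (Suc k)) *\<^sub>R dpw (Suc k) (t *\<^sub>R A) A = A \<odot> ((1 / fact k) *\<^sub>R pw k (t *\<^sub>R A))" for k
  proof -
    have "1 / fact (Suc k) * (real (Suc k) * t ^ k) = 1 / fact k * t ^ k"
      by (simp add: field_simps del: of_nat_Suc)
    then show ?thesis
      unfolding dpw_self pw_Suc pw_scaleR mult.scaleR_right scaleR_scaleR by simp
  qed
  ultimately show ?thesis
    using 1 sums_unique2 by fastforce
qed

lemma ex_scaleR_deriv:
  "((\<lambda>t. ex (t *\<^sub>R A)) has_vector_derivative A \<odot> ex (t *\<^sub>R A)) (at t within S)"
proof -
  have "((\<lambda>t. ex (t *\<^sub>R A)) has_derivative (\<lambda>h. dex (t *\<^sub>R A) (h *\<^sub>R A))) (at t within S)"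
    by (rule has_derivative_compose[OF _ ex_has_derivative]) (auto intro!: derivative_eq_intros)
  then show ?thesis
    by (simp add: has_vector_derivative_def linear_cmul[OF linear_dex] dex_self)
qed

text \<open>The product of \<open>ex ((s + t) A)\<close> and \<open>ex (- t A)\<close> is constant
  in \<open>t\<close>; the same argument, run first for \<open>ex (- t A)\<close> times
  \<open>ex (t A)\<close>, supplies the inverse that removes the second factor.\<close>

lemma ex_add: "ex ((s + t) *\<^sub>R A) = ex (s *\<^sub>R A) \<odot> ex (t *\<^sub>R A)"
proof -
  have inv: "ex (t *\<^sub>R (-A)) \<odot> ex (t *\<^sub>R A) = one" for t A
  proof -
    have c: "A \<odot> ex (- (t *\<^sub>R A)) = ex (- (t *\<^sub>R A)) \<odot> A" for t
      by (rule ex_commute[symmetric]) (simp add: mult.scaleR_left mult.scaleR_right mult.minus_left mult.minus_right)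
    have "((\<lambda>t. ex (t *\<^sub>R - A) \<odot> ex (t *\<^sub>R A)) has_vector_derivative 0) (at t)" for t
      using mult.has_vector_derivative[OF ex_scaleR_deriv[of "-A"] ex_scaleR_deriv[of A]]
      by (rule has_vector_derivative_eq_rhs) (simp add: mult.minus_left c[symmetric] flip: assoc)
    then have "ex (t *\<^sub>R - A) \<odot> ex (t *\<^sub>R A) = ex (0 *\<^sub>R - A) \<odot> ex (0 *\<^sub>R A)"
      by (rule vector_derivative_zero_imp_eq)
    then show ?thesis
      by simp
  qed
  have c: "A \<odot> ex (- (t *\<^sub>R A)) = ex (- (t *\<^sub>R A)) \<odot> A" for t
    by (rule ex_commute[symmetric]) (simp add: mult.scaleR_left mult.scaleR_right mult.minus_left mult.minus_right)
  have c2: "A \<odot> ex (t *\<^sub>R A) = ex (t *\<^sub>R A) \<odot> A" for t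
    by (rule ex_commute[symmetric]) (simp add: mult.scaleR_left mult.scaleR_right mult.minus_left mult.minus_right)
  have sh: "((\<lambda>t. ex ((s + t) *\<^sub>R A)) has_vector_derivative A \<odot> ex ((s + t) *\<^sub>R A)) (at t)" for t
  proof -
    have "((\<lambda>t. s + t) has_vector_derivative 1) (at t)"
      by (auto intro!: derivative_eq_intros)
    from vector_diff_chain_at[OF this ex_scaleR_deriv[of A]] show ?thesis
      by (simp add: o_def)
  qed
  have "((\<lambda>t. ex ((s + t) *\<^sub>R A) \<odot> ex (t *\<^sub>R - A)) has_vector_derivative 0) (at t)" for t
    using mult.has_vector_derivative[OF sh ex_scaleR_deriv[of "-A"]]
    by (rule has_vector_derivative_eq_rhs) (simp add: mult.minus_left mult.minus_right c2 assoc)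
  then have "ex ((s + t) *\<^sub>R A) \<odot> ex (t *\<^sub>R - A) = ex ((s + 0) *\<^sub>R A) \<odot> ex (0 *\<^sub>R - A)"
    by (rule vector_derivative_zero_imp_eq)
  then have "ex ((s + t) *\<^sub>R A) \<odot> ex (t *\<^sub>R - A) \<odot> ex (t *\<^sub>R A) = ex (s *\<^sub>R A) \<odot> ex (t *\<^sub>R A)"
    by simp
  then show ?thesis
    by (simp add: inv[simplified] assoc)
qed

lemma ex_minus: "ex (- A) \<odot> ex A = one" "ex A \<odot> ex (- A) = one"
  using ex_add[of "-1" 1 A] ex_add[of 1 "-1" A] by simp_all

end

text \<open>Dual numbers \<open>A + \<epsilon> U\<close>: the second component of their exponential is the derivative of the exponential
  of the algebra, so differentiability bootstraps.\<close>

definition dual_mult :: "('a::euclidean_space \<Rightarrow> 'a \<Rightarrow> 'a) \<Rightarrow> 'a \<times> 'a \<Rightarrow> 'a \<times> 'a \<Rightarrow> 'a \<times> 'a" where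
  "dual_mult m p q = (m (fst p) (fst q), m (fst p) (snd q) + m (snd p) (fst q))"

lemma dual_mult_Pair: "dual_mult m (a, b) (c, d) = (m a c, m a d + m b c)"
  by (simp add: dual_mult_def)

context euclidean_algebra
begin

lemma dual_algebra: "euclidean_algebra (dual_mult (\<odot>)) (one, 0)"
proof (rule euclidean_algebra.intro)
  show "bounded_bilinear (dual_mult (\<odot>))"
    unfolding bilinear_conv_bounded_bilinear[symmetric] bilinear_def
    by (auto intro!: linearI simp: dual_mult_def mult.add_left mult.add_right mult.scaleR_left
        mult.scaleR_right scaleR_add_right)
qed (auto simp: dual_mult_def assoc mult.add_left mult.add_right mult.zero_left mult.zero_right)

interpretation dual: euclidean_algebra "dual_mult (\<odot>)" "(one, 0)"
  by (rule dual_algebra)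

lemma dual_pw: "dual.pw k (A, U) = (pw k A, dpw k A U)"
  by (induction k) (auto simp: dual.pw_Suc pw_Suc dual_mult_Pair)

lemma dual_ex: "dual.ex (A, U) = (ex A, dex A U)"
proof -
  have "dual.ex p = (fst (dual.ex p), snd (dual.ex p))" for p
    by simp
  moreover have "fst (dual.ex (A, U)) = ex A"
    unfolding dual.ex_def ex_def
    by (subst bounded_linear.suminf[OF bounded_linear_fst dual.summable_ex]) (simp add: dual_pw)
  moreover have "snd (dual.ex (A, U)) = dex A U"
    unfolding dual.ex_def dex_def
    by (subst bounded_linear.suminf[OF bounded_linear_snd dual.summable_ex]) (simp add: dual_pw)
  ultimately show ?thesis
    by metis
qed

lemma dex_has_derivative:
  "((\<lambda>p. dex (fst p) (snd p)) has_derivative (\<lambda>q. snd (dual.dex p q))) (at p)"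
proof -
  have "((\<lambda>p. snd (dual.ex p)) has_derivative (\<lambda>q. snd (dual.dex p q))) (at p)"
    by (intro has_derivative_snd dual.ex_has_derivative)
  moreover have "snd (dual.ex p) = dex (fst p) (snd p)" for p
    by (cases p) (simp add: dual_ex)
  ultimately show ?thesis
    by simp
qed

text \<open>The dual number \<open>(0, U)\<close> squares to zero, so only the terms up to
  \<open>k = 2\<close> of the dual series survive. The result is the derivative of
  \<open>dex\<close> at base point 0, read off from the term \<open>A^2 / 2\<close> of exp; it is
  the only second-order information that the geodesic equation uses.\<close>

lemma dex_second_order:
  "snd (dual.dex (0, U) (A, V)) = V + (1 / 2) *\<^sub>R (A \<odot> U + U \<odot> A)"
proof -
  have p: "dual.pw (Suc (Suc k)) (0, U) = 0" for k
    by (induction k) (simp_all add: dual.pw_Suc dual_mult_Pair zero_prod_def mult.zero_left mult.zero_right)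
  have d2: "dual.dpw (Suc (Suc 0)) (0, U) (A, V) = (0, A \<odot> U + U \<odot> A)"
    by (simp add: dual.pw_Suc dual_mult_Pair zero_prod_def mult.zero_left mult.zero_right)
  have d: "dual.dpw (Suc (Suc (Suc k))) (0, U) (A, V) = 0" for k
  proof (induction k)
    case 0
    show ?case
      by (subst dual.dpw.simps(2), unfold d2 p) (simp add: dual_mult_Pair zero_prod_def mult.zero_left mult.zero_right)
  next
    case (Suc k)
    show ?case
      by (subst dual.dpw.simps(2), unfold Suc p) (simp add: dual_mult_Pair zero_prod_def mult.zero_left mult.zero_right)
  qed
  have "dual.dex (0, U) (A, V) = (\<Sum>k<3. (1 / fact k) *\<^sub>R dual.dpw k (0, U) (A, V))"
    unfolding dual.dex_def
  proof (rule suminf_finite)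
    fix n :: nat
    assume "n \<notin> {..<3}"
    then have "n = Suc (Suc (Suc (n - 3)))"
      by auto
    then show "(1 / fact n) *\<^sub>R dual.dpw n (0, U) (A, V) = 0"
      by (metis d scaleR_zero_right)
  qed auto
  also have "\<dots> = (A, V) + (1 / 2) *\<^sub>R (0, A \<odot> U + U \<odot> A)"
    using d2 by (simp add: numeral_3_eq_3 dual_mult_Pair zero_prod_def mult.zero_left mult.zero_right)
  finally show ?thesis
    by simp
qed

lemma dex_continuous: "continuous_on UNIV (\<lambda>p. dex (fst p) (snd p))"
  using has_derivative_continuous[OF dex_has_derivative] by (intro continuous_at_imp_continuous_on) auto

lemma ex_continuous: "continuous_on UNIV ex"
  by (meson continuous_at_imp_continuous_on ex_has_derivative has_derivative_continuous)

text \<open>A variant of exponential coordinates: with \<open>P\<close> the projection onto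
  \<open>\<mm>\<close>, a nearby group element splits as exp of an element of \<open>\<mm>\<close>
  times a factor that should lie in the isotropy group. They are coordinates on the whole algebra,
  so that the inverse function theorem applies in a vector space; membership in the group is
  recovered afterwards.\<close>

definition fac :: "('a \<Rightarrow> 'a) \<Rightarrow> 'a \<Rightarrow> 'a" where
  "fac P X = ex (P X) \<odot> ex (X - P X)"

definition dfac :: "('a \<Rightarrow> 'a) \<Rightarrow> 'a \<Rightarrow> 'a \<Rightarrow> 'a" where
  "dfac P X W = ex (P X) \<odot> dex (X - P X) (W - P W) + dex (P X) (P W) \<odot> ex (X - P X)"

lemma fac_has_derivative:
  assumes "linear P"
  shows "(fac P has_derivative dfac P X) (at X)"
proof -
  have P: "bounded_linear P"
    using assms by (simp add: linear_conv_bounded_linear)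
  have 1: "((\<lambda>X. ex (P X)) has_derivative (\<lambda>W. dex (P X) (P W))) (at X)"
    by (rule has_derivative_compose[OF bounded_linear_imp_has_derivative[OF P] ex_has_derivative])
  have "((\<lambda>X. X - P X) has_derivative (\<lambda>W. W - P W)) (at X)"
    by (intro derivative_intros bounded_linear_imp_has_derivative P)
  then have 2: "((\<lambda>X. ex (X - P X)) has_derivative (\<lambda>W. dex (X - P X) (W - P W))) (at X)"
    by (rule has_derivative_compose[OF _ ex_has_derivative])
  show ?thesis
    using mult.FDERIV[OF 1 2] unfolding fac_def[abs_def] dfac_def[abs_def] .
qed

lemma fac_zero: "linear P \<Longrightarrow> fac P 0 = one"
  by (simp add: fac_def linear_0)

lemma dfac_zero: "linear P \<Longrightarrow> dfac P 0 W = W"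
  by (simp add: dfac_def linear_0)

lemma dfac_continuous:
  assumes "linear P"
  shows "continuous_on UNIV (\<lambda>X. dfac P X W)"
proof -
  have P: "continuous_on UNIV P"
    by (simp add: assms linear_continuous_on linear_linear)
  have e: "continuous_on UNIV (\<lambda>X. ex (f X))" if "continuous_on UNIV f" for f :: "'a \<Rightarrow> 'a"
    using continuous_on_compose2[OF ex_continuous that] by simp
  have d: "continuous_on UNIV (\<lambda>X. dex (f X) V)" if "continuous_on UNIV f" for f :: "'a \<Rightarrow> 'a" and V
    using continuous_on_compose2[OF dex_continuous, of UNIV "\<lambda>X. (f X, V)"] that
    by (simp add: continuous_on_Pair)
  show ?thesis
    unfolding dfac_def by (intro continuous_on_add mult.continuous_on e d P continuous_on_diff continuous_on_id)
qed

text \<open>The derivative at 0 is \<open>P W + (W - P W) = W\<close> for every linear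
  \<open>P\<close>, so the inverse function theorem applies. In finite dimension, continuity of the
  derivative in operator norm reduces to continuity of its values at single vectors.\<close>

lemma fac_local_inverse:
  assumes "linear P"
  obtains U V G G' where "open U" "0 \<in> U" "open V" "homeomorphism U V (fac P) G"
    "\<And>y. y \<in> V \<Longrightarrow> (G has_derivative G' y) (at y)"
proof -
  define f' where "f' X = Blinfun (dfac P X)" for X
  have bl: "bounded_linear (dfac P X)" for X
    using fac_has_derivative[OF assms] has_derivative_bounded_linear by blast
  have f': "blinfun_apply (f' X) = dfac P X" for X
    by (simp add: f'_def bounded_linear_Blinfun_apply bl)
  have c: "continuous_on UNIV f'"
    by (rule continuous_on_blinfun_componentwise) (simp add: f' dfac_continuous[OF assms])
  have i: "id_blinfun o\<^sub>L f' 0 = id_blinfun"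
    by (rule blinfun_eqI) (simp add: f' dfac_zero[OF assms])
  have d: "(fac P has_derivative blinfun_apply (f' X)) (at X)" for X
    by (simp add: f' fac_has_derivative[OF assms])
  obtain U V G G' where "open U" "0 \<in> U" "open V" "homeomorphism U V (fac P) G"
    "\<And>y. y \<in> V \<Longrightarrow> (G has_derivative (G' y)) (at y)"
    using inverse_function_theorem[OF open_UNIV d c UNIV_I i] by metis
  then show ?thesis
    using that by blast
qed

end

section \<open>Lifting curves through the coordinates \<open>fac P\<close>\<close>

context euclidean_algebra
begin

interpretation dual: euclidean_algebra "dual_mult (\<odot>)" "(one, 0)"
  by (rule dual_algebra)

text \<open>Over the dual numbers \<open>fac\<close> becomes the tangent map of \<open>fac\<close>;
  inverting it locally lifts a point and a velocity at once.\<close>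

lemma dual_fac: "dual.fac (map_prod P P) (X, W) = (fac P X, dfac P X W)"
  by (simp add: dual.fac_def fac_def dfac_def dual_ex dual_mult_Pair)

text \<open>The pair of the curve and its velocity is differentiable, hence so is its image under
  the local inverse of the tangent map; the second component of that image turns out to be the
  derivative of the first, which makes \<open>x\<close> twice differentiable. The velocity at
  \<open>t0\<close> must be small for the pair to lie in the domain of this inverse. Injectivity on
  a ball is exported as well, to recognise skew-Hermitian coordinates later.\<close>

lemma fac_lift_curve:
  assumes P: "linear P"
  obtains \<delta> where "\<delta> > 0" "inj_on (fac P) (ball 0 \<delta>)"
    "\<And>\<gamma> \<gamma>' \<gamma>'' t0 \<epsilon>. \<lbrakk>\<epsilon> > 0; \<gamma> t0 = one; norm (\<gamma>' t0) < \<delta>;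
      \<And>t. t \<in> ball t0 \<epsilon> \<Longrightarrow> (\<gamma> has_vector_derivative \<gamma>' t) (at t);
      \<And>t. t \<in> ball t0 \<epsilon> \<Longrightarrow> (\<gamma>' has_vector_derivative \<gamma>'' t) (at t)\<rbrakk> \<Longrightarrow>
      \<exists>\<epsilon>'>0. \<exists>x x' x''. \<epsilon>' \<le> \<epsilon> \<and> x t0 = 0 \<and> (\<forall>t\<in>ball t0 \<epsilon>'. fac P (x t) = \<gamma> t \<and>
        (x has_vector_derivative x' t) (at t) \<and> (x' has_vector_derivative x'' t) (at t))"
proof -
  have lin: "linear (map_prod P P)"
    using P by (auto intro!: linearI simp: linear_add linear_cmul)
  obtain U V G G' where U: "open U" "0 \<in> U" and V: "open V"
    and hom: "homeomorphism U V (dual.fac (map_prod P P)) G"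
    and G: "\<And>y. y \<in> V \<Longrightarrow> (G has_derivative G' y) (at y)"
    using dual.fac_local_inverse[OF lin] by metis
  have GU: "G q \<in> U" "dual.fac (map_prod P P) (G q) = q" if "q \<in> V" for q
    using hom that by (auto simp: homeomorphism_def)
  have FV: "dual.fac (map_prod P P) p \<in> V" "G (dual.fac (map_prod P P) p) = p" if "p \<in> U" for p
    using hom that by (auto simp: homeomorphism_def)
  obtain d where d: "d > 0" "ball 0 d \<subseteq> U"
    using U openE by blast
  have dU: "(X, W) \<in> U" if "norm X < d / 2" "norm W < d / 2" for X W
  proof -
    have "norm (X, W) < d"
      using norm_Pair_le[of X W] that by simp
    then show ?thesis
      using d(2) by auto
  qed
  show ?thesis
  proof (rule that)
    show "d / 2 > 0"
      using d by simp
    show "inj_on (fac P) (ball 0 (d / 2))"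
    proof (rule inj_onI)
      fix X Y
      assume XY: "X \<in> ball 0 (d / 2)" "Y \<in> ball 0 (d / 2)" "fac P X = fac P Y"
      have "dfac P X 0 = 0" "dfac P Y 0 = 0"
        using fac_has_derivative[OF P] has_derivative_linear linear_0 by blast+
      then have "dual.fac (map_prod P P) (X, 0) = dual.fac (map_prod P P) (Y, 0)"
        using XY by (simp add: dual_fac)
      moreover have "(X, 0) \<in> U" "(Y, 0) \<in> U"
        using XY d dU by auto
      ultimately show "X = Y"
        using FV(2) by (metis prod.inject)
    qed
    fix \<gamma> \<gamma>' \<gamma>'' t0 and \<epsilon> :: real
    assume \<epsilon>: "\<epsilon> > 0" and start: "\<gamma> t0 = one" "norm (\<gamma>' t0) < d / 2"
      and der: "\<And>t. t \<in> ball t0 \<epsilon> \<Longrightarrow> (\<gamma> has_vector_derivative \<gamma>' t) (at t)"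
        "\<And>t. t \<in> ball t0 \<epsilon> \<Longrightarrow> (\<gamma>' has_vector_derivative \<gamma>'' t) (at t)"
    define q where "q t = (\<gamma> t, \<gamma>' t)" for t
    define y where "y t = G (q t)" for t
    define y' where "y' t = G' (q t) (\<gamma>' t, \<gamma>'' t)" for t
    have qd: "(q has_vector_derivative (\<gamma>' t, \<gamma>'' t)) (at t)" if "t \<in> ball t0 \<epsilon>" for t
      unfolding q_def by (intro has_vector_derivative_Pair der that)
    have "isCont q t0"
      using qd \<epsilon> by (meson centre_in_ball has_vector_derivative_continuous)
    then have "(q \<longlongrightarrow> q t0) (nhds t0)"
      by (simp add: continuous_at tendsto_at_iff_tendsto_nhds)
    moreover have 0: "(0, \<gamma>' t0) \<in> U"
      using start d by (intro dU) auto
    have q0: "q t0 = dual.fac (map_prod P P) (0, \<gamma>' t0)"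
      by (simp add: dual_fac q_def start fac_zero[OF P] dfac_zero[OF P])
    then have "q t0 \<in> V"
      using FV 0 by simp
    ultimately have "eventually (\<lambda>t. q t \<in> V) (nhds t0)"
      using V topological_tendstoD by blast
    then obtain e where e: "e > 0" "\<And>t. t \<in> ball t0 e \<Longrightarrow> q t \<in> V"
      by (auto simp: eventually_nhds_metric dist_commute)
    define \<epsilon>' where "\<epsilon>' = min e \<epsilon>"
    have yd: "(y has_vector_derivative y' t) (at t)" if "t \<in> ball t0 \<epsilon>'" for t
    proof -
      have "t \<in> ball t0 \<epsilon>" "q t \<in> V"
        using that e by (auto simp: \<epsilon>'_def)
      from has_derivative_compose[OF qd[OF this(1), unfolded has_vector_derivative_def] G[OF this(2)]]
      have "(y has_derivative (\<lambda>h. G' (q t) (h *\<^sub>R (\<gamma>' t, \<gamma>'' t)))) (at t)"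
        by (simp add: y_def[abs_def])
      moreover have "linear (G' (q t))"
        using G[OF \<open>q t \<in> V\<close>] has_derivative_linear by blast
      ultimately show ?thesis
        by (simp add: has_vector_derivative_def y'_def linear_cmul del: scaleR_Pair)
    qed
    have xd: "((\<lambda>t. fst (y t)) has_vector_derivative fst (y' t)) (at t)"
      and ud: "((\<lambda>t. snd (y t)) has_vector_derivative snd (y' t)) (at t)" if "t \<in> ball t0 \<epsilon>'" for t
      using yd[OF that] by (auto intro!: derivative_eq_intros bounded_linear.has_vector_derivative[OF bounded_linear_fst]
          bounded_linear.has_vector_derivative[OF bounded_linear_snd])
    have lift: "fac P (fst (y t)) = \<gamma> t" "dfac P (fst (y t)) (snd (y t)) = \<gamma>' t" "y t \<in> U"
      if "t \<in> ball t0 \<epsilon>'" for t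
    proof -
      have "q t \<in> V"
        using that e by (auto simp: \<epsilon>'_def)
      then have "dual.fac (map_prod P P) (fst (y t), snd (y t)) = q t" "y t \<in> U"
        by (auto simp: y_def GU)
      then show "fac P (fst (y t)) = \<gamma> t" "dfac P (fst (y t)) (snd (y t)) = \<gamma>' t" "y t \<in> U"
        by (auto simp only: dual_fac q_def prod.inject)
    qed
    have eq: "fst (y' t) = snd (y t)" if t: "t \<in> ball t0 \<epsilon>'" for t
    proof -
      have "((\<lambda>t. fac P (fst (y t))) has_derivative (\<lambda>h. dfac P (fst (y t)) (h *\<^sub>R fst (y' t)))) (at t)"
        using has_derivative_compose[OF xd[OF t, unfolded has_vector_derivative_def] fac_has_derivative[OF P]] .
      moreover have l: "linear (dfac P (fst (y t)))"
        using fac_has_derivative[OF P] has_derivative_linear by blast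
      ultimately have "((\<lambda>t. fac P (fst (y t))) has_vector_derivative dfac P (fst (y t)) (fst (y' t))) (at t)"
        by (simp add: has_vector_derivative_def linear_cmul)
      then have "(\<gamma> has_vector_derivative dfac P (fst (y t)) (fst (y' t))) (at t)"
        by (rule has_vector_derivative_transform_within_open[where S = "ball t0 \<epsilon>'"]) (use t lift in auto)
      moreover have "(\<gamma> has_vector_derivative \<gamma>' t) (at t)"
        using t by (intro der) (auto simp: \<epsilon>'_def)
      ultimately have *: "dfac P (fst (y t)) (fst (y' t)) = \<gamma>' t"
        by (rule vector_derivative_unique_at)
      \<comment> \<open>Both \<open>fst (y' t)\<close> and \<open>snd (y t)\<close> are sent to
        \<open>\<gamma>' t\<close>. A short piece of the line from the latter towards the former
        stays in \<open>U\<close>, where the tangent map is injective, yet it is sent to a single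
        point; so the two vectors agree.\<close>
      define z where "z s = (fst (y t), snd (y t) + s *\<^sub>R (fst (y' t) - snd (y t)))" for s :: real
      have z: "dual.fac (map_prod P P) (z s) = q t" for s
        using * lift[OF t] l by (simp add: z_def dual_fac q_def linear_add linear_cmul linear_diff)
      have "isCont z 0"
        unfolding z_def by (intro continuous_intros)
      then have "(z \<longlongrightarrow> z 0) (nhds 0)"
        by (simp add: continuous_at tendsto_at_iff_tendsto_nhds)
      moreover have "z 0 \<in> U"
        using lift[OF t] by (simp add: z_def)
      ultimately have "eventually (\<lambda>s. z s \<in> U) (nhds 0)"
        using U(1) topological_tendstoD by blast
      then obtain r where r: "r > 0" "\<And>s. \<bar>s\<bar> < r \<Longrightarrow> z s \<in> U"
        by (auto simp: eventually_nhds_metric dist_real_def)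
      have "z (r / 2) = z 0"
        using FV(2)[of "z (r / 2)"] FV(2)[of "z 0"] r z by simp
      then show ?thesis
        using r by (simp add: z_def prod_eq_iff)
    qed
    show "\<exists>\<epsilon>'>0. \<exists>x x' x''. \<epsilon>' \<le> \<epsilon> \<and> x t0 = 0 \<and> (\<forall>t\<in>ball t0 \<epsilon>'. fac P (x t) = \<gamma> t \<and>
        (x has_vector_derivative x' t) (at t) \<and> (x' has_vector_derivative x'' t) (at t))"
    proof (rule exI[of _ \<epsilon>'], intro conjI exI ballI)
      show "\<epsilon>' > 0" "\<epsilon>' \<le> \<epsilon>"
        using e \<epsilon> by (auto simp: \<epsilon>'_def)
      show "fst (y t0) = 0"
        using q0 FV(2)[OF 0] by (simp add: y_def)
      fix t
      assume t: "t \<in> ball t0 \<epsilon>'"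
      show "fac P (fst (y t)) = \<gamma> t"
        using lift[OF t] by simp
      show "((\<lambda>t. fst (y t)) has_vector_derivative snd (y t)) (at t)"
        using xd[OF t] eq[OF t] by simp
      show "((\<lambda>t. snd (y t)) has_vector_derivative snd (y' t)) (at t)"
        by (rule ud[OF t])
    qed
  qed
qed

end

subsection \<open>Quadratic differential equations\<close>

text \<open>The integral from 0 to \<open>s\<close> for either sign of \<open>s\<close>, written
  with base point \<open>-\<tau>\<close> because the integral over \<open>{0..s}\<close> is zero for
  negative \<open>s\<close>.\<close>

lemma norm_integral_diff_le:
  fixes F :: "real \<Rightarrow> 'a::euclidean_space"
  assumes F: "continuous_on {-\<tau>..\<tau>} F" and B: "\<And>t. t \<in> {-\<tau>..\<tau>} \<Longrightarrow> norm (F t) \<le> B" and s: "s \<in> {-\<tau>..\<tau>}"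
  shows "norm (integral {-\<tau>..s} F - integral {-\<tau>..0} F) \<le> B * \<bar>s\<bar>"
proof -
  have int: "F integrable_on {a..b}" if "-\<tau> \<le> a" "b \<le> \<tau>" for a b
    using that by (intro integrable_continuous_interval continuous_on_subset[OF F]) auto
  show ?thesis
  proof (cases "s \<ge> 0")
    case True
    then have "integral {-\<tau>..0} F + integral {0..s} F = integral {-\<tau>..s} F"
      using s by (intro Henstock_Kurzweil_Integration.integral_combine int) auto
    then have "integral {-\<tau>..s} F - integral {-\<tau>..0} F = integral {0..s} F"
      by (metis add_diff_cancel_left')
    moreover have "norm (integral {0..s} F) \<le> B * (s - 0)"
      using True s by (intro integral_bound continuous_on_subset[OF F]) (auto intro!: B)
    ultimately show ?thesis
      using True by (simp add: algebra_simps)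
  next
    case False
    then have "integral {-\<tau>..s} F + integral {s..0} F = integral {-\<tau>..0} F"
      using s by (intro Henstock_Kurzweil_Integration.integral_combine int) auto
    then have "integral {-\<tau>..s} F - integral {-\<tau>..0} F = - integral {s..0} F"
      by (simp add: algebra_simps)
    moreover have "norm (integral {s..0} F) \<le> B * (0 - s)"
      using False s by (intro integral_bound continuous_on_subset[OF F]) (auto intro!: B)
    ultimately show ?thesis
      using False by simp
  qed
qed

text \<open>Picard iteration as a contraction on a closed unit ball of bounded continuous functions.
  Functions on the whole line, with the time clamped by \<open>cl\<close> to an interval, give
  access to their complete metric.\<close>

lemma quadratic_ode_solution:
  fixes p :: "'a::euclidean_space \<Rightarrow> 'a \<Rightarrow> 'a"
  assumes "bounded_bilinear p"
  obtains \<tau> y where "\<tau> > 0" "y 0 = y0"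
    "\<And>t. t \<in> {-\<tau><..<\<tau>} \<Longrightarrow> (y has_vector_derivative p (y t) (y t)) (at t)"
proof -
  interpret p: bounded_bilinear p
    by fact
  obtain K where K: "K > 0" "\<And>a b. norm (p a b) \<le> norm a * norm b * K"
    using p.pos_bounded by blast
  define R where "R = norm y0 + 1"
  have R: "R > 0"
    by (simp add: R_def add_nonneg_pos)
  \<comment> \<open>The first bound keeps the iterates within distance 1 of \<open>y0\<close>, the
    second makes the Picard map a contraction with factor 1/2.\<close>
  define \<tau> where "\<tau> = min (1 / (K * R * R)) (1 / (4 * K * R))"
  have \<tau>: "\<tau> > 0" "K * R * R * \<tau> \<le> 1" "2 * K * R * \<tau> \<le> 1 / 2"
  proof -
    show "\<tau> > 0"
      using K R by (simp add: \<tau>_def)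
    have "\<tau> \<le> 1 / (K * R * R)" "\<tau> \<le> 1 / (4 * K * R)"
      by (simp_all add: \<tau>_def)
    then show "K * R * R * \<tau> \<le> 1" "2 * K * R * \<tau> \<le> 1 / 2"
      using K R by (simp_all add: pos_le_divide_eq mult_ac)
  qed
  define q where "q f t = p (f t) (f t)" for f :: "real \<Rightarrow> 'a" and t
  define J where "J f s = integral {-\<tau>..s} (q f) - integral {-\<tau>..0} (q f)" for f s
  define cl where "cl t = max (-\<tau>) (min \<tau> t)" for t
  have cl: "cl t \<in> {-\<tau>..\<tau>}" for t
    using \<tau> by (auto simp: cl_def)
  have clc: "continuous_on UNIV cl"
    unfolding cl_def by (intro continuous_intros)
  define S where "S = cball (const_bcontfun y0) 1 \<inter> (UNIV :: (real \<Rightarrow>\<^sub>C 'a) set)"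
  have qc: "continuous_on A (q (apply_bcontfun f))" for f A
    unfolding q_def by (intro p.continuous_on continuous_on_apply_bcontfun continuous_on_id)
  have SR: "norm (apply_bcontfun f t) \<le> R" if "f \<in> S" for f t
  proof -
    have "dist (apply_bcontfun (const_bcontfun y0) t) (apply_bcontfun f t) \<le> 1"
      using that dist_bounded[of "const_bcontfun y0" t f] by (auto simp: S_def)
    then show ?thesis
      using norm_triangle_sub[of "apply_bcontfun f t" y0]
      by (simp add: R_def dist_norm norm_minus_commute)
  qed
  have qR: "norm (q (apply_bcontfun f) t) \<le> K * R * R" if "f \<in> S" for f t
  proof -
    have "norm (q (apply_bcontfun f) t) \<le> norm (apply_bcontfun f t) * norm (apply_bcontfun f t) * K"
      by (simp add: q_def K)
    also have "\<dots> \<le> R * R * K"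
      using K R SR[OF that] by (intro mult_right_mono mult_mono) auto
    finally show ?thesis
      by (simp add: mult_ac)
  qed
  have J1: "norm (J (apply_bcontfun f) (cl t)) \<le> 1" if "f \<in> S" for f t
  proof -
    have "norm (J (apply_bcontfun f) (cl t)) \<le> K * R * R * \<bar>cl t\<bar>"
      unfolding J_def by (intro norm_integral_diff_le qc qR[OF that] cl)
    also have "\<dots> \<le> K * R * R * \<tau>"
      using K R cl[of t] by (intro mult_left_mono) auto
    finally show ?thesis
      using \<tau> by simp
  qed
  define T where "T f = Bcontfun (\<lambda>t. y0 + J (apply_bcontfun f) (cl t))" for f
  have T: "apply_bcontfun (T f) = (\<lambda>t. y0 + J (apply_bcontfun f) (cl t))" if "f \<in> S" for f
    unfolding T_def
  proof (rule Bcontfun_inverse, unfold bcontfun_def, intro CollectI conjI)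
    have "continuous_on {-\<tau>..\<tau>} (\<lambda>s. J (apply_bcontfun f) s)"
      unfolding J_def
      by (intro continuous_intros indefinite_integral_continuous_1 integrable_continuous_interval qc)
    then show "continuous_on UNIV (\<lambda>t. y0 + J (apply_bcontfun f) (cl t))"
      using cl by (intro continuous_intros continuous_on_compose2[OF _ clc]) auto
    show "bounded (range (\<lambda>t. y0 + J (apply_bcontfun f) (cl t)))"
      unfolding bounded_iff
      using J1[OF that] norm_triangle_ineq[of y0] by (intro exI[of _ "norm y0 + 1"]) (force intro: order_trans add_mono)
  qed
  have "\<exists>!f\<in>S. T f = f"
  proof (rule Banach_fix[where c = "1 / 2"])
    show "complete S"
      by (simp add: S_def complete_eq_closed)
    have "const_bcontfun y0 \<in> S"
      by (simp add: S_def)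
    then show "S \<noteq> {}"
      by blast
    show "T ` S \<subseteq> S"
    proof safe
      fix f
      assume f: "f \<in> S"
      have "dist (const_bcontfun y0) (T f) \<le> 1"
        using J1[OF f] by (intro dist_bound) (simp add: T[OF f] dist_norm)
      then show "T f \<in> S"
        by (simp add: S_def)
    qed
    show "dist (T f) (T g) \<le> 1 / 2 * dist f g" if f: "f \<in> S" and g: "g \<in> S" for f g
    proof (rule dist_bound)
      fix t
      let ?h = "\<lambda>s. q (apply_bcontfun f) s - q (apply_bcontfun g) s"
      have h: "norm (?h s) \<le> 2 * K * R * dist f g" for s
      proof -
        let ?a = "apply_bcontfun f s" and ?b = "apply_bcontfun g s"
        have ab: "norm (?a - ?b) \<le> dist f g"
          using dist_bounded[of f s g] by (simp add: dist_norm)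
        \<comment> \<open>Telescoping makes the quadratic map Lipschitz on the ball of radius
          \<open>R\<close>, with constant \<open>2 * K * R\<close>.\<close>
        have "?h s = p ?a (?a - ?b) + p (?a - ?b) ?b"
          by (simp add: q_def p.diff_left p.diff_right)
        also have "norm \<dots> \<le> norm ?a * norm (?a - ?b) * K + norm (?a - ?b) * norm ?b * K"
          using K(2) by (meson add_mono norm_triangle_le)
        also have "\<dots> \<le> R * dist f g * K + dist f g * R * K"
          using SR[OF f, of s] SR[OF g, of s] ab K R by (intro add_mono mult_right_mono mult_mono) auto
        finally show ?thesis
          by (simp add: algebra_simps)
      qed
      have "J (apply_bcontfun f) (cl t) - J (apply_bcontfun g) (cl t)
          = integral {-\<tau>..cl t} ?h - integral {-\<tau>..0} ?h"
        unfolding J_def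
        by (subst (1 2) integral_diff) (auto intro!: integrable_continuous_interval qc)
      also have "norm \<dots> \<le> 2 * K * R * dist f g * \<bar>cl t\<bar>"
        by (intro norm_integral_diff_le h cl continuous_intros qc)
      also have "\<dots> \<le> 2 * K * R * dist f g * \<tau>"
        using K R cl[of t] by (intro mult_left_mono) auto
      also have "\<dots> = 2 * K * R * \<tau> * dist f g"
        by (simp add: mult_ac)
      also have "\<dots> \<le> 1 / 2 * dist f g"
        using \<tau> by (intro mult_right_mono) auto
      finally show "dist (apply_bcontfun (T f) t) (apply_bcontfun (T g) t) \<le> 1 / 2 * dist f g"
        by (simp add: T f g dist_norm)
    qed
  qed auto
  then obtain f where f: "f \<in> S" "T f = f"
    by blast
  define y where "y = apply_bcontfun f"
  have y: "y t = y0 + J y (cl t)" for t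
    using fun_cong[OF T[OF f(1)], of t] f(2) by (simp add: y_def)
  show ?thesis
  proof (rule that[OF \<tau>(1), of y])
    have "cl 0 = 0"
      using \<tau> by (simp add: cl_def)
    then show "y 0 = y0"
      using y[of 0] by (simp add: J_def)
    fix t
    assume t: "t \<in> {-\<tau><..<\<tau>}"
    have "((\<lambda>s. integral {-\<tau>..s} (q y)) has_vector_derivative q y t) (at t within {-\<tau>..\<tau>})"
      using t qc[of _ f] by (intro integral_has_vector_derivative) (auto simp: y_def)
    then have "((\<lambda>s. integral {-\<tau>..s} (q y)) has_vector_derivative q y t) (at t)"
      using t by (simp add: at_within_Icc_at)
    then have "((\<lambda>s. y0 + J y s) has_vector_derivative q y t) (at t)"
      unfolding J_def by (auto intro!: derivative_eq_intros)
    then have "(y has_vector_derivative q y t) (at t)"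
    proof (rule has_vector_derivative_transform_within_open[where S = "{-\<tau><..<\<tau>}"])
      fix s
      assume "s \<in> {-\<tau><..<\<tau>}"
      then have "cl s = s"
        by (auto simp: cl_def)
      then show "y0 + J y s = y s"
        using y[of s] by simp
    qed (use t in auto)
    then show "(y has_vector_derivative p (y t) (y t)) (at t)"
      by (simp add: q_def)
  qed
qed

subsection \<open>Matrices\<close>

lemma exhaust_5:
  fixes x :: 5
  shows "x = 1 \<or> x = 2 \<or> x = 3 \<or> x = 4 \<or> x = 5"
proof (induct x)
  case (of_int z)
  \<comment> \<open>The representatives run from 0 to 4; the residue 0 is the index 5.\<close>
  then have "z = 0 \<or> z = 1 \<or> z = 2 \<or> z = 3 \<or> z = 4" by fastforce
  then show ?case by auto
qed

lemma forall_5: "(\<forall>i::5. P i) \<longleftrightarrow> P 1 \<and> P 2 \<and> P 3 \<and> P 4 \<and> P 5"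
  by (metis exhaust_5)

lemma UNIV_5: "UNIV = {1, 2, 3, 4, 5::5}"
  using exhaust_5 by auto

lemma sum_5: "sum f (UNIV::5 set) = f 1 + f 2 + f 3 + f 4 + f 5"
  unfolding UNIV_5 by (simp add: ac_simps)

lemma matrix_mult_entry_5:
  fixes A B :: cmat5
  shows "(A ** B) $ i $ j = A$i$1 * B$1$j + A$i$2 * B$2$j + A$i$3 * B$3$j + A$i$4 * B$4$j + A$i$5 * B$5$j"
  by (simp add: matrix_matrix_mult_def sum_5)

lemma conj_transpose_entry [simp]: "conj_transpose A $ i $ j = cnj (A $ j $ i)"
  by (simp add: conj_transpose_def)

lemma conj_transpose_add: "conj_transpose (A + B) = conj_transpose A + conj_transpose B"
  and conj_transpose_diff: "conj_transpose (A - B) = conj_transpose A - conj_transpose B"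
  and conj_transpose_scaleR: "conj_transpose (c *\<^sub>R A) = c *\<^sub>R conj_transpose A"
  and conj_transpose_conj_transpose [simp]: "conj_transpose (conj_transpose A) = A"
  and conj_transpose_zero [simp]: "conj_transpose 0 = 0"
  by (simp_all add: vec_eq_iff complex_eq_iff)

lemma conj_transpose_one [simp]: "conj_transpose (mat 1 :: cmat5) = mat 1"
  by (simp add: vec_eq_iff mat_def)

lemma conj_transpose_mult: "conj_transpose (A ** B) = conj_transpose (B :: cmat5) ** conj_transpose (A :: cmat5)"
  by (simp add: vec_eq_iff matrix_mult_entry_5 mult.commute)

lemma bounded_linear_conj_transpose: "bounded_linear (conj_transpose :: cmat5 \<Rightarrow> cmat5)"
  unfolding linear_conv_bounded_linear[symmetric]
  by (intro linearI conj_transpose_add conj_transpose_scaleR)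

lemma trace_diff: "trace (A - B) = trace A - trace (B :: cmat5)"
  and trace_minus: "trace (- A) = - trace (A :: cmat5)"
  and trace_scaleR: "trace (c *\<^sub>R A) = c *\<^sub>R trace (A :: cmat5)"
  and trace_zero [simp]: "trace (0 :: cmat5) = 0"
  by (simp_all add: trace_def sum_5 algebra_simps)

lemma bounded_linear_trace: "bounded_linear (trace :: cmat5 \<Rightarrow> complex)"
  unfolding linear_conv_bounded_linear[symmetric]
  by (intro linearI trace_add trace_scaleR)

interpretation mat5: euclidean_algebra "(**)" "mat 1 :: cmat5"
proof (rule euclidean_algebra.intro)
  show "bounded_bilinear ((**) :: cmat5 \<Rightarrow> cmat5 \<Rightarrow> cmat5)"
    unfolding bilinear_conv_bounded_bilinear[symmetric] bilinear_def
    by (auto intro!: linearI simp: vec_eq_iff matrix_mult_entry_5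
        algebra_simps)
qed (simp_all add: matrix_mul_assoc)

lemmas mult_left_deriv = bounded_linear.has_vector_derivative[OF mat5.mult.bounded_linear_left]
  and mult_right_deriv = bounded_linear.has_vector_derivative[OF mat5.mult.bounded_linear_right]
  and conj_transpose_deriv = bounded_linear.has_vector_derivative[OF bounded_linear_conj_transpose]

lemma mexp_eq_ex: "mexp = mat5.ex"
  unfolding mexp_def[abs_def] mat5.ex_def[abs_def] mat5.pw_def ..

lemma conj_transpose_mexp: "conj_transpose (mexp A) = mexp (conj_transpose A)"
proof -
  have p: "conj_transpose (mat5.pw k A) = mat5.pw k (conj_transpose A)" for k
  proof (induction k)
    case (Suc k)
    have "mat5.pw k (conj_transpose A) ** conj_transpose A = conj_transpose A ** mat5.pw k (conj_transpose A)"
      by (rule mat5.pw_commute) simp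
    then show ?case
      by (simp add: mat5.pw_Suc conj_transpose_mult Suc)
  qed simp
  show ?thesis
    unfolding mexp_eq_ex mat5.ex_def
    by (subst bounded_linear.suminf[OF bounded_linear_conj_transpose mat5.summable_ex])
      (simp add: conj_transpose_scaleR p)
qed

subsection \<open>Determinant and special unitary group\<close>

text \<open>Jacobi's formula at the identity. A permutation other than the identity moves at least
  two indices, so even after one factor is differentiated its product still contains an off-diagonal
  entry of the identity.\<close>

lemma det_has_vector_derivative_at_one:
  fixes M :: "real \<Rightarrow> cmat5"
  assumes M: "(M has_vector_derivative M') (at t)" and one: "M t = mat 1"
  shows "((\<lambda>s. det (M s)) has_vector_derivative trace M') (at t)"
proof -
  have e: "((\<lambda>s. M s $ i $ j) has_derivative (\<lambda>h. h *\<^sub>R (M' $ i $ j))) (at t)" for i j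
    using bounded_linear.has_derivative[OF bounded_linear_compose[OF bounded_linear_vec_nth bounded_linear_vec_nth], 
        OF M[unfolded has_vector_derivative_def], of i j]
    by simp
  define D where "D p h = of_int (sign p) * (\<Sum>i\<in>UNIV. h *\<^sub>R (M' $ i $ p i) * (\<Prod>j\<in>UNIV - {i}. M t $ j $ p j))"
    for p and h :: real
  have "((\<lambda>s. det (M s)) has_derivative (\<lambda>h. \<Sum>p\<in>{p. p permutes UNIV}. D p h)) (at t)"
    unfolding det_def D_def
    by (intro has_derivative_sum has_derivative_mult_right has_derivative_prod e)
  moreover have "D p h = (if p = id then h *\<^sub>R trace M' else 0)" if p: "p permutes UNIV" for p h
  proof (cases "p = id")
    case True
    then show ?thesis
      by (simp add: D_def one mat_def trace_def scaleR_sum_right sign_id prod.neutral)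
  next
    case False
    have "(\<Prod>j\<in>UNIV - {i}. M t $ j $ p j) = 0" for i
    proof -
      obtain j where j: "p j \<noteq> j"
        using False by fastforce
      have "inj p"
        using p permutes_inj by blast
      then have "p (p j) \<noteq> p j"
        using j by (metis injD)
      then obtain l where "l \<noteq> i" "p l \<noteq> l"
        using j by metis
      then show ?thesis
        by (intro prod_zero) (auto simp: one mat_def intro!: bexI[of _ l])
    qed
    then show ?thesis
      using False by (simp add: D_def del: prod_zero_iff)
  qed
  then have "(\<Sum>p\<in>{p. p permutes UNIV}. D p h) = h *\<^sub>R trace M'" for h
    using permutes_id[of UNIV] by (simp add: sum.delta finite_permutations)
  ultimately show ?thesis
    by (simp add: has_vector_derivative_def)
qed

text \<open>Liouville's formula. At \<open>s = t\<close> the factor \<open>mexp ((s - t) A)\<close>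
  is the identity, where Jacobi's formula applies, and multiplicativity of \<open>det\<close>
  carries the result to \<open>mexp (t A)\<close>.\<close>

lemma det_mexp: "det (mexp A) = exp (trace A)"
proof -
  define f where "f t = det (mexp (t *\<^sub>R A)) * exp (- t *\<^sub>R trace A)" for t :: real
  have "((\<lambda>s. det (mexp (s *\<^sub>R A))) has_vector_derivative trace A * det (mexp (t *\<^sub>R A))) (at t)" for t
  proof -
    have "((\<lambda>s. mexp ((s - t) *\<^sub>R A)) has_vector_derivative 1 *\<^sub>R (A ** mexp ((t - t) *\<^sub>R A))) (at t)"
      using vector_diff_chain_at[of "\<lambda>s. s - t" 1 t "\<lambda>s. mexp (s *\<^sub>R A)", unfolded mexp_eq_ex, OF _ mat5.ex_scaleR_deriv]
      by (simp add: o_def mexp_eq_ex has_vector_derivative_diff_const has_vector_derivative_id)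
    then have "((\<lambda>s. det (mexp ((s - t) *\<^sub>R A))) has_vector_derivative trace A) (at t)"
      using det_has_vector_derivative_at_one by (fastforce simp: mexp_eq_ex)
    then have "((\<lambda>s. det (mexp ((s - t) *\<^sub>R A)) * det (mexp (t *\<^sub>R A)))
        has_vector_derivative trace A * det (mexp (t *\<^sub>R A))) (at t)"
      by (intro bounded_linear.has_vector_derivative[OF bounded_linear_mult_left])
    moreover have "det (mexp ((s - t) *\<^sub>R A)) * det (mexp (t *\<^sub>R A)) = det (mexp (s *\<^sub>R A))" for s
      using mat5.ex_add[of "s - t" t A] by (simp add: mexp_eq_ex det_mul)
    ultimately show ?thesis
      by simp
  qed
  moreover have "((\<lambda>s. exp (- s *\<^sub>R trace A)) has_vector_derivative exp (- t *\<^sub>R trace A) * - trace A) (at t)" for t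
    using exp_scaleR_has_vector_derivative_right[of "- trace A" t] by simp
  ultimately have "(f has_vector_derivative 0) (at t)" for t
    unfolding f_def
    by (rule has_vector_derivative_eq_rhs[OF has_vector_derivative_mult]) simp
  then have "f 1 = f 0"
    by (rule vector_derivative_zero_imp_eq)
  then show ?thesis
    by (simp add: f_def mexp_eq_ex exp_minus divide_simps)
qed

lemma SU5_iff: "g \<in> SU5 \<longleftrightarrow> conj_transpose g ** g = mat 1 \<and> det g = 1"
  by (simp add: SU5_def unitary_group_def)

lemma SU5_inverse:
  assumes "g \<in> SU5"
  shows "conj_transpose g ** g = mat 1" "g ** conj_transpose g = mat 1"
  using assms matrix_left_right_inverse[of g "conj_transpose g"] by (auto simp: SU5_iff)

lemma SU5_cancel:
  assumes "g \<in> SU5"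
  shows "conj_transpose g ** (g ** X) = X" "g ** (conj_transpose g ** X) = X"
    "X ** g ** conj_transpose g = X" "X ** conj_transpose g ** g = X"
  using SU5_inverse[OF assms]
  by (simp add: matrix_mul_assoc, simp add: matrix_mul_assoc, simp_all flip: matrix_mul_assoc)

lemma matrix_inv_SU5:
  assumes "g \<in> SU5"
  shows "matrix_inv g = conj_transpose g"
proof -
  have "matrix_inv g ** g = mat 1"
    unfolding matrix_inv_def using SU5_inverse[OF assms] someI[of "\<lambda>A'. g ** A' = mat 1 \<and> A' ** g = mat 1"]
    by blast
  then show ?thesis
    using SU5_cancel(3)[OF assms, of "matrix_inv g"] by simp
qed

lemma SU5_one [simp]: "mat 1 \<in> SU5"
  by (simp add: SU5_iff)

lemma SU5_mult [simp]:
  assumes "g \<in> SU5" "h \<in> SU5"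
  shows "g ** h \<in> SU5"
proof -
  have "conj_transpose h ** (conj_transpose g ** g) ** h = mat 1"
    using assms by (simp add: SU5_inverse)
  then show ?thesis
    using assms by (simp add: SU5_iff det_mul conj_transpose_mult matrix_mul_assoc)
qed

lemma SU5_conj_transpose [simp]:
  assumes "g \<in> SU5"
  shows "conj_transpose g \<in> SU5"
proof -
  have "det (conj_transpose g) * det g = 1"
    using assms SU5_inverse(1)[OF assms] by (metis det_I det_mul)
  then show ?thesis
    using assms SU5_inverse(2)[OF assms] by (simp add: SU5_iff)
qed

lemma su5_iff: "X \<in> su5 \<longleftrightarrow> conj_transpose X = - X \<and> trace X = 0"
  by (simp add: su5_def)

lemma subspace_su5: "subspace su5"
  by (auto simp: subspace_def su5_iff conj_transpose_add conj_transpose_scaleR trace_add trace_scaleR)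

lemma mexp_SU5:
  assumes "X \<in> su5"
  shows "mexp X \<in> SU5"
  using assms mat5.ex_minus(1)[of X]
  by (simp add: SU5_iff su5_iff det_mexp conj_transpose_mexp) (simp add: mexp_eq_ex)

lemma mexp_minus: "X \<in> su5 \<Longrightarrow> conj_transpose (mexp X) = mexp (- X)"
  by (simp add: conj_transpose_mexp su5_iff)

text \<open>Differentiating \<open>g^* g = 1\<close> gives skewness; translating by the adjoint of
  \<open>g t\<close> moves the curve to the identity, where Jacobi's formula turns the constant
  determinant into a vanishing trace.\<close>

lemma SU5_curve_su5:
  fixes g :: "real \<Rightarrow> cmat5"
  assumes g: "(g has_vector_derivative g') (at t)" and S: "open S" "t \<in> S" "\<And>s. s \<in> S \<Longrightarrow> g s \<in> SU5"
  shows "conj_transpose (g t) ** g' \<in> su5"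
proof -
  have "((\<lambda>s. conj_transpose (g s) ** g s) has_vector_derivative
      (conj_transpose (g t) ** g' + conj_transpose g' ** g t)) (at t)"
    by (intro mat5.mult.has_vector_derivative g conj_transpose_deriv)
  moreover have "((\<lambda>s. conj_transpose (g s) ** g s) has_vector_derivative 0) (at t)"
    by (rule has_vector_derivative_transform_within_open[OF has_vector_derivative_const S(1,2)])
      (use S(3) SU5_inverse in auto)
  ultimately have 1: "conj_transpose (g t) ** g' + conj_transpose g' ** g t = 0"
    by (rule vector_derivative_unique_at)
  have "((\<lambda>s. conj_transpose (g t) ** g s) has_vector_derivative conj_transpose (g t) ** g') (at t)"
    by (intro mult_right_deriv g)
  then have "((\<lambda>s. det (conj_transpose (g t) ** g s)) has_vector_derivative trace (conj_transpose (g t) ** g')) (at t)"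
    using S by (intro det_has_vector_derivative_at_one) (auto simp: SU5_inverse)
  moreover have "((\<lambda>s. det (conj_transpose (g t) ** g s)) has_vector_derivative 0) (at t)"
  proof (rule has_vector_derivative_transform_within_open[OF has_vector_derivative_const S(1,2)])
    fix s
    assume "s \<in> S"
    then have "conj_transpose (g t) ** g s \<in> SU5"
      using S by simp
    then show "1 = det (conj_transpose (g t) ** g s)"
      by (simp add: SU5_iff)
  qed
  ultimately have "trace (conj_transpose (g t) ** g') = 0"
    by (rule vector_derivative_unique_at)
  then show ?thesis
    using 1 by (simp add: su5_iff conj_transpose_mult eq_neg_iff_add_eq_0 add.commute)
qed

lemma su5_Ad:
  assumes "g \<in> SU5" "X \<in> su5"
  shows "g ** X ** conj_transpose g \<in> su5"
proof -
  have "trace (g ** X ** conj_transpose g) = trace (conj_transpose g ** (g ** X))"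
    by (rule trace_mul_sym)
  then show ?thesis
    using assms by (simp add: su5_iff SU5_inverse SU5_cancel conj_transpose_mult matrix_mul_assoc mat5.mult.minus_left mat5.mult.minus_right)
qed

lemma su5_bracket: "X \<in> su5 \<Longrightarrow> Y \<in> su5 \<Longrightarrow> lie_bracket X Y \<in> su5"
  by (simp add: su5_iff lie_bracket_def conj_transpose_diff conj_transpose_mult trace_diff trace_mul_sym[of X Y]
      mat5.mult.minus_left mat5.mult.minus_right)

subsection \<open>Isotropy group and isotropy complement\<close>

text \<open>\<open>SU2U2\<close> is a stabiliser: \<open>h E11 = E11\<close> fixes the first basis
  vector, and \<open>h P2 = P2 h\<close> preserves the coordinate plane 2, 3 and its orthogonal
  complement. Both equations are affine in \<open>h\<close>, so the same matrices describe
  \<open>\<hh>\<close>, and curves are tested by differentiating them.\<close>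

definition E11 :: cmat5 where
  "E11 = E_mat 1 1"

definition P2 :: cmat5 where
  "P2 = (\<chi> i j. if i = j \<and> (i = 2 \<or> i = 3) then 1 else 0)"

lemma E11_entry: "E11 $ i $ j = (if i = 1 \<and> j = 1 then 1 else 0)"
  by (simp add: E11_def E_mat_def)

lemma P2_entry: "P2 $ i $ j = (if i = j \<and> (i = 2 \<or> i = 3) then 1 else 0)"
  by (simp add: P2_def)

lemma conj_transpose_P2: "conj_transpose P2 = P2"
  by (simp add: vec_eq_iff P2_entry)

lemma mult_E11_eq_iff:
  "g ** E11 = E11 \<longleftrightarrow> g$1$1 = 1 \<and> g$2$1 = 0 \<and> g$3$1 = 0 \<and> g$4$1 = 0 \<and> g$5$1 = 0"
  for g :: cmat5
  by (simp add: vec_eq_iff matrix_mult_entry_5 E11_entry forall_5)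

lemma mult_E11_eq_0_iff:
  "g ** E11 = 0 \<longleftrightarrow> g$1$1 = 0 \<and> g$2$1 = 0 \<and> g$3$1 = 0 \<and> g$4$1 = 0 \<and> g$5$1 = 0"
  for g :: cmat5
  by (simp add: vec_eq_iff matrix_mult_entry_5 E11_entry forall_5)

lemma commute_P2_iff:
  "g ** P2 = P2 ** g \<longleftrightarrow> g$1$2 = 0 \<and> g$1$3 = 0 \<and> g$4$2 = 0 \<and> g$4$3 = 0 \<and> g$5$2 = 0 \<and> g$5$3 = 0 \<and>
     g$2$1 = 0 \<and> g$3$1 = 0 \<and> g$2$4 = 0 \<and> g$3$4 = 0 \<and> g$2$5 = 0 \<and> g$3$5 = 0"
  by (simp add: vec_eq_iff matrix_mult_entry_5 P2_entry forall_5) blast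

lemma unitary_2_iff:
  "A \<in> unitary_group \<longleftrightarrow>
     cnj (A$1$1) * A$1$1 + cnj (A$2$1) * A$2$1 = 1 \<and> cnj (A$1$1) * A$1$2 + cnj (A$2$1) * A$2$2 = 0 \<and>
     cnj (A$1$2) * A$1$1 + cnj (A$2$2) * A$2$1 = 0 \<and> cnj (A$1$2) * A$1$2 + cnj (A$2$2) * A$2$2 = (1::complex)"
  for A :: "complex^2^2"
  by (simp add: unitary_group_def vec_eq_iff matrix_matrix_mult_def sum_2 forall_2 mat_def)

lemma block_embed_entry:
  "block_embed A B $ 1 $ 1 = 1" "block_embed A B $ 1 $ 2 = 0" "block_embed A B $ 1 $ 3 = 0"
  "block_embed A B $ 1 $ 4 = 0" "block_embed A B $ 1 $ 5 = 0"
  "block_embed A B $ 2 $ 1 = 0" "block_embed A B $ 2 $ 2 = A$1$1" "block_embed A B $ 2 $ 3 = A$1$2"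
  "block_embed A B $ 2 $ 4 = 0" "block_embed A B $ 2 $ 5 = 0"
  "block_embed A B $ 3 $ 1 = 0" "block_embed A B $ 3 $ 2 = A$2$1" "block_embed A B $ 3 $ 3 = A$2$2"
  "block_embed A B $ 3 $ 4 = 0" "block_embed A B $ 3 $ 5 = 0"
  "block_embed A B $ 4 $ 1 = 0" "block_embed A B $ 4 $ 2 = 0" "block_embed A B $ 4 $ 3 = 0"
  "block_embed A B $ 4 $ 4 = B$1$1" "block_embed A B $ 4 $ 5 = B$1$2"
  "block_embed A B $ 5 $ 1 = 0" "block_embed A B $ 5 $ 2 = 0" "block_embed A B $ 5 $ 3 = 0"
  "block_embed A B $ 5 $ 4 = B$2$1" "block_embed A B $ 5 $ 5 = B$2$2"
  by (simp_all add: block_embed_def vector_def)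

lemma SU2U2_iff: "g \<in> SU2U2 \<longleftrightarrow> g \<in> SU5 \<and> g ** E11 = E11 \<and> g ** P2 = P2 ** g"
proof
  assume "g \<in> SU2U2"
  then obtain A B where g: "g = block_embed A B" and AB: "A \<in> unitary_group" "B \<in> unitary_group"
    and d: "det g = 1"
    by (auto simp: SU2U2_def)
  have "conj_transpose g ** g = mat 1"
    using AB unfolding unitary_2_iff
    by (simp add: vec_eq_iff forall_5 matrix_mult_entry_5 g block_embed_entry mat_def del: One_nat_def)
  then show "g \<in> SU5 \<and> g ** E11 = E11 \<and> g ** P2 = P2 ** g"
    using d by (simp add: SU5_iff mult_E11_eq_iff commute_P2_iff) (simp add: g block_embed_entry)
next
  assume g: "g \<in> SU5 \<and> g ** E11 = E11 \<and> g ** P2 = P2 ** g"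
  then have z: "g$1$1 = 1" "g$2$1 = 0" "g$3$1 = 0" "g$4$1 = 0" "g$5$1 = 0"
     "g$1$2 = 0" "g$1$3 = 0" "g$4$2 = 0" "g$4$3 = 0" "g$5$2 = 0" "g$5$3 = 0"
     "g$2$4 = 0" "g$3$4 = 0" "g$2$5 = 0" "g$3$5 = 0"
    by (auto simp: mult_E11_eq_iff commute_P2_iff)
  have u: "(conj_transpose g ** g) $ i $ j = (mat 1 :: cmat5) $ i $ j" for i j
    using g by (simp add: SU5_iff)
  \<comment> \<open>Columns 4 and 5 are orthogonal to the first column, which is the first basis
    vector.\<close>
  have z': "g$1$4 = 0" "g$1$5 = 0"
    using u[of 1 4] u[of 1 5] by (simp_all add: matrix_mult_entry_5 z mat_def)
  define A :: "complex^2^2" where "A = vector [vector [g$2$2, g$2$3], vector [g$3$2, g$3$3]]"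
  define B :: "complex^2^2" where "B = vector [vector [g$4$4, g$4$5], vector [g$5$4, g$5$5]]"
  have AB: "g = block_embed A B"
    by (simp add: vec_eq_iff forall_5 block_embed_entry z z' A_def B_def vector_2)
  have "A \<in> unitary_group"
    using u[of 2 2] u[of 2 3] u[of 3 2] u[of 3 3]
    by (simp add: unitary_2_iff A_def vector_2 matrix_mult_entry_5 z z' mat_def)
  moreover have "B \<in> unitary_group"
    using u[of 4 4] u[of 4 5] u[of 5 4] u[of 5 5]
    by (simp add: unitary_2_iff B_def vector_2 matrix_mult_entry_5 z z' mat_def)
  moreover have "det g = 1"
    using g by (simp add: SU5_iff)
  ultimately show "g \<in> SU2U2"
    using AB by (auto simp: SU2U2_def)
qed

lemma SU2U2_SU5: "g \<in> SU2U2 \<Longrightarrow> g \<in> SU5"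
  by (simp add: SU2U2_iff)

lemma SU2U2_one: "mat 1 \<in> SU2U2"
  by (simp add: SU2U2_iff)

lemma SU2U2_mult: "g \<in> SU2U2 \<Longrightarrow> h \<in> SU2U2 \<Longrightarrow> g ** h \<in> SU2U2"
  by (simp add: SU2U2_iff matrix_mul_assoc[symmetric]) (simp add: matrix_mul_assoc)

lemma SU2U2_conj_transpose:
  assumes "g \<in> SU2U2"
  shows "conj_transpose g \<in> SU2U2"
proof -
  have g: "g \<in> SU5" "g ** E11 = E11" "g ** P2 = P2 ** g"
    using assms by (auto simp: SU2U2_iff)
  have "conj_transpose g ** E11 = E11"
    using SU5_cancel(1)[OF g(1), of E11] g(2) by simp
  moreover have "conj_transpose g ** P2 = P2 ** conj_transpose g"
    using arg_cong[OF g(3), of conj_transpose] by (simp add: conj_transpose_mult conj_transpose_P2)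
  ultimately show ?thesis
    using g by (simp add: SU2U2_iff)
qed

lemma skew_entry: "conj_transpose X = - X \<Longrightarrow> cnj (X $ j $ i) = - X $ i $ j"
  by (metis conj_transpose_entry vector_uminus_component)

lemma e_mat_entry: "e_mat a b $ i $ j =
    (if i = of_nat a \<and> j = of_nat b then 1 else 0) - (if i = of_nat b \<and> j = of_nat a then 1 else 0)"
  by (simp add: e_mat_def E_mat_def)

lemma f_mat_entry: "f_mat a b $ i $ j = \<i> * (if a = b then (if i = of_nat a \<and> j = of_nat a then 1 else 0) else
    (if i = of_nat a \<and> j = of_nat b then 1 else 0) + (if i = of_nat b \<and> j = of_nat a then 1 else 0))"
  by (simp add: f_mat_def E_mat_def)

lemma cnj_E_mat: "cnj (E_mat a b $ i $ j) = E_mat b a $ j $ i"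
  by (simp add: E_mat_def)

lemma conj_transpose_e_mat: "conj_transpose (e_mat a b) = - e_mat a b"
  by (simp add: vec_eq_iff e_mat_def cnj_E_mat)

lemma conj_transpose_f_mat: "conj_transpose (f_mat a b) = - f_mat a b"
  by (cases "a = b") (simp_all add: vec_eq_iff f_mat_def cnj_E_mat)

text \<open>Linearisation of \<open>SU2U2_iff\<close>; equations pass to derivatives, conjugates and
  brackets more easily than a spanning set.\<close>

lemma hh_iff: "X \<in> \<hh> \<longleftrightarrow> X \<in> su5 \<and> X ** E11 = 0 \<and> X ** P2 = P2 ** X"
proof
  let ?S = "{X. X \<in> su5 \<and> X ** E11 = 0 \<and> X ** P2 = P2 ** X}"
  have "subspace ?S"
    using subspace_su5
    by (auto simp: subspace_def mat5.mult.add_left mat5.mult.add_right mat5.mult.scaleR_left mat5.mult.scaleR_right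
        mat5.mult.zero_left mat5.mult.zero_right)
  then have "\<hh> \<subseteq> ?S"
    unfolding \<hh>_def
    by (intro span_minimal)
      (simp_all add: su5_iff mult_E11_eq_0_iff commute_P2_iff e_mat_entry f_mat_entry trace_def sum_5
        conj_transpose_add conj_transpose_diff conj_transpose_e_mat conj_transpose_f_mat)
  then show "X \<in> su5 \<and> X ** E11 = 0 \<and> X ** P2 = P2 ** X" if "X \<in> \<hh>"
    using that by blast
next
  assume X: "X \<in> su5 \<and> X ** E11 = 0 \<and> X ** P2 = P2 ** X"
  then have z: "X$1$1 = 0" "X$2$1 = 0" "X$3$1 = 0" "X$4$1 = 0" "X$5$1 = 0"
     "X$1$2 = 0" "X$1$3 = 0" "X$4$2 = 0" "X$4$3 = 0" "X$5$2 = 0" "X$5$3 = 0"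
     "X$2$4 = 0" "X$3$4 = 0" "X$2$5 = 0" "X$3$5 = 0"
    by (auto simp: mult_E11_eq_0_iff commute_P2_iff)
  have s: "cnj (X $ j $ i) = - X $ i $ j" for i j
    using X skew_entry by (auto simp: su5_iff)
  have z': "X$1$4 = 0" "X$1$5 = 0"
    using s[of 4 1] s[of 5 1] z by simp_all
  have r: "Re (X $ i $ i) = 0" for i
    using s[of i i] by (simp add: complex_eq_iff)
  have t: "Im (X$2$2) + Im (X$3$3) + Im (X$4$4) + Im (X$5$5) = 0"
    using X z by (simp add: su5_iff trace_def sum_5 complex_eq_iff)
  have c: "X$3$2 = - cnj (X$2$3)" "X$5$4 = - cnj (X$4$5)"
    using s by auto
  \<comment> \<open>The half-differences give the traceless diagonal parts of the two blocks; the
    half-sum accounts for both blocks at once because the trace vanishes.\<close>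
  have "X = ((Im (X$2$2) - Im (X$3$3)) / 2) *\<^sub>R (f_mat 2 2 - f_mat 3 3)
      + Re (X$2$3) *\<^sub>R e_mat 2 3 + Im (X$2$3) *\<^sub>R f_mat 2 3
      + ((Im (X$4$4) - Im (X$5$5)) / 2) *\<^sub>R (f_mat 4 4 - f_mat 5 5)
      + Re (X$4$5) *\<^sub>R e_mat 4 5 + Im (X$4$5) *\<^sub>R f_mat 4 5
      + ((Im (X$2$2) + Im (X$3$3)) / 2) *\<^sub>R (f_mat 2 2 + f_mat 3 3 - f_mat 4 4 - f_mat 5 5)"
    using t by (simp add: vec_eq_iff forall_5 z z' c e_mat_entry f_mat_entry complex_eq_iff r field_simps)
  also have "\<dots> \<in> \<hh>"
    unfolding \<hh>_def by (intro span_add span_scale span_base) auto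
  finally show "X \<in> \<hh>" .
qed

lemma hh_entry:
  assumes "h \<in> \<hh>"
  shows "h$1$j = 0" "h$j$1 = 0" "h$2$4 = 0" "h$2$5 = 0" "h$3$4 = 0" "h$3$5 = 0"
    "h$4$2 = 0" "h$4$3 = 0" "h$5$2 = 0" "h$5$3 = 0" "cnj (h $ l $ k) = - h $ k $ l"
    "h$2$2 + h$3$3 + h$4$4 + h$5$5 = 0"
proof -
  show s: "cnj (h $ l $ k) = - h $ k $ l" for k l
    using assms skew_entry by (auto simp: su5_iff hh_iff)
  have z: "h$1$1 = 0" "h$2$1 = 0" "h$3$1 = 0" "h$4$1 = 0" "h$5$1 = 0"
     "h$4$2 = 0" "h$4$3 = 0" "h$5$2 = 0" "h$5$3 = 0"
     "h$2$4 = 0" "h$3$4 = 0" "h$2$5 = 0" "h$3$5 = 0"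
    using assms by (auto simp: mult_E11_eq_0_iff commute_P2_iff hh_iff)
  show j1: "h$j$1 = 0" for j
    using exhaust_5[of j] z by auto
  show "h$1$j = 0"
    using s[of j 1] j1 by simp
  show "h$2$4 = 0" "h$2$5 = 0" "h$3$4 = 0" "h$3$5 = 0" "h$4$2 = 0" "h$4$3 = 0" "h$5$2 = 0" "h$5$3 = 0"
    by (rule z)+
  show "h$2$2 + h$3$3 + h$4$4 + h$5$5 = 0"
    using assms z(1) by (simp add: hh_iff su5_iff trace_def sum_5)
qed

lemma subspace_hh: "subspace \<hh>"
  by (simp add: \<hh>_def)

lemma hh_su5: "X \<in> \<hh> \<Longrightarrow> X \<in> su5"
  by (simp add: hh_iff)

lemma hh_Ad:
  assumes "g \<in> SU2U2" "X \<in> \<hh>"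
  shows "g ** X ** conj_transpose g \<in> \<hh>"
proof -
  have g: "conj_transpose g \<in> SU2U2" "g \<in> SU5"
    using assms SU2U2_conj_transpose SU2U2_SU5 by auto
  have "g ** X ** conj_transpose g ** E11 = g ** (X ** (conj_transpose g ** E11))"
    by (simp add: matrix_mul_assoc)
  also have "\<dots> = 0"
    using g assms by (simp add: SU2U2_iff hh_iff mat5.mult.zero_right)
  finally have 1: "g ** X ** conj_transpose g ** E11 = 0" .
  have "g ** X ** conj_transpose g ** P2 = g ** (X ** (conj_transpose g ** P2))"
    by (simp add: matrix_mul_assoc)
  also have "\<dots> = g ** (X ** P2 ** conj_transpose g)"
    using g by (simp add: SU2U2_iff matrix_mul_assoc)
  also have "\<dots> = g ** P2 ** (X ** conj_transpose g)"
    using assms by (simp add: hh_iff matrix_mul_assoc)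
  also have "\<dots> = P2 ** (g ** X ** conj_transpose g)"
    using assms by (simp add: SU2U2_iff matrix_mul_assoc)
  finally have "g ** X ** conj_transpose g ** P2 = P2 ** (g ** X ** conj_transpose g)" .
  with 1 show ?thesis
    using assms g by (simp add: hh_iff su5_Ad)
qed

lemma hh_bracket:
  assumes "X \<in> \<hh>" "Y \<in> \<hh>"
  shows "lie_bracket X Y \<in> \<hh>"
proof -
  have "X ** Y ** P2 = P2 ** (X ** Y)" "Y ** X ** P2 = P2 ** (Y ** X)"
    using assms unfolding hh_iff by (metis matrix_mul_assoc)+
  moreover have "X ** Y ** E11 = 0" "Y ** X ** E11 = 0"
    using assms unfolding hh_iff by (metis matrix_mul_assoc mat5.mult.zero_right)+
  ultimately show ?thesis
    using assms su5_bracket by (simp add: hh_iff lie_bracket_def mat5.mult.diff_left mat5.mult.diff_right)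
qed

lemma mexp_hh:
  assumes X: "X \<in> \<hh>"
  shows "mexp X \<in> SU2U2"
proof -
  have "((\<lambda>t. mexp (t *\<^sub>R X) ** E11) has_vector_derivative 0) (at t)" for t
  proof -
    have "X ** mexp (t *\<^sub>R X) = mexp (t *\<^sub>R X) ** X"
      unfolding mexp_eq_ex
      by (rule mat5.ex_commute[symmetric]) (simp add: mat5.mult.scaleR_left mat5.mult.scaleR_right)
    then have "X ** mexp (t *\<^sub>R X) ** E11 = 0"
      using X by (simp add: hh_iff mat5.mult.zero_right flip: matrix_mul_assoc)
    moreover have "((\<lambda>t. mexp (t *\<^sub>R X) ** E11) has_vector_derivative X ** mexp (t *\<^sub>R X) ** E11) (at t)"
      unfolding mexp_eq_ex
      by (rule mult_left_deriv[OF mat5.ex_scaleR_deriv])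
    ultimately show ?thesis
      by simp
  qed
  then have "mexp (1 *\<^sub>R X) ** E11 = mexp (0 *\<^sub>R X) ** E11"
    by (rule vector_derivative_zero_imp_eq)
  moreover have "mexp X ** P2 = P2 ** mexp X"
    using X unfolding mexp_eq_ex hh_iff by (intro mat5.ex_commute) simp
  ultimately show ?thesis
    using mexp_SU5 hh_su5[OF X] by (simp add: SU2U2_iff) (simp add: mexp_eq_ex)
qed

lemma SU2U2_curve_hh:
  fixes k :: "real \<Rightarrow> cmat5"
  assumes k: "(k has_vector_derivative k') (at t)" and S: "open S" "t \<in> S" "\<And>s. s \<in> S \<Longrightarrow> k s \<in> SU2U2"
  shows "conj_transpose (k t) ** k' \<in> \<hh>"
proof -
  have "((\<lambda>s. k s ** E11) has_vector_derivative k' ** E11) (at t)"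
    by (rule mult_left_deriv[OF k])
  moreover have "((\<lambda>s. k s ** E11) has_vector_derivative 0) (at t)"
    by (rule has_vector_derivative_transform_within_open[OF has_vector_derivative_const S(1,2)])
      (use S(3) in \<open>simp add: SU2U2_iff\<close>)
  ultimately have 1: "k' ** E11 = 0"
    by (rule vector_derivative_unique_at)
  have "((\<lambda>s. k s ** P2 - P2 ** k s) has_vector_derivative k' ** P2 - P2 ** k') (at t)"
    by (intro has_vector_derivative_diff mult_left_deriv[OF k]
        mult_right_deriv[OF k])
  moreover have "((\<lambda>s. k s ** P2 - P2 ** k s) has_vector_derivative 0) (at t)"
    by (rule has_vector_derivative_transform_within_open[OF has_vector_derivative_const S(1,2)])
      (use S(3) in \<open>simp add: SU2U2_iff\<close>)
  ultimately have "k' ** P2 - P2 ** k' = 0"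
    by (rule vector_derivative_unique_at)
  moreover have "conj_transpose (k t) ** P2 = P2 ** conj_transpose (k t)"
    using SU2U2_conj_transpose[OF S(3)[OF S(2)]] by (simp add: SU2U2_iff)
  ultimately have "conj_transpose (k t) ** k' ** P2 = P2 ** (conj_transpose (k t) ** k')"
    by (metis eq_iff_diff_eq_0 matrix_mul_assoc)
  moreover have "conj_transpose (k t) ** k' ** E11 = 0"
    using 1 by (simp add: mat5.mult.zero_right flip: matrix_mul_assoc)
  moreover have "conj_transpose (k t) ** k' \<in> su5"
    using SU5_curve_su5[OF k S(1,2)] S(3) SU2U2_SU5 by blast
  ultimately show ?thesis
    by (simp add: hh_iff)
qed

section \<open>The trace form and its invariance\<close>

lemma Q_form_add_left: "Q_form (X + Y) Z = Q_form X Z + Q_form Y Z"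
  and Q_form_add_right: "Q_form X (Y + Z) = Q_form X Y + Q_form X Z"
  and Q_form_diff_left: "Q_form (X - Y) Z = Q_form X Z - Q_form Y Z"
  and Q_form_minus_right: "Q_form X (- Z) = - Q_form X Z"
  and Q_form_scaleR_left: "Q_form (c *\<^sub>R X) Z = c * Q_form X Z"
  and Q_form_scaleR_right: "Q_form X (c *\<^sub>R Z) = c * Q_form X Z"
  by (simp_all add: Q_form_def mat5.mult.add_left mat5.mult.add_right mat5.mult.diff_left mat5.mult.minus_left
      mat5.mult.minus_right mat5.mult.scaleR_left mat5.mult.scaleR_right trace_add trace_diff trace_minus trace_scaleR)

lemma bounded_bilinear_Q_form: "bounded_bilinear Q_form"
  unfolding bilinear_conv_bounded_bilinear[symmetric] bilinear_def
  by (intro conjI allI linearI)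
    (simp_all only: Q_form_add_left Q_form_add_right Q_form_scaleR_left Q_form_scaleR_right real_scaleR_def)

lemma Q_form_sym: "Q_form X Y = Q_form Y X"
  by (simp add: Q_form_def trace_mul_sym[of X Y])

lemma Q_form_inner:
  assumes "conj_transpose Y = - Y"
  shows "Q_form X Y = X \<bullet> Y"
proof -
  have "Q_form X Y = (\<Sum>i\<in>UNIV. \<Sum>k\<in>UNIV. - Re (X $ i $ k * Y $ k $ i))"
    by (simp add: Q_form_def trace_def matrix_matrix_mult_def flip: sum_negf)
  also have "\<dots> = (\<Sum>i\<in>UNIV. \<Sum>k\<in>UNIV. X $ i $ k \<bullet> Y $ i $ k)"
  proof (intro sum.cong refl)
    fix i k
    have "Y $ k $ i = - cnj (Y $ i $ k)"
      using skew_entry[OF assms, of i k] by simp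
    then show "- Re (X $ i $ k * Y $ k $ i) = X $ i $ k \<bullet> Y $ i $ k"
      by (simp add: inner_complex_def)
  qed
  finally show ?thesis
    by (simp add: inner_vec_def)
qed

lemma Q_form_pos:
  assumes "X \<in> su5" "X \<noteq> 0"
  shows "Q_form X X > 0"
  using assms by (simp add: su5_iff Q_form_inner)

lemma Q_form_Ad: "Q_form (g ** X ** h) Y = Q_form X (h ** Y ** g)"
proof -
  have "trace (g ** (X ** (h ** Y))) = trace (X ** (h ** Y) ** g)"
    by (rule trace_mul_sym)
  then show ?thesis
    by (simp add: Q_form_def matrix_mul_assoc)
qed

lemma Q_form_bracket: "Q_form (lie_bracket X Y) Z = Q_form X (lie_bracket Y Z)"
proof -
  have "trace (Y ** (X ** Z)) = trace (X ** Z ** Y)"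
    by (rule trace_mul_sym)
  then show ?thesis
    by (simp add: Q_form_def lie_bracket_def mat5.mult.diff_left mat5.mult.diff_right trace_diff matrix_mul_assoc)
qed

lemma lie_bracket_add_left: "lie_bracket (X + Y) Z = lie_bracket X Z + lie_bracket Y Z"
  and lie_bracket_add_right: "lie_bracket X (Y + Z) = lie_bracket X Y + lie_bracket X Z"
  and lie_bracket_scaleR_left: "lie_bracket (c *\<^sub>R X) Z = c *\<^sub>R lie_bracket X Z"
  and lie_bracket_scaleR_right: "lie_bracket X (c *\<^sub>R Z) = c *\<^sub>R lie_bracket X Z"
  and lie_bracket_self: "lie_bracket X X = 0"
  and lie_bracket_zero_left: "lie_bracket 0 Z = 0"
  by (simp_all add: lie_bracket_def mat5.mult.add_left mat5.mult.add_right mat5.mult.diff_left mat5.mult.diff_right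
      mat5.mult.minus_left mat5.mult.minus_right mat5.mult.scaleR_left mat5.mult.scaleR_right
      mat5.mult.zero_left mat5.mult.zero_right scaleR_diff_right)

lemma lie_bracket_swap: "lie_bracket X Y = - lie_bracket Y X"
  by (simp add: lie_bracket_def)

section \<open>The orthogonal projection onto \<open>\<mm>\<close>\<close>

definition block :: "5 \<Rightarrow> nat" where
  "block i = (if i = 1 then 0 else if i = 2 \<or> i = 3 then 1 else 2)"

text \<open>On \<open>su5\<close> this is the orthogonal projection onto \<open>\<mm>\<close>; it is
  extended to a real-linear map on all matrices that kills the Hermitian ones. Its diagonal is
  \<open>Im (X$1$1) / 4\<close> times \<open>w_vec\<close>: trace zero gives
  \<open>Q_form w_vec X = 5 * Im (X$1$1)\<close>, and
  \<open>Q_form w_vec w_vec = 20\<close>.\<close>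

definition m_proj :: "cmat5 \<Rightarrow> cmat5" where
  "m_proj X = (\<chi> i j. if block i = block j
     then (if i = j then \<i> * of_real (if i = 1 then Im (X$1$1) else - Im (X$1$1) / 4) else 0)
     else (X$i$j - cnj (X$j$i)) / 2)"

lemma m_proj_entry: "m_proj X $ i $ j = (if block i = block j
     then (if i = j then \<i> * of_real (if i = 1 then Im (X$1$1) else - Im (X$1$1) / 4) else 0)
     else (X$i$j - cnj (X$j$i)) / 2)"
  by (simp add: m_proj_def)

lemma linear_m_proj: "linear m_proj"
  by (intro linearI) (simp_all add: vec_eq_iff m_proj_entry complex_eq_iff field_simps)

lemmas m_proj_add = linear_add[OF linear_m_proj]
  and m_proj_diff = linear_diff[OF linear_m_proj]
  and m_proj_minus = linear_neg[OF linear_m_proj]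
  and m_proj_scaleR = linear_cmul[OF linear_m_proj]
  and m_proj_zero = linear_0[OF linear_m_proj]

lemma bounded_linear_m_proj: "bounded_linear m_proj"
  using linear_m_proj by (simp add: linear_conv_bounded_linear)

lemmas m_proj_deriv = bounded_linear.has_vector_derivative[OF bounded_linear_m_proj]

lemma m_proj_conj_transpose: "m_proj (conj_transpose X) = - m_proj X"
  by (simp add: vec_eq_iff m_proj_entry complex_eq_iff field_simps)

lemma conj_transpose_m_proj: "conj_transpose (m_proj X) = - m_proj X"
  by (simp add: vec_eq_iff m_proj_entry complex_eq_iff field_simps)

lemma m_proj_su5: "m_proj X \<in> su5"
  by (simp add: su5_iff conj_transpose_m_proj) (simp add: trace_def sum_5 m_proj_entry complex_eq_iff)

lemma m_proj_m_proj [simp]: "m_proj (m_proj X) = m_proj X"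
proof -
  have "m_proj (m_proj X) $ i $ j = m_proj X $ i $ j" for i j
  proof (cases "block i = block j")
    case True
    then show ?thesis
      by (simp add: m_proj_entry)
  next
    case False
    then show ?thesis
      by (simp add: m_proj_entry[of "m_proj X"] skew_entry[OF conj_transpose_m_proj])
  qed
  then show ?thesis
    by (simp add: vec_eq_iff)
qed

lemma m_proj_hh:
  assumes "Y \<in> \<hh>"
  shows "m_proj Y = 0"
  by (simp add: vec_eq_iff forall_5 m_proj_entry block_def hh_entry[OF assms])

lemma hh_if_m_proj_eq_0:
  assumes "Y \<in> su5" "m_proj Y = 0"
  shows "Y \<in> \<hh>"
proof -
  have s: "cnj (Y $ j $ i) = - Y $ i $ j" for i j
    using assms skew_entry by (auto simp: su5_iff)
  have z: "Y $ i $ j = 0" if "block i \<noteq> block j" for i j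
    using arg_cong[OF assms(2), of "\<lambda>X. X $ i $ j"] that by (simp add: m_proj_entry s)
  have "Im (Y$1$1) = 0"
    using arg_cong[OF assms(2), of "\<lambda>X. X $ 1 $ 1"] by (simp add: m_proj_entry)
  moreover have "Re (Y$1$1) = 0"
    using s[of 1 1] by (simp add: complex_eq_iff)
  ultimately have "Y$1$1 = 0"
    by (simp add: complex_eq_iff)
  then show ?thesis
    using assms(1) by (simp add: hh_iff mult_E11_eq_0_iff commute_P2_iff z block_def)
qed

lemma Q_form_m_proj_hh:
  assumes "Y \<in> \<hh>"
  shows "Q_form (m_proj X) Y = 0"
proof -
  note e = hh_entry[OF assms]
  \<comment> \<open>Block-diagonality of \<open>Y\<close> leaves only diagonal products, and the
    entry (1, 1) of \<open>Y\<close> vanishes; what remains is a multiple of its trace.\<close>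
  have "Q_form (m_proj X) Y = - Im (X$1$1) / 4 * (Im (Y$2$2) + Im (Y$3$3) + Im (Y$4$4) + Im (Y$5$5))"
    by (simp add: Q_form_def trace_def sum_5 matrix_mult_entry_5 m_proj_entry block_def e(1-10) field_simps)
  then show ?thesis
    using arg_cong[OF e(12), of Im] by simp
qed

lemma m_proj_mm: "m_proj X \<in> \<mm>"
  by (simp add: \<mm>_def m_proj_su5 Q_form_m_proj_hh)

lemma su5_decomp: "X \<in> su5 \<Longrightarrow> X - m_proj X \<in> \<hh>"
  by (intro hh_if_m_proj_eq_0) (auto simp: m_proj_diff subspace_diff[OF subspace_su5] m_proj_su5)

text \<open>The difference \<open>X - m_proj X\<close> lies in \<open>\<hh>\<close> and is
  orthogonal to itself. The fixed-point equation is the form in which membership in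
  \<open>\<mm>\<close> is computed and differentiated.\<close>

lemma mm_iff: "X \<in> \<mm> \<longleftrightarrow> m_proj X = X"
proof
  assume X: "X \<in> \<mm>"
  then have su: "X \<in> su5"
    by (simp add: \<mm>_def)
  let ?D = "X - m_proj X"
  have D: "?D \<in> \<hh>"
    by (rule su5_decomp[OF su])
  then have "Q_form ?D ?D = 0"
    using X Q_form_m_proj_hh[OF D] by (simp add: \<mm>_def Q_form_diff_left)
  then show "m_proj X = X"
    using Q_form_pos[OF hh_su5[OF D]] by fastforce
next
  show "m_proj X = X \<Longrightarrow> X \<in> \<mm>"
    using m_proj_mm by metis
qed

lemma subspace_mm: "subspace \<mm>"
  by (auto simp: subspace_def mm_iff m_proj_add m_proj_scaleR m_proj_zero)

lemma mm_su5: "X \<in> \<mm> \<Longrightarrow> X \<in> su5"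
  by (simp add: \<mm>_def)

lemma m_part_eq:
  assumes "X \<in> su5"
  shows "m_part X = m_proj X"
  unfolding m_part_def
proof (rule the_equality)
  show "m_proj X \<in> \<mm> \<and> X - m_proj X \<in> \<hh>"
    using assms by (simp add: m_proj_mm su5_decomp)
  fix U
  assume "U \<in> \<mm> \<and> X - U \<in> \<hh>"
  then show "U = m_proj X"
    using m_proj_hh[of "X - U"] by (simp add: mm_iff m_proj_diff)
qed

lemma mm_eqI:
  assumes "X \<in> \<mm>" "Y \<in> \<mm>" "\<And>Z. Z \<in> \<mm> \<Longrightarrow> Q_form X Z = Q_form Y Z"
  shows "X = Y"
proof -
  have "X - Y \<in> \<mm>"
    using assms subspace_mm subspace_diff by blast
  then have "Q_form (X - Y) (X - Y) = 0" "X - Y \<in> su5"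
    using assms mm_su5 by (auto simp: Q_form_diff_left)
  then show ?thesis
    using Q_form_pos[of "X - Y"] by fastforce
qed

lemma Q_form_m_proj:
  assumes "X \<in> su5" "Z \<in> \<mm>"
  shows "Q_form (m_proj X) Z = Q_form X Z"
proof -
  have "Q_form Z (X - m_proj X) = 0"
    using assms su5_decomp by (simp add: \<mm>_def)
  then show ?thesis
    using Q_form_diff_left[of X "m_proj X" Z] by (simp add: Q_form_sym)
qed

lemma mm_Ad:
  assumes "g \<in> SU2U2" "X \<in> \<mm>"
  shows "g ** X ** conj_transpose g \<in> \<mm>"
proof -
  have "Q_form (g ** X ** conj_transpose g) Y = 0" if "Y \<in> \<hh>" for Y
    using hh_Ad[OF SU2U2_conj_transpose[OF assms(1)] that] assms by (simp add: Q_form_Ad \<mm>_def)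
  then show ?thesis
    using assms su5_Ad SU2U2_SU5 by (simp add: \<mm>_def)
qed

lemma m_proj_Ad:
  assumes "g \<in> SU2U2" "X \<in> su5"
  shows "m_proj (g ** X ** conj_transpose g) = g ** m_proj X ** conj_transpose g"
proof -
  have "m_proj (g ** X ** conj_transpose g) =
      m_proj (g ** m_proj X ** conj_transpose g) + m_proj (g ** (X - m_proj X) ** conj_transpose g)"
    by (simp add: m_proj_add[symmetric] mat5.mult.diff_left mat5.mult.diff_right)
  also have "m_proj (g ** (X - m_proj X) ** conj_transpose g) = 0"
    using assms by (intro m_proj_hh hh_Ad su5_decomp)
  also have "m_proj (g ** m_proj X ** conj_transpose g) = g ** m_proj X ** conj_transpose g"
    using mm_Ad[OF assms(1) m_proj_mm] by (simp add: mm_iff)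
  finally show ?thesis
    by simp
qed

lemma bracket_hh_mm:
  assumes "a \<in> \<hh>" "X \<in> \<mm>"
  shows "lie_bracket a X \<in> \<mm>"
proof -
  have "Q_form (lie_bracket a X) Y = 0" if "Y \<in> \<hh>" for Y
  proof -
    have "Q_form (lie_bracket a X) Y = Q_form X (lie_bracket Y a)"
      by (metis Q_form_bracket Q_form_sym)
    then show ?thesis
      using assms hh_bracket[OF that assms(1)] by (simp add: \<mm>_def)
  qed
  then show ?thesis
    using assms su5_bracket hh_su5 by (simp add: \<mm>_def)
qed

subsection \<open>Block-scalar endomorphisms\<close>

text \<open>The block diagonal of an element of \<open>\<mm>\<close> is its
  \<open>\<nn>\<close>-part, so \<open>d\<close> is the scalar on \<open>\<nn>\<close>. Blocks are
  numbered 0, 1, 2, hence the sums 1, 2, 3 of two different numbers single out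
  \<open>\<mm>01\<close>, \<open>\<mm>02\<close>, \<open>\<mm>12\<close>, with scalars
  \<open>a\<close>, \<open>b\<close>, \<open>c\<close>.\<close>

definition coef :: "real \<Rightarrow> real \<Rightarrow> real \<Rightarrow> real \<Rightarrow> 5 \<Rightarrow> 5 \<Rightarrow> real" where
  "coef d a b c i j = (if block i = block j then d
     else if block i + block j = 1 then a else if block i + block j = 2 then b else c)"

definition block_scale :: "real \<Rightarrow> real \<Rightarrow> real \<Rightarrow> real \<Rightarrow> cmat5 \<Rightarrow> cmat5" where
  "block_scale d a b c X = (\<chi> i j. coef d a b c i j *\<^sub>R X $ i $ j)"

lemma block_scale_entry: "block_scale d a b c X $ i $ j = coef d a b c i j *\<^sub>R X $ i $ j"
  by (simp add: block_scale_def)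

lemma coef_sym: "coef d a b c i j = coef d a b c j i"
  by (auto simp: coef_def add.commute)

lemma linear_block_scale: "linear (block_scale d a b c)"
  by (intro linearI) (simp_all add: vec_eq_iff block_scale_entry scaleR_add_right)

lemmas block_scale_add = linear_add[OF linear_block_scale]
  and block_scale_scaleR = linear_cmul[OF linear_block_scale]
  and block_scale_zero = linear_0[OF linear_block_scale]

lemma block_scale_m_proj: "block_scale d a b c (m_proj X) = m_proj (block_scale d a b c X)"
  by (auto simp: vec_eq_iff block_scale_entry m_proj_entry coef_sym[of d a b c _ _] complex_eq_iff
      coef_def add.commute field_simps)

lemma block_scale_mm: "X \<in> \<mm> \<Longrightarrow> block_scale d a b c X \<in> \<mm>"
  by (simp add: mm_iff flip: block_scale_m_proj)

lemma block_scale_inverse: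
  assumes "d \<noteq> 0" "a \<noteq> 0" "b \<noteq> 0" "c \<noteq> 0"
  shows "block_scale d a b c (block_scale (1/d) (1/a) (1/b) (1/c) X) = X"
  using assms by (simp add: vec_eq_iff block_scale_entry coef_def)

lemma Q_form_block_scale: "Q_form (block_scale d a b c X) Y = Q_form X (block_scale d a b c Y)"
proof -
  have "trace (block_scale d a b c X ** Y) = trace (X ** block_scale d a b c Y)"
    unfolding trace_def matrix_matrix_mult_def
    by (simp add: block_scale_entry coef_sym[of d a b c])  
  then show ?thesis
    by (simp add: Q_form_def)
qed

subsection \<open>Logarithmic derivatives and the exponential chart\<close>

lemma mexp_compose_has_vector_derivative:
  assumes "(x has_vector_derivative x') (at t)"
  shows "((\<lambda>s. mexp (x s)) has_vector_derivative mat5.dex (x t) x') (at t)"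
proof -
  have "((\<lambda>s. mat5.ex (x s)) has_derivative (\<lambda>h. mat5.dex (x t) (h *\<^sub>R x'))) (at t)"
    using has_derivative_compose[OF assms[unfolded has_vector_derivative_def] mat5.ex_has_derivative] .
  then show ?thesis
    by (simp add: has_vector_derivative_def mexp_eq_ex linear_cmul[OF mat5.linear_dex])
qed

text \<open>The left logarithmic derivative of exp, formally
  \<open>(1 - exp (- ad X)) / ad X\<close> applied to \<open>U\<close>.\<close>

definition log_dex :: "cmat5 \<Rightarrow> cmat5 \<Rightarrow> cmat5" where
  "log_dex X U = mexp (- X) ** mat5.dex X U"

lemma mexp_zero [simp]: "mexp 0 = mat 1"
  by (simp add: mexp_eq_ex)

lemma log_dex_zero [simp]: "log_dex 0 U = U"
  by (simp add: log_dex_def)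

lemma log_dex_su5:
  assumes "X \<in> su5" "U \<in> su5"
  shows "log_dex X U \<in> su5"
proof -
  have "((\<lambda>s. X + s *\<^sub>R U) has_vector_derivative U) (at 0)"
    by (auto intro!: derivative_eq_intros)
  then have "((\<lambda>s. mexp (X + s *\<^sub>R U)) has_vector_derivative mat5.dex X U) (at 0)"
    using mexp_compose_has_vector_derivative by fastforce
  then have "conj_transpose (mexp (X + 0 *\<^sub>R U)) ** mat5.dex X U \<in> su5"
    by (rule SU5_curve_su5[OF _ open_UNIV UNIV_I])
      (intro mexp_SU5 subspace_add[OF subspace_su5] subspace_scale[OF subspace_su5] assms)
  then show ?thesis
    using assms by (simp add: log_dex_def mexp_minus)
qed

lemma exp_chart_deriv_eq:
  assumes "X \<in> su5" "U \<in> su5"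
  shows "exp_chart_deriv X U = m_proj (log_dex X U)"
proof -
  have "((\<lambda>s. X + s *\<^sub>R U) has_vector_derivative U) (at 0)"
    by (auto intro!: derivative_eq_intros)
  then have "((\<lambda>s. mexp (X + s *\<^sub>R U)) has_vector_derivative mat5.dex X U) (at 0)"
    using mexp_compose_has_vector_derivative by fastforce
  then have "vector_derivative (\<lambda>s. mexp (X + s *\<^sub>R U)) (at 0) = mat5.dex X U"
    by (rule vector_derivative_at)
  then show ?thesis
    using m_part_eq[OF log_dex_su5[OF assms]] assms
    by (simp add: exp_chart_deriv_def log_dex_def matrix_inv_SU5 mexp_SU5 mexp_minus)
qed

text \<open>Where \<open>x\<close> vanishes, the left factor contributes \<open>- x' y\<close> and
  the second derivative of exp contributes \<open>(x' y + y x') / 2\<close>; together they give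
  \<open>- [x', y] / 2\<close>.\<close>

lemma log_dex_has_vector_derivative:
  assumes x: "(x has_vector_derivative x') (at t)" "x t = 0" and y: "(y has_vector_derivative y') (at t)"
  shows "((\<lambda>s. log_dex (x s) (y s)) has_vector_derivative y' - (1/2) *\<^sub>R lie_bracket x' (y t)) (at t)"
proof -
  have "((\<lambda>s. mexp (- x s)) has_vector_derivative - x') (at t)"
    using mexp_compose_has_vector_derivative[OF has_vector_derivative_minus[OF x(1)]] x(2) by simp
  moreover have "((\<lambda>s. mat5.dex (x s) (y s)) has_vector_derivative y' + (1/2) *\<^sub>R (x' ** y t + y t ** x')) (at t)"
  proof -
    let ?dd = "euclidean_algebra.dex (dual_mult (**)) (mat 1, 0) (x t, y t)"
    have "((\<lambda>s. (x s, y s)) has_derivative (\<lambda>h. h *\<^sub>R (x', y'))) (at t)"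
      using has_vector_derivative_Pair[OF x(1) y] by (simp only: has_vector_derivative_def)
    from has_derivative_compose[OF this mat5.dex_has_derivative]
    have "((\<lambda>s. mat5.dex (x s) (y s)) has_derivative (\<lambda>h. snd (?dd (h *\<^sub>R (x', y'))))) (at t)"
      by simp
    moreover have "linear ?dd"
      by (rule euclidean_algebra.linear_dex[OF mat5.dual_algebra])
    ultimately show ?thesis
      by (simp add: has_vector_derivative_def linear_cmul mat5.dex_second_order x(2) del: scaleR_Pair)
  qed
  ultimately have "((\<lambda>s. log_dex (x s) (y s)) has_vector_derivative
      mexp (- x t) ** (y' + (1/2) *\<^sub>R (x' ** y t + y t ** x')) + - x' ** mat5.dex (x t) (y t)) (at t)"
    unfolding log_dex_def by (rule mat5.mult.has_vector_derivative)
  then show ?thesis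
  proof (rule has_vector_derivative_eq_rhs)
    have "(1/2) *\<^sub>R P + (1/2) *\<^sub>R P = P" for P :: cmat5
      by (simp flip: scaleR_add_left)
    then show "mexp (- x t) ** (y' + (1/2) *\<^sub>R (x' ** y t + y t ** x')) + - x' ** mat5.dex (x t) (y t)
        = y' - (1/2) *\<^sub>R lie_bracket x' (y t)"
      by (simp add: x(2) lie_bracket_def mat5.mult.minus_left scaleR_diff_right scaleR_add_right algebra_simps)
  qed
qed

lemma mm_has_vector_derivative:
  assumes x: "(x has_vector_derivative x') (at t)" and S: "open S" "t \<in> S" "\<And>s. s \<in> S \<Longrightarrow> x s \<in> \<mm>"
  shows "x' \<in> \<mm>"
proof -
  have "((\<lambda>s. m_proj (x s)) has_vector_derivative m_proj x') (at t)"
    by (rule m_proj_deriv[OF x])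
  moreover have "((\<lambda>s. m_proj (x s)) has_vector_derivative x') (at t)"
    by (rule has_vector_derivative_transform_within_open[OF x S(1,2)]) (use S(3) in \<open>simp add: mm_iff\<close>)
  ultimately show ?thesis
    using vector_derivative_unique_at by (auto simp: mm_iff)
qed

subsection \<open>Cosets\<close>

lemma left_coset_eq_iff:
  assumes "g \<in> SU5" "h \<in> SU5"
  shows "left_coset g = left_coset h \<longleftrightarrow> conj_transpose g ** h \<in> SU2U2"
proof
  assume "left_coset g = left_coset h"
  moreover have "h \<in> left_coset h"
    using SU2U2_one by (force simp: left_coset_def)
  ultimately obtain k where "h = g ** k" "k \<in> SU2U2"
    by (auto simp: left_coset_def)
  then show "conj_transpose g ** h \<in> SU2U2"
    by (simp add: SU5_cancel[OF assms(1)])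
next
  let ?k = "conj_transpose g ** h"
  assume k: "?k \<in> SU2U2"
  have h: "h = g ** ?k" and g: "g = h ** conj_transpose ?k"
    using assms by (simp_all add: SU5_cancel SU5_inverse conj_transpose_mult matrix_mul_assoc)
  have "h ** l \<in> left_coset g" if "l \<in> SU2U2" for l
    unfolding left_coset_def using SU2U2_mult[OF k that]
    by (subst h) (auto simp flip: matrix_mul_assoc)
  moreover have "g ** l \<in> left_coset h" if "l \<in> SU2U2" for l
    unfolding left_coset_def using SU2U2_mult[OF SU2U2_conj_transpose[OF k] that]
    by (subst g) (auto simp flip: matrix_mul_assoc)
  ultimately show "left_coset g = left_coset h"
    by (auto simp: left_coset_def)
qed

lemma translate_left_coset: "translate a (left_coset g) = left_coset (a ** g)"
  by (simp add: translate_def left_coset_def Setcompr_eq_image image_image matrix_mul_assoc)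

text \<open>Two lifts of a curve of cosets differ by a curve \<open>k\<close> in the isotropy group,
  and their logarithmic derivatives are related by the gauge transformation with
  \<open>\<eta> = k^(-1) k'\<close>.\<close>

lemma lift_transition:
  fixes \<alpha> \<beta> :: "real \<Rightarrow> cmat5"
  assumes \<alpha>: "(\<alpha> has_vector_derivative \<alpha>') (at t)" and \<beta>: "(\<beta> has_vector_derivative \<beta>') (at t)"
    and S: "open S" "t \<in> S" and SU: "\<And>s. s \<in> S \<Longrightarrow> \<alpha> s \<in> SU5" "\<And>s. s \<in> S \<Longrightarrow> \<beta> s \<in> SU5"
    and eq: "\<And>s. s \<in> S \<Longrightarrow> left_coset (\<alpha> s) = left_coset (\<beta> s)"
  defines "k \<equiv> \<lambda>s. conj_transpose (\<alpha> s) ** \<beta> s"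
  obtains \<eta> where "\<eta> \<in> \<hh>" "(k has_vector_derivative k t ** \<eta>) (at t)"
    "conj_transpose (\<beta> t) ** \<beta>' = conj_transpose (k t) ** (conj_transpose (\<alpha> t) ** \<alpha>') ** k t + \<eta>"
proof -
  define k' where "k' = conj_transpose (\<alpha> t) ** \<beta>' + conj_transpose \<alpha>' ** \<beta> t"
  have k: "(k has_vector_derivative k') (at t)"
    unfolding k_def k'_def
    by (intro mat5.mult.has_vector_derivative \<beta> conj_transpose_deriv[OF \<alpha>])
  have kH: "k s \<in> SU2U2" if "s \<in> S" for s
    using eq[OF that] SU[OF that] by (simp add: k_def left_coset_eq_iff)
  define \<eta> where "\<eta> = conj_transpose (k t) ** k'"
  have kt: "k t \<in> SU5"
    using kH S SU2U2_SU5 by blast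
  have "conj_transpose (\<alpha> t) ** \<alpha>' \<in> su5"
    by (rule SU5_curve_su5[OF \<alpha> S SU(1)])
  then have "conj_transpose \<alpha>' ** \<alpha> t = - (conj_transpose (\<alpha> t) ** \<alpha>')"
    by (simp add: su5_iff conj_transpose_mult)
  then have "conj_transpose \<alpha>' ** \<alpha> t ** k t = - (conj_transpose (\<alpha> t) ** \<alpha>' ** k t)"
    by (simp add: mat5.mult.minus_left)
  then have "conj_transpose \<alpha>' ** \<beta> t = - (conj_transpose (\<alpha> t) ** \<alpha>' ** k t)"
    using SU5_cancel(2)[OF SU(1)[OF S(2)]] by (simp add: k_def flip: matrix_mul_assoc)
  then have "\<eta> = conj_transpose (k t) ** (conj_transpose (\<alpha> t) ** \<beta>') - conj_transpose (k t) ** (conj_transpose (\<alpha> t) ** \<alpha>' ** k t)"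
    by (simp add: \<eta>_def k'_def mat5.mult.add_right mat5.mult.minus_right mat5.mult.diff_right)
  moreover have "conj_transpose (k t) ** (conj_transpose (\<alpha> t) ** \<beta>') = conj_transpose (\<beta> t) ** \<beta>'"
    using SU5_cancel(2)[OF SU(1)[OF S(2)]] by (simp add: k_def conj_transpose_mult flip: matrix_mul_assoc)
  ultimately have "conj_transpose (\<beta> t) ** \<beta>' = conj_transpose (k t) ** (conj_transpose (\<alpha> t) ** \<alpha>') ** k t + \<eta>"
    by (simp add: matrix_mul_assoc)
  moreover have "\<eta> \<in> \<hh>"
    unfolding \<eta>_def by (rule SU2U2_curve_hh[OF k S kH])
  moreover have "k' = k t ** \<eta>"
    by (simp add: \<eta>_def SU5_cancel[OF kt])
  ultimately show ?thesis
    using that k by simp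
qed

text \<open>The gauge term lies in \<open>\<hh>\<close> and disappears: the horizontal velocity
  changes by conjugation alone.\<close>

lemma m_proj_lift_transition:
  fixes \<alpha> \<beta> :: "real \<Rightarrow> cmat5"
  assumes \<alpha>: "(\<alpha> has_vector_derivative \<alpha>') (at t)" and \<beta>: "(\<beta> has_vector_derivative \<beta>') (at t)"
    and S: "open S" "t \<in> S" and SU: "\<And>s. s \<in> S \<Longrightarrow> \<alpha> s \<in> SU5" "\<And>s. s \<in> S \<Longrightarrow> \<beta> s \<in> SU5"
    and eq: "\<And>s. s \<in> S \<Longrightarrow> left_coset (\<alpha> s) = left_coset (\<beta> s)"
    and k: "k = conj_transpose (\<alpha> t) ** \<beta> t"
  shows "m_proj (conj_transpose (\<beta> t) ** \<beta>') = conj_transpose k ** m_proj (conj_transpose (\<alpha> t) ** \<alpha>') ** k"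
proof -
  obtain \<eta> where \<eta>: "\<eta> \<in> \<hh>"
    "conj_transpose (\<beta> t) ** \<beta>' = conj_transpose k ** (conj_transpose (\<alpha> t) ** \<alpha>') ** k + \<eta>"
    unfolding k by (rule lift_transition[OF \<alpha> \<beta> S SU eq]; blast)
  have "k \<in> SU2U2"
    using eq[OF S(2)] SU[OF S(2)] by (simp add: k left_coset_eq_iff)
  then show ?thesis
    using m_proj_Ad[OF SU2U2_conj_transpose SU5_curve_su5[OF \<alpha> S SU(1)], of k] \<eta>
    by (simp add: m_proj_add m_proj_hh)
qed

lemma chart_curve:
  assumes g: "g \<in> SU5" and x: "(x has_vector_derivative x') (at t)" and xt: "x t \<in> su5"
  shows "((\<lambda>s. g ** mexp (x s)) has_vector_derivative g ** mat5.dex (x t) x') (at t)"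
    "conj_transpose (g ** mexp (x t)) ** (g ** mat5.dex (x t) x') = log_dex (x t) x'"
proof -
  show "((\<lambda>s. g ** mexp (x s)) has_vector_derivative g ** mat5.dex (x t) x') (at t)"
    by (rule mult_right_deriv[OF mexp_compose_has_vector_derivative[OF x]])
  have "conj_transpose (mexp (x t)) ** (conj_transpose g ** (g ** mat5.dex (x t) x')) = log_dex (x t) x'"
    by (simp add: SU5_cancel[OF g] log_dex_def mexp_minus[OF xt])
  then show "conj_transpose (g ** mexp (x t)) ** (g ** mat5.dex (x t) x') = log_dex (x t) x'"
    by (simp add: conj_transpose_mult matrix_mul_assoc)
qed

subsection \<open>The geodesic equation\<close>

lemma eventually_norm_linear_less:
  fixes z :: "'a::t2_space \<Rightarrow> 'b::real_normed_vector" and f :: "'b \<Rightarrow> 'c::real_normed_vector"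
  assumes f: "bounded_linear f" and z: "isCont z t" "z t = 0" and r: "r > 0"
  shows "eventually (\<lambda>s. norm (f (z s)) < r) (nhds t)"
proof -
  have "isCont (\<lambda>s. norm (f (z s))) t"
    by (intro isCont_norm bounded_linear.isCont[OF f] z(1))
  then have "((\<lambda>s. norm (f (z s))) \<longlongrightarrow> norm (f (z t))) (nhds t)"
    using tendsto_at_iff_tendsto_nhds[of "\<lambda>s. norm (f (z s))" t] by (simp add: isCont_def)
  moreover have "norm (f (z t)) < r"
    using r linear_0[OF bounded_linear.linear[OF f]] z(2) by simp
  ultimately show ?thesis
    by (rule order_tendstoD(2))
qed

text \<open>\<open>L\<close> is the metric endomorphism, extended linearly to all matrices; its
  inverse \<open>L'\<close> on \<open>\<mm>\<close> brings the geodesic equation into explicit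
  form.\<close>

locale metric_operator =
  fixes L L' :: "cmat5 \<Rightarrow> cmat5" and B :: "cmat5 \<Rightarrow> cmat5 \<Rightarrow> cmat5 \<Rightarrow> real"
  assumes linear_L: "linear L" and linear_L': "linear L'"
    and L_mm: "X \<in> \<mm> \<Longrightarrow> L X \<in> \<mm>" and L'_mm: "X \<in> \<mm> \<Longrightarrow> L' X \<in> \<mm>"
    and L_L': "X \<in> \<mm> \<Longrightarrow> L (L' X) = X"
    and Q_L: "Q_form (L X) Y = Q_form X (L Y)"
    and B_eq: "g \<in> SU5 \<Longrightarrow> X \<in> \<mm> \<Longrightarrow> Y \<in> \<mm> \<Longrightarrow> B g X Y = Q_form (L X) Y"
begin

lemma bounded_linear_L: "bounded_linear L"
  using linear_L by (simp add: linear_conv_bounded_linear)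

lemma chart_metric_eq:
  assumes "g \<in> SU5" "X \<in> su5" "U \<in> su5" "V \<in> su5"
  shows "chart_metric B g X U V = Q_form (L (m_proj (log_dex X U))) (m_proj (log_dex X V))"
  using assms by (simp add: chart_metric_def exp_chart_deriv_eq B_eq m_proj_mm mexp_SU5)

text \<open>To first order at the centre, the coordinate field \<open>U\<close> is represented by
  the \<open>\<mm>\<close>-part of \<open>U - [s A, U] / 2\<close>. The metric varies only through
  these representatives, since its value on fixed elements of \<open>\<mm>\<close> is the same at
  every group element.\<close>

lemma deriv_chart_metric:
  assumes "g \<in> SU5" "A \<in> \<mm>" "U \<in> \<mm>" "V \<in> \<mm>"
  shows "deriv (\<lambda>s. chart_metric B g (0 + s *\<^sub>R A) U V) 0
    = - (Q_form (lie_bracket A U) (L V) + Q_form (L U) (lie_bracket A V)) / 2"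
proof -
  have su: "s *\<^sub>R A \<in> su5" "U \<in> su5" "V \<in> su5" for s
    using assms mm_su5 subspace_scale[OF subspace_su5] by auto
  have x: "((\<lambda>s. s *\<^sub>R A) has_vector_derivative A) (at 0)"
    by (auto intro!: derivative_eq_intros)
  have w: "((\<lambda>s. m_proj (log_dex (s *\<^sub>R A) W)) has_vector_derivative - (1/2) *\<^sub>R m_proj (lie_bracket A W)) (at 0)" for W
    using m_proj_deriv[OF log_dex_has_vector_derivative[OF x _ has_vector_derivative_const[of W]]]
    by (simp add: m_proj_minus m_proj_scaleR)
  have "((\<lambda>s. Q_form (L (m_proj (log_dex (s *\<^sub>R A) U))) (m_proj (log_dex (s *\<^sub>R A) V))) has_vector_derivative
     Q_form (L (m_proj (log_dex (0 *\<^sub>R A) U))) (- (1/2) *\<^sub>R m_proj (lie_bracket A V))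
     + Q_form (L (- (1/2) *\<^sub>R m_proj (lie_bracket A U))) (m_proj (log_dex (0 *\<^sub>R A) V))) (at 0)"
    by (rule bounded_bilinear.has_vector_derivative[OF bounded_bilinear_Q_form
          bounded_linear.has_vector_derivative[OF bounded_linear_L w] w])
  then have "((\<lambda>s. chart_metric B g (0 + s *\<^sub>R A) U V) has_vector_derivative
     Q_form (L (m_proj (log_dex (0 *\<^sub>R A) U))) (- (1/2) *\<^sub>R m_proj (lie_bracket A V))
     + Q_form (L (- (1/2) *\<^sub>R m_proj (lie_bracket A U))) (m_proj (log_dex (0 *\<^sub>R A) V))) (at 0)"
    using assms su by (simp add: chart_metric_eq)
  then have "deriv (\<lambda>s. chart_metric B g (0 + s *\<^sub>R A) U V) 0 =
     Q_form (L (m_proj (log_dex (0 *\<^sub>R A) U))) (- (1/2) *\<^sub>R m_proj (lie_bracket A V))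
     + Q_form (L (- (1/2) *\<^sub>R m_proj (lie_bracket A U))) (m_proj (log_dex (0 *\<^sub>R A) V))"
    by (intro DERIV_imp_deriv) (simp only: has_real_derivative_iff_has_vector_derivative)
  also have "\<dots> = - (Q_form (L U) (m_proj (lie_bracket A V)) + Q_form (m_proj (lie_bracket A U)) (L V)) / 2"
    using assms by (simp only: scaleR_zero_left log_dex_zero Q_L Q_form_scaleR_left Q_form_scaleR_right)
      (simp add: mm_iff Q_L field_simps)
  also have "Q_form (L U) (m_proj (lie_bracket A V)) = Q_form (L U) (lie_bracket A V)"
    using assms Q_form_m_proj[of "lie_bracket A V" "L U"] su5_bracket
    by (simp add: Q_form_sym[of "L U"] L_mm mm_su5)
  also have "Q_form (m_proj (lie_bracket A U)) (L V) = Q_form (lie_bracket A U) (L V)"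
    using assms Q_form_m_proj[of "lie_bracket A U" "L V"] su5_bracket
    by (simp add: L_mm mm_su5)
  finally show ?thesis
    by simp
qed

text \<open>In the Christoffel symbol each derivative along \<open>U\<close> leaves
  \<open>- Q(L U, [U, Z]) / 2\<close>, its other term containing \<open>[U, U]\<close>, and the
  derivative along \<open>Z\<close> contributes twice as much. Half of the sum is
  \<open>- Q(L U, [U, Z])\<close>, which invariance of \<open>Q\<close> rewrites as
  \<open>- Q([L U, U], Z)\<close>; nondegeneracy on \<open>\<mm>\<close> then removes
  \<open>Z\<close>.\<close>

lemma covariant_acceleration_zero_iff:
  assumes "g \<in> SU5" "U \<in> \<mm>" "A \<in> \<mm>"
  shows "(\<forall>Z\<in>\<mm>. covariant_acceleration (chart_metric B g) 0 U A Z = 0) \<longleftrightarrow>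
    L A = m_proj (lie_bracket (L U) U)"
proof -
  have su: "U \<in> su5" "A \<in> su5" "L U \<in> su5" "lie_bracket (L U) U \<in> su5"
    using assms L_mm mm_su5 su5_bracket by auto
  have "covariant_acceleration (chart_metric B g) 0 U A Z = Q_form (L A) Z - Q_form (lie_bracket (L U) U) Z"
    if Z: "Z \<in> \<mm>" for Z
  proof -
    have 1: "chart_metric B g 0 A Z = Q_form (L A) Z"
      using assms Z su chart_metric_eq[of g 0 A Z] subspace_0[OF subspace_su5] by (simp add: mm_su5 mm_iff)
    have 2: "Q_form (L U) (lie_bracket Z U) = - Q_form (lie_bracket (L U) U) Z"
      by (subst lie_bracket_swap) (simp add: Q_form_minus_right Q_form_bracket)
    have 3: "Q_form (lie_bracket U U) W = 0" "Q_form (lie_bracket Z U) (L U) = Q_form (L U) (lie_bracket Z U)"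
      "Q_form (L U) (lie_bracket U Z) = Q_form (lie_bracket (L U) U) Z" for W
      by (simp_all add: Q_form_bracket Q_form_sym[of _ "L U"] lie_bracket_self)
        (simp_all add: Q_form_def mat5.mult.zero_left lie_bracket_def)
    show ?thesis
      unfolding covariant_acceleration_def christoffel_def 1
      using assms Z by (simp only: deriv_chart_metric 3 2) simp
  qed
  then have "(\<forall>Z\<in>\<mm>. covariant_acceleration (chart_metric B g) 0 U A Z = 0) \<longleftrightarrow>
      (\<forall>Z\<in>\<mm>. Q_form (L A) Z = Q_form (m_proj (lie_bracket (L U) U)) Z)"
    using su by (simp add: Q_form_m_proj)
  then show ?thesis
    using mm_eqI[OF L_mm[OF assms(3)] m_proj_mm] by auto
qed

text \<open>The bound on the velocity keeps it in the domain of the local inverse of the tangent map of the chart.\<close>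

lemma horizontal_geodesic:
  obtains \<delta> where "\<delta> > 0"
    "\<And>I g v v'. \<lbrakk>open I; is_interval I; \<And>t. t \<in> I \<Longrightarrow> g t \<in> SU5; \<And>t. t \<in> I \<Longrightarrow> v t \<in> \<mm>;
      \<And>t. t \<in> I \<Longrightarrow> norm (v t) < \<delta>; \<And>t. t \<in> I \<Longrightarrow> (g has_vector_derivative g t ** v t) (at t);
      \<And>t. t \<in> I \<Longrightarrow> (v has_vector_derivative v' t) (at t);
      \<And>t. t \<in> I \<Longrightarrow> L (v' t) = m_proj (lie_bracket (L (v t)) (v t))\<rbrakk> \<Longrightarrow>
      geodesic B I (\<lambda>t. left_coset (g t))"
proof -
  obtain \<delta> where \<delta>: "\<delta> > 0" and inj: "inj_on (mat5.fac m_proj) (ball 0 \<delta>)"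
    and lift: "\<And>\<gamma> \<gamma>' \<gamma>'' t0 \<epsilon>. \<lbrakk>\<epsilon> > 0; \<gamma> t0 = mat 1; norm (\<gamma>' t0) < \<delta>;
      \<And>t. t \<in> ball t0 \<epsilon> \<Longrightarrow> (\<gamma> has_vector_derivative \<gamma>' t) (at t);
      \<And>t. t \<in> ball t0 \<epsilon> \<Longrightarrow> (\<gamma>' has_vector_derivative \<gamma>'' t) (at t)\<rbrakk> \<Longrightarrow>
      \<exists>\<epsilon>'>0. \<exists>x x' x''. \<epsilon>' \<le> \<epsilon> \<and> x t0 = 0 \<and> (\<forall>t\<in>ball t0 \<epsilon>'. mat5.fac m_proj (x t) = \<gamma> t \<and>
        (x has_vector_derivative x' t) (at t) \<and> (x' has_vector_derivative x'' t) (at t))"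
  proof (rule mat5.fac_lift_curve[OF linear_m_proj], goal_cases)
    case (1 \<delta>)
    show ?case
      by (rule 1(1)[OF 1(2,3)]) (rule 1(4))
  qed
  show ?thesis
  proof (rule that[OF \<delta>])
    fix I :: "real set" and g v v'
    assume I: "open I" "is_interval I" and g: "\<And>t. t \<in> I \<Longrightarrow> g t \<in> SU5" and v: "\<And>t. t \<in> I \<Longrightarrow> v t \<in> \<mm>"
      and small: "\<And>t. t \<in> I \<Longrightarrow> norm (v t) < \<delta>"
      and g': "\<And>t. t \<in> I \<Longrightarrow> (g has_vector_derivative g t ** v t) (at t)"
      and v': "\<And>t. t \<in> I \<Longrightarrow> (v has_vector_derivative v' t) (at t)"
      and euler: "\<And>t. t \<in> I \<Longrightarrow> L (v' t) = m_proj (lie_bracket (L (v t)) (v t))"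
    show "geodesic B I (\<lambda>t. left_coset (g t))"
      unfolding geodesic_def
    proof (intro conjI ballI I)
      fix t0
      assume t0: "t0 \<in> I"
      obtain \<epsilon> where \<epsilon>: "\<epsilon> > 0" "ball t0 \<epsilon> \<subseteq> I"
        using I(1) t0 openE by blast
      define h where "h = conj_transpose (g t0)"
      have h: "h \<in> SU5"
        using g[OF t0] by (simp add: h_def)
      obtain \<epsilon>1 x x' x'' where \<epsilon>1: "\<epsilon>1 > 0" "\<epsilon>1 \<le> \<epsilon>" and x0: "x t0 = 0"
        and x: "\<And>t. t \<in> ball t0 \<epsilon>1 \<Longrightarrow> mat5.fac m_proj (x t) = h ** g t"
          "\<And>t. t \<in> ball t0 \<epsilon>1 \<Longrightarrow> (x has_vector_derivative x' t) (at t)"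
          "\<And>t. t \<in> ball t0 \<epsilon>1 \<Longrightarrow> (x' has_vector_derivative x'' t) (at t)"
      proof -
        have "h ** g t0 = mat 1"
          using SU5_inverse(1)[OF g[OF t0]] by (simp add: h_def)
        moreover have "norm (h ** (g t0 ** v t0)) < \<delta>"
          using small[OF t0] SU5_cancel(1)[OF g[OF t0]] by (simp add: h_def)
        moreover have "((\<lambda>t. h ** g t) has_vector_derivative h ** (g t ** v t)) (at t)"
          and "((\<lambda>t. h ** (g t ** v t)) has_vector_derivative h ** (g t ** v' t + g t ** v t ** v t)) (at t)"
          if "t \<in> ball t0 \<epsilon>" for t
          using that \<epsilon>(2)
          by (auto intro!: mult_right_deriv mat5.mult.has_vector_derivative g' v')
        ultimately show ?thesis
          using lift[OF \<epsilon>(1), of "\<lambda>t. h ** g t" t0 "\<lambda>t. h ** (g t ** v t)" "\<lambda>t. h ** (g t ** v' t + g t ** v t ** v t)"] that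
          by blast
      qed
      \<comment> \<open>\<open>y\<close> is the coordinate curve sought. As \<open>x\<close> was
        found among all matrices, it remains to be shown that the factor \<open>mexp (z t)\<close>
        belongs to the isotropy group.\<close>
      define y where "y t = m_proj (x t)" for t
      define z where "z t = x t - m_proj (x t)" for t
      have yz: "h ** g t = mexp (y t) ** mexp (z t)" if "t \<in> ball t0 \<epsilon>1" for t
        using x(1)[OF that] by (simp add: mat5.fac_def mexp_eq_ex y_def z_def)
      have yd: "(y has_vector_derivative m_proj (x' t)) (at t)" "((\<lambda>t. m_proj (x' t)) has_vector_derivative m_proj (x'' t)) (at t)"
        if "t \<in> ball t0 \<epsilon>1" for t
        using x(2,3)[OF that] unfolding y_def[abs_def]
        by (auto intro: m_proj_deriv)
      have zd: "(z has_vector_derivative x' t - m_proj (x' t)) (at t)" if "t \<in> ball t0 \<epsilon>1" for t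
        unfolding z_def[abs_def]
        by (intro has_vector_derivative_diff m_proj_deriv x(2) that)
      have z0: "z t0 = 0" "y t0 = 0"
        by (simp_all add: z_def y_def x0 m_proj_zero)
      have zc: "isCont z t0"
        using zd[of t0] \<epsilon>1 has_vector_derivative_continuous by (metis centre_in_ball)
      \<comment> \<open>The first two bounds place \<open>z\<close> and its adjoint in the ball
        where \<open>fac\<close> is injective; the third excludes nonzero multiples of
        \<open>2 * pi * \<i>\<close> as trace.\<close>
      have ev: "eventually (\<lambda>t. norm (z t) < \<delta> \<and> norm (conj_transpose (z t)) < \<delta> \<and> norm (trace (z t)) < 1) (nhds t0)"
      proof (intro eventually_conj)
        note * = eventually_norm_linear_less[OF _ zc z0(1)]
        show "eventually (\<lambda>t. norm (z t) < \<delta>) (nhds t0)"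
          using *[OF bounded_linear_ident \<delta>] .
        show "eventually (\<lambda>t. norm (conj_transpose (z t)) < \<delta>) (nhds t0)"
          using *[OF bounded_linear_conj_transpose \<delta>] .
        show "eventually (\<lambda>t. norm (trace (z t)) < 1) (nhds t0)"
          using *[OF bounded_linear_trace zero_less_one] .
      qed
      then obtain \<epsilon>2 where \<epsilon>2: "\<epsilon>2 > 0" "\<And>t. t \<in> ball t0 \<epsilon>2 \<Longrightarrow>
          norm (z t) < \<delta> \<and> norm (conj_transpose (z t)) < \<delta> \<and> norm (trace (z t)) < 1"
        by (auto simp: eventually_nhds_metric dist_commute)
      define e where "e = min \<epsilon>1 \<epsilon>2"
      have e: "e > 0" "ball t0 e \<subseteq> I" and e1: "t \<in> ball t0 e \<Longrightarrow> t \<in> ball t0 \<epsilon>1"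
        and e2: "t \<in> ball t0 e \<Longrightarrow> t \<in> ball t0 \<epsilon>2" for t
        using \<epsilon> \<epsilon>1 \<epsilon>2 by (auto simp: e_def)
      have yz': "mexp (z t) = mexp (- y t) ** (h ** g t)" if "t \<in> ball t0 e" for t
        using yz[OF e1[OF that]] mat5.ex_minus(1)[of "y t"] by (simp add: mexp_eq_ex matrix_mul_assoc)
      \<comment> \<open>Unitarity of \<open>mexp (z t)\<close> says that the adjoint of
        \<open>z t\<close> and \<open>- z t\<close> have the same exponential. Both are killed by
        \<open>m_proj\<close>, so on them \<open>fac\<close> is exp and its injectivity shows that
        \<open>z t\<close> is skew-Hermitian.\<close>
      have zH: "z t \<in> \<hh>" if t: "t \<in> ball t0 e" for t
      proof -
        have "y t \<in> su5"
          by (simp add: y_def m_proj_su5)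
        then have "mexp (z t) \<in> SU5"
          unfolding yz'[OF t] using e(2) t h g by (metis SU5_mult mexp_SU5 subsetD subspace_neg subspace_su5)
        then have SU: "mexp (conj_transpose (z t)) ** mexp (z t) = mat 1" "det (mexp (z t)) = 1"
          by (auto simp: SU5_iff conj_transpose_mexp)
        have "mexp (conj_transpose (z t)) = mexp (conj_transpose (z t)) ** (mexp (z t) ** mexp (- z t))"
          using mat5.ex_minus(2)[of "z t"] by (simp add: mexp_eq_ex)
        also have "\<dots> = mexp (- z t)"
          using SU(1) by (simp add: matrix_mul_assoc)
        finally have "mexp (conj_transpose (z t)) = mexp (- z t)" .
        moreover have p: "m_proj (z t) = 0"
          by (simp add: z_def m_proj_diff)
        ultimately have "mat5.fac m_proj (conj_transpose (z t)) = mat5.fac m_proj (- z t)"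
          by (simp add: mat5.fac_def m_proj_conj_transpose m_proj_minus mexp_eq_ex)
        then have skew: "conj_transpose (z t) = - z t"
          using inj_onD[OF inj] \<epsilon>2(2)[OF e2[OF t]] by simp
        have "cnj (trace (z t)) = trace (conj_transpose (z t))"
          by (simp add: trace_def sum_5)
        then have "Re (trace (z t)) = 0"
          by (simp add: skew trace_minus complex_eq_iff)
        \<comment> \<open>Determinant 1 makes the trace a multiple of \<open>2 * pi * \<i>\<close>;
          smallness selects 0.\<close>
        moreover have "Im (trace (z t)) = 0"
        proof -
          have "exp (trace (z t)) = 1"
            using SU(2) by (simp add: det_mexp)
          then obtain n :: int where n: "Im (trace (z t)) = of_int (2 * n) * pi"
            by (auto simp: exp_eq_1)
          have "\<bar>Im (trace (z t))\<bar> < 1"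
            using \<epsilon>2(2)[OF e2[OF t]] abs_Im_le_cmod[of "trace (z t)"] by linarith
          moreover have "\<bar>Im (trace (z t))\<bar> \<ge> 2 * pi" if "n \<noteq> 0"
          proof -
            have "\<bar>real_of_int n\<bar> \<ge> 1"
              using that by linarith
            then show ?thesis
              using mult_right_mono[of 1 "\<bar>real_of_int n\<bar>" "2 * pi"] by (simp add: n abs_mult)
          qed
          moreover have "2 * pi > 1"
            using pi_gt3 by simp
          ultimately show ?thesis
            using n by force
        qed
        ultimately have "trace (z t) = 0"
          by (simp add: complex_eq_iff)
        then show ?thesis
          using skew p by (intro hh_if_m_proj_eq_0) (auto simp: su5_iff)
      qed
      have g_eq: "g t = g t0 ** mexp (y t) ** mexp (z t)" if "t \<in> ball t0 e" for t
        using yz[OF e1[OF that]] SU5_cancel(2)[OF g[OF t0], of "g t"] by (simp add: h_def flip: matrix_mul_assoc)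
      have ysu: "y t \<in> su5" for t
        by (simp add: y_def m_proj_su5)
      have coset: "left_coset (g t0 ** mexp (y t)) = left_coset (g t)" if t: "t \<in> ball t0 e" for t
      proof -
        have a: "g t0 ** mexp (y t) \<in> SU5"
          using g[OF t0] ysu by (simp add: mexp_SU5)
        moreover have "g t \<in> SU5"
          using g e t by blast
        moreover have "conj_transpose (g t0 ** mexp (y t)) ** g t = mexp (z t)"
          by (simp add: g_eq[OF t] SU5_cancel(1)[OF a])
        ultimately show ?thesis
          using mexp_hh[OF zH[OF t]] by (simp add: left_coset_eq_iff)
      qed
      have t0e: "t0 \<in> ball t0 e"
        using e by simp
      \<comment> \<open>\<open>g\<close> and the chart curve lift the same curve of cosets, so their
        horizontal velocities are conjugate by \<open>mexp (z t)\<close>.\<close>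
      have step: "m_proj (log_dex (y t) (m_proj (x' t))) = mexp (z t) ** v t ** conj_transpose (mexp (z t))"
        if t: "t \<in> ball t0 e" for t
      proof -
        note c = chart_curve[OF g[OF t0] yd(1)[OF e1[OF t]] ysu]
        have "m_proj (conj_transpose (g t0 ** mexp (y t)) ** (g t0 ** mat5.dex (y t) (m_proj (x' t)))) =
          conj_transpose (conj_transpose (mexp (z t))) ** m_proj (conj_transpose (g t) ** (g t ** v t)) ** conj_transpose (mexp (z t))"
        proof (rule m_proj_lift_transition[OF g' c(1) open_ball[of t0 e] t])
          show "t \<in> I"
            using t e by blast
          show "conj_transpose (mexp (z t)) = conj_transpose (g t) ** (g t0 ** mexp (y t))"
            using SU5_cancel(3)[OF g[OF t0]] SU5_inverse(1)[OF mexp_SU5[OF ysu]] SU5_inverse(1)[OF g[OF t0]]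
            by (simp add: g_eq[OF t] conj_transpose_mult matrix_mul_assoc)
              (metis SU5_cancel(4) mexp_SU5 ysu SU5_inverse(1) g t0 matrix_mul_assoc matrix_mul_rid)
        qed (use e g coset t0 ysu in \<open>auto simp: mexp_SU5\<close>)
        moreover have "m_proj (v t) = v t" "conj_transpose (g t) ** (g t ** v t) = v t"
          using t e v[of t] g[of t] by (auto simp: mm_iff SU5_cancel)
        ultimately show ?thesis
          by (simp add: c(2))
      qed
      define \<zeta> where "\<zeta> = x' t0 - m_proj (x' t0)"
      have k: "((\<lambda>t. mexp (z t)) has_vector_derivative \<zeta>) (at t0)"
        using mexp_compose_has_vector_derivative[OF zd[OF e1[OF t0e]]] by (simp add: z0 \<zeta>_def)
      have "m_proj (x' t0) = v t0"
        using step[OF t0e] by (simp add: z0)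
      \<comment> \<open>At \<open>t0\<close> the velocity of \<open>h ** g t\<close> is
        \<open>\<zeta>\<close> plus the velocity of \<open>y\<close>. The latter already equals
        \<open>v t0\<close>, so nothing is left for \<open>\<zeta>\<close>.\<close>
      have "\<zeta> = 0"
      proof -
        have "h ** (g t0 ** v t0) = v t0"
          using SU5_cancel(1)[OF g[OF t0]] by (simp add: h_def)
        then have "((\<lambda>t. h ** g t) has_vector_derivative v t0) (at t0)"
          using mult_right_deriv[OF g'[OF t0]] by metis
        moreover have "((\<lambda>t. h ** g t) has_vector_derivative mexp (y t0) ** \<zeta> + mat5.dex (y t0) (m_proj (x' t0)) ** mexp (z t0)) (at t0)"
          by (rule has_vector_derivative_transform_within_open[OF mat5.mult.has_vector_derivative[
                OF mexp_compose_has_vector_derivative[OF yd(1)[OF e1[OF t0e]]] k] open_ball[of t0 e] t0e])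
            (use yz e1 in metis)
        ultimately have "v t0 = mexp (y t0) ** \<zeta> + mat5.dex (y t0) (m_proj (x' t0)) ** mexp (z t0)"
          by (rule vector_derivative_unique_at)
        then show ?thesis
          by (simp add: z0 \<open>m_proj (x' t0) = v t0\<close>)
      qed
      \<comment> \<open>Differentiate \<open>step\<close> at \<open>t0\<close>: the bracket
        correction is \<open>[y', y'] = 0\<close>, and the conjugating factor is stationary because
        \<open>\<zeta> = 0\<close>.\<close>
      have "m_proj (x'' t0) = v' t0"
      proof -
        have l: "((\<lambda>t. m_proj (log_dex (y t) (m_proj (x' t)))) has_vector_derivative
            m_proj (m_proj (x'' t0) - (1/2) *\<^sub>R lie_bracket (m_proj (x' t0)) (m_proj (x' t0)))) (at t0)"
          by (intro m_proj_deriv log_dex_has_vector_derivative yd e1 t0e z0)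
        have "((\<lambda>t. mexp (z t) ** v t ** conj_transpose (mexp (z t))) has_vector_derivative
            mexp (z t0) ** v t0 ** conj_transpose \<zeta> + (mexp (z t0) ** v' t0 + \<zeta> ** v t0) ** conj_transpose (mexp (z t0))) (at t0)"
          by (intro mat5.mult.has_vector_derivative k conj_transpose_deriv v' t0)
        then have "((\<lambda>t. m_proj (log_dex (y t) (m_proj (x' t)))) has_vector_derivative
            mexp (z t0) ** v t0 ** conj_transpose \<zeta> + (mexp (z t0) ** v' t0 + \<zeta> ** v t0) ** conj_transpose (mexp (z t0))) (at t0)"
          by (rule has_vector_derivative_transform_within_open[OF _ open_ball[of t0 e] t0e]) (simp add: step)
        from vector_derivative_unique_at[OF l this] show ?thesis
          by (simp add: \<open>\<zeta> = 0\<close> z0 lie_bracket_self mat5.mult.zero_left mat5.mult.zero_right)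
      qed
      have "v' t0 \<in> \<mm>"
        using mm_has_vector_derivative[OF v'[OF t0] I(1) t0 v] .
      then have acc: "\<forall>Z\<in>\<mm>. covariant_acceleration (chart_metric B (g t0)) 0 (v t0) (v' t0) Z = 0"
        using covariant_acceleration_zero_iff[OF g[OF t0] v[OF t0]] euler[OF t0] by blast
      show "\<exists>g'\<in>SU5. \<exists>\<epsilon>>0. \<exists>x x' x''. ball t0 \<epsilon> \<subseteq> I \<and> x t0 = 0 \<and>
          (\<forall>t\<in>ball t0 \<epsilon>. x t \<in> \<mm> \<and> left_coset (g t) = exp_chart g' (x t) \<and>
             (x has_vector_derivative x' t) (at t) \<and> (x' has_vector_derivative x'' t) (at t)) \<and>
          (\<forall>z\<in>\<mm>. covariant_acceleration (chart_metric B g') (x t0) (x' t0) (x'' t0) z = 0)"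
      proof (rule bexI[OF _ g[OF t0]], rule exI[of _ e], intro conjI e,
          rule exI[of _ y], rule exI[of _ "\<lambda>t. m_proj (x' t)"], rule exI[of _ "\<lambda>t. m_proj (x'' t)"],
          intro conjI ballI e z0(2))
        fix t
        assume t: "t \<in> ball t0 e"
        show "y t \<in> \<mm>"
          by (simp add: y_def m_proj_mm)
        show "left_coset (g t) = exp_chart (g t0) (y t)"
          using coset[OF t] by (simp add: exp_chart_def)
        show "(y has_vector_derivative m_proj (x' t)) (at t)"
          "((\<lambda>t. m_proj (x' t)) has_vector_derivative m_proj (x'' t)) (at t)"
          by (rule yd[OF e1[OF t]])+
      next
        fix Z
        assume "Z \<in> \<mm>"
        then show "covariant_acceleration (chart_metric B (g t0)) (y t0) (m_proj (x' t0)) (m_proj (x'' t0)) Z = 0"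
          using acc by (simp add: z0 \<open>m_proj (x' t0) = v t0\<close> \<open>m_proj (x'' t0) = v' t0\<close>)
      qed
    qed
  qed
qed

end

subsection \<open>Existence and homogeneity of geodesics\<close>

lemma vector_derivative_zero_imp_eq_on:
  fixes f :: "real \<Rightarrow> 'a::real_normed_vector"
  assumes "open I" "is_interval I" "s \<in> I" "t \<in> I" "\<And>t. t \<in> I \<Longrightarrow> (f has_vector_derivative 0) (at t)"
  shows "f t = f s"
proof -
  have "convex I"
    using assms(2) by (simp add: is_interval_convex)
  moreover have "(f has_vector_derivative 0) (at t within I)" if "t \<in> I" for t
    using assms(5)[OF that] by (rule has_vector_derivative_at_within)
  ultimately obtain c where "\<And>t. t \<in> I \<Longrightarrow> f t = c"
    using has_vector_derivative_zero_constant[of I f] by auto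
  then show ?thesis
    using assms(3,4) by simp
qed

text \<open>By \<open>SU2U2_iff\<close> the isotropy group is the common stabiliser of
  \<open>E11\<close> under left multiplication and of \<open>P2\<close> under conjugation, so the
  two orbit points determine the coset. Equality of cosets becomes an equation between vectors,
  which can be proved by differentiation.\<close>

lemma left_coset_eqI:
  assumes "g \<in> SU5" "h \<in> SU5" "g ** E11 = h ** E11" "g ** P2 ** conj_transpose g = h ** P2 ** conj_transpose h"
  shows "left_coset g = left_coset h"
proof -
  have "conj_transpose g ** h ** E11 = conj_transpose g ** (h ** E11)"
    by (simp add: matrix_mul_assoc)
  also have "\<dots> = E11"
    using assms by (metis SU5_cancel(1))
  finally have 1: "conj_transpose g ** h ** E11 = E11" .
  have "conj_transpose g ** h ** P2 = conj_transpose g ** (h ** P2 ** conj_transpose h) ** h"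
    by (metis SU5_cancel(4)[OF assms(2)] matrix_mul_assoc)
  also have "\<dots> = conj_transpose g ** (g ** P2 ** conj_transpose g) ** h"
    using assms by simp
  also have "\<dots> = P2 ** (conj_transpose g ** h)"
    using SU5_inverse(1)[OF assms(1)] by (simp add: matrix_mul_assoc)
  finally show ?thesis
    using 1 assms by (simp add: left_coset_eq_iff SU2U2_iff)
qed

lemma left_coset_eqD:
  assumes "g \<in> SU5" "h \<in> SU5" "left_coset g = left_coset h"
  shows "g ** E11 = h ** E11" "g ** P2 ** conj_transpose g = h ** P2 ** conj_transpose h"
proof -
  define k where "k = conj_transpose g ** h"
  have k: "k \<in> SU2U2"
    using assms by (simp add: k_def left_coset_eq_iff)
  have h: "h = g ** k"
    using assms by (simp add: k_def SU5_cancel)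
  show "g ** E11 = h ** E11"
    using k by (simp add: h SU2U2_iff flip: matrix_mul_assoc)
  have "k ** P2 ** conj_transpose k = P2 ** (k ** conj_transpose k)"
    using k by (simp add: SU2U2_iff matrix_mul_assoc)
  also have "\<dots> = P2"
    using k SU2U2_SU5 SU5_inverse(2) by simp
  finally have "g ** (k ** P2 ** conj_transpose k) ** conj_transpose g = g ** P2 ** conj_transpose g"
    by simp
  then show "g ** P2 ** conj_transpose g = h ** P2 ** conj_transpose h"
    by (simp add: h conj_transpose_mult matrix_mul_assoc)
qed

section \<open>Existence of geodesics and the algebraic geodesic orbit condition\<close>

context metric_operator
begin

text \<open>The lift and its velocity together obey a homogeneous quadratic system, so one existence
  lemma covers both.\<close>

lemma euler_bilinear:
  "bounded_bilinear (\<lambda>(p :: cmat5 \<times> cmat5) (q :: cmat5 \<times> cmat5). (fst p ** snd q, L' (m_proj (lie_bracket (L (m_proj (snd p))) (m_proj (snd q))))))"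
proof (rule iffD1[OF bilinear_conv_bounded_bilinear], unfold bilinear_def, intro conjI allI linearI)
qed (simp_all add: mat5.mult.add_left mat5.mult.add_right mat5.mult.scaleR_left mat5.mult.scaleR_right
      lie_bracket_add_left lie_bracket_add_right lie_bracket_scaleR_left lie_bracket_scaleR_right
      m_proj_add m_proj_scaleR linear_add[OF linear_L] linear_add[OF linear_L'] linear_cmul[OF linear_L] linear_cmul[OF linear_L'])

text \<open>\<open>g g^*\<close> is the product to differentiate: \<open>v\<close> and its adjoint
  meet between the two factors and cancel, whereas the derivative of \<open>g^* g\<close> is its
  commutator with \<open>v\<close>.\<close>

lemma SU5_solution:
  assumes I: "open I" "is_interval I" "0 \<in> I" and g0: "g 0 = mat 1"
    and g: "\<And>t. t \<in> I \<Longrightarrow> (g has_vector_derivative g t ** v t) (at t)" and v: "\<And>t. t \<in> I \<Longrightarrow> v t \<in> su5"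
    and t: "t \<in> I"
  shows "g t \<in> SU5"
proof -
  have D: "((\<lambda>t. g t ** conj_transpose (g t)) has_vector_derivative 0) (at t)" if t: "t \<in> I" for t
    using mat5.mult.has_vector_derivative[OF g[OF t] conj_transpose_deriv[OF g[OF t]]]
      v[OF t]
    by (simp add: conj_transpose_mult su5_iff mat5.mult.minus_left mat5.mult.minus_right matrix_mul_assoc)
  have inv: "g t ** conj_transpose (g t) = mat 1" if "t \<in> I" for t
    using vector_derivative_zero_imp_eq_on[OF I that D] g0 by simp
  then have inv': "conj_transpose (g t) ** g t = mat 1" if "t \<in> I" for t
    using that matrix_left_right_inverse by metis
  have D: "((\<lambda>s. det (g s)) has_vector_derivative 0) (at t)" if t: "t \<in> I" for t
  proof -
    have "((\<lambda>s. conj_transpose (g t) ** g s) has_vector_derivative conj_transpose (g t) ** (g t ** v t)) (at t)"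
      by (intro mult_right_deriv g t)
    then have "((\<lambda>s. det (conj_transpose (g t) ** g s)) has_vector_derivative trace (conj_transpose (g t) ** (g t ** v t))) (at t)"
      by (rule det_has_vector_derivative_at_one) (rule inv'[OF t])
    moreover have "trace (conj_transpose (g t) ** (g t ** v t)) = 0"
      using v[OF t] inv'[OF t] by (simp add: su5_iff matrix_mul_assoc)
    ultimately have "((\<lambda>s. det (g t) * det (conj_transpose (g t) ** g s)) has_vector_derivative det (g t) * 0) (at t)"
      using bounded_linear.has_vector_derivative[OF bounded_linear_mult_right[of "det (g t)"]] by metis
    moreover have "det (g t) * det (conj_transpose (g t) ** g s) = det (g s)" for s
      using inv[OF t] by (simp add: matrix_mul_assoc flip: det_mul)
    ultimately show ?thesis
      by simp
  qed
  have "det (g t) = 1"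
    using vector_derivative_zero_imp_eq_on[OF I t D] g0 by simp
  then show ?thesis
    using inv'[OF t] by (simp add: SU5_iff)
qed

lemma geodesic_exists:
  assumes X: "X \<in> \<mm>"
  obtains I g v v' r where "r > 0" "0 \<in> I" "open I" "g 0 = mat 1" "v 0 = r *\<^sub>R X" "geodesic B I (\<lambda>t. left_coset (g t))"
    "\<And>t. t \<in> I \<Longrightarrow> g t \<in> SU5" "\<And>t. t \<in> I \<Longrightarrow> v t \<in> \<mm>"
    "\<And>t. t \<in> I \<Longrightarrow> (g has_vector_derivative g t ** v t) (at t)"
    "\<And>t. t \<in> I \<Longrightarrow> (v has_vector_derivative v' t) (at t)" "\<And>t. t \<in> I \<Longrightarrow> v' t \<in> \<mm>"
    "\<And>t. t \<in> I \<Longrightarrow> L (v' t) = m_proj (lie_bracket (L (v t)) (v t))"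
proof (rule horizontal_geodesic, goal_cases)
  case (1 \<delta>)
  note geo = 1(3)
  \<comment> \<open>Small enough for \<open>horizontal_geodesic\<close>; the summand 1 covers
    \<open>X = 0\<close>.\<close>
  define r where "r = \<delta> / (2 * (norm X + 1))"
  have r: "r > 0" "norm (r *\<^sub>R X) < \<delta>"
  proof -
    have "norm X + 1 > 0"
      by (simp add: add_nonneg_pos)
    then show "r > 0" "norm (r *\<^sub>R X) < \<delta>"
      using \<open>\<delta> > 0\<close> by (simp_all add: r_def field_simps add_strict_increasing2 add_nonneg_pos)
  qed
  define W where "W v = L' (m_proj (lie_bracket (L (m_proj v)) (m_proj v)))" for v
  obtain \<tau> y where \<tau>: "\<tau> > 0" and y0: "y 0 = (mat 1, r *\<^sub>R X)"
    and y: "\<And>t. t \<in> {-\<tau><..<\<tau>} \<Longrightarrow> (y has_vector_derivative (fst (y t) ** snd (y t), W (snd (y t)))) (at t)"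
    unfolding W_def by (rule quadratic_ode_solution[OF euler_bilinear, of "(mat 1, r *\<^sub>R X)"]; blast)
  define g where "g t = fst (y t)" for t
  define v where "v t = snd (y t)" for t
  have g': "(g has_vector_derivative g t ** v t) (at t)" and v': "(v has_vector_derivative W (v t)) (at t)"
    if "t \<in> {-\<tau><..<\<tau>}" for t
    using bounded_linear.has_vector_derivative[OF bounded_linear_fst y[OF that]]
      bounded_linear.has_vector_derivative[OF bounded_linear_snd y[OF that]]
    by (simp_all add: g_def[abs_def] v_def[abs_def])
  have W: "W v \<in> \<mm>" for v
    by (simp add: W_def L'_mm m_proj_mm)
  have J: "open {-\<tau><..<\<tau>}" "is_interval {-\<tau><..<\<tau>}" "0 \<in> {-\<tau><..<\<tau>}"
    using \<tau> by (auto simp: is_interval_def)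
  \<comment> \<open>The right-hand side of the equation takes values in \<open>\<mm>\<close>, so the
    component of \<open>v\<close> outside \<open>\<mm>\<close> is constant, and it is zero
    initially.\<close>
  have D: "((\<lambda>t. v t - m_proj (v t)) has_vector_derivative 0) (at t)" if "t \<in> {-\<tau><..<\<tau>}" for t
    using has_vector_derivative_diff[OF v'[OF that] m_proj_deriv[OF v'[OF that]]]
      W[of "v t"] by (simp add: mm_iff)
  have "v t - m_proj (v t) = v 0 - m_proj (v 0)" if "t \<in> {-\<tau><..<\<tau>}" for t
    by (rule vector_derivative_zero_imp_eq_on[OF J that D])
  moreover have v0: "v 0 = r *\<^sub>R X" and g0: "g 0 = mat 1"
    by (simp_all add: v_def g_def y0)
  ultimately have vm: "v t \<in> \<mm>" if "t \<in> {-\<tau><..<\<tau>}" for t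
    using that X by (simp add: mm_iff m_proj_scaleR)
  have gS: "g t \<in> SU5" if "t \<in> {-\<tau><..<\<tau>}" for t
    by (rule SU5_solution[OF J g0 g' mm_su5[OF vm] that])
  have "isCont v 0"
    using v' J(3) has_vector_derivative_continuous by blast
  then have "isCont (\<lambda>t. norm (v t)) 0"
    by (rule isCont_norm)
  then have "((\<lambda>t. norm (v t)) \<longlongrightarrow> norm (v 0)) (nhds 0)"
    using tendsto_at_iff_tendsto_nhds[of "\<lambda>s. norm (v s)" 0] by (simp add: isCont_def)
  moreover have "norm (v 0) < \<delta>"
    using r v0 by simp
  ultimately have "eventually (\<lambda>t. norm (v t) < \<delta>) (nhds 0)"
    by (rule order_tendstoD(2))
  then obtain e where e: "e > 0" "\<And>t. \<bar>t\<bar> < e \<Longrightarrow> norm (v t) < \<delta>"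
    by (auto simp: eventually_nhds_metric dist_real_def)
  define \<rho> where "\<rho> = min \<tau> e"
  let ?I = "{-\<rho><..<\<rho>}"
  have I: "open ?I" "is_interval ?I" "0 \<in> ?I"
    using \<tau> e by (auto simp: is_interval_def \<rho>_def)
  have sub: "t \<in> {-\<tau><..<\<tau>}" "norm (v t) < \<delta>" if "t \<in> ?I" for t
    using that e(2)[of t] by (auto simp: \<rho>_def)
  have euler: "L (W (v t)) = m_proj (lie_bracket (L (v t)) (v t))" if "t \<in> ?I" for t
    using vm[OF sub(1)[OF that]] by (simp add: W_def L_L' m_proj_mm mm_iff)
  have "geodesic B ?I (\<lambda>t. left_coset (g t))"
    by (rule geo[OF I(1,2), where v = v and v' = "\<lambda>t. W (v t)"]) (auto intro!: gS vm sub g' v' euler)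
  then show ?case
    by (intro 1(1)[where I = ?I and g = g and v = v and r = r and v' = "\<lambda>t. W (v t)"] r(1) I g0 v0) (auto intro!: gS vm sub g' v' euler W)
qed

text \<open>The homogeneous lift has constant logarithmic derivative \<open>Y\<close>. Passing to
  the horizontal lift conjugates the \<open>\<mm>\<close>-part of \<open>Y\<close> by a curve in the
  isotropy group; differentiating this at time 0 turns the derivative of \<open>v\<close> into a
  bracket with an element of \<open>\<hh>\<close>.\<close>

lemma geodesic_orbit_imp:
  assumes go: "geodesic_orbit B" and X: "X \<in> \<mm>"
  obtains a where "a \<in> \<hh>" "L (lie_bracket a X) = m_proj (lie_bracket (L X) X)"
proof -
  obtain I g v v' r where r: "r > 0" and I: "0 \<in> I" "open I" and g0: "g 0 = mat 1" and v0: "v 0 = r *\<^sub>R X"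
    and geo: "geodesic B I (\<lambda>t. left_coset (g t))"
    and gv: "\<And>t. t \<in> I \<Longrightarrow> g t \<in> SU5" "\<And>t. t \<in> I \<Longrightarrow> v t \<in> \<mm>"
    "\<And>t. t \<in> I \<Longrightarrow> (g has_vector_derivative g t ** v t) (at t)"
    "\<And>t. t \<in> I \<Longrightarrow> (v has_vector_derivative v' t) (at t)" "\<And>t. t \<in> I \<Longrightarrow> v' t \<in> \<mm>"
    "\<And>t. t \<in> I \<Longrightarrow> L (v' t) = m_proj (lie_bracket (L (v t)) (v t))"
    by (rule geodesic_exists[OF X]; blast)
  obtain Y where Y: "Y \<in> su5" "\<And>t. t \<in> I \<Longrightarrow> left_coset (g t) = translate (mexp (t *\<^sub>R Y)) (left_coset (g 0))"
    using go geo I(1) unfolding geodesic_orbit_def by blast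
  define \<alpha> where "\<alpha> t = mexp (t *\<^sub>R Y)" for t
  have \<alpha>S: "\<alpha> t \<in> SU5" for t
    using Y(1) by (simp add: \<alpha>_def mexp_SU5 subspace_scale[OF subspace_su5])
  have \<alpha>': "(\<alpha> has_vector_derivative \<alpha> t ** Y) (at t)" for t
  proof -
    have "Y ** mexp (t *\<^sub>R Y) = mexp (t *\<^sub>R Y) ** Y"
      unfolding mexp_eq_ex
      by (rule mat5.ex_commute[symmetric]) (simp add: mat5.mult.scaleR_left mat5.mult.scaleR_right)
    then show ?thesis
      using mat5.ex_scaleR_deriv[of Y t] by (simp add: \<alpha>_def[abs_def] mexp_eq_ex)
  qed
  have eq: "left_coset (\<alpha> t) = left_coset (g t)" if "t \<in> I" for t
    using Y(2)[OF that] g0 by (simp add: translate_left_coset \<alpha>_def)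
  define k where "k t = conj_transpose (\<alpha> t) ** g t" for t
  obtain \<eta> where \<eta>: "\<eta> \<in> \<hh>" "(k has_vector_derivative k 0 ** \<eta>) (at 0)"
    unfolding k_def[abs_def]
    by (rule lift_transition[OF \<alpha>' gv(3)[OF I(1)] I(2,1) \<alpha>S gv(1) eq]; blast)
  have k0: "k 0 = mat 1"
    by (simp add: k_def \<alpha>_def g0)
  have v: "v t = conj_transpose (k t) ** m_proj Y ** k t" if t: "t \<in> I" for t
  proof -
    have "m_proj (conj_transpose (g t) ** (g t ** v t)) = conj_transpose (k t) ** m_proj (conj_transpose (\<alpha> t) ** (\<alpha> t ** Y)) ** k t"
      by (rule m_proj_lift_transition[OF \<alpha>' gv(3)[OF t] I(2) t \<alpha>S gv(1) eq]) (simp_all add: k_def)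
    then show ?thesis
      using gv(2)[OF t] by (simp add: SU5_cancel(1)[OF \<alpha>S] SU5_cancel(1)[OF gv(1)[OF t]] mm_iff)
  qed
  then have Yv: "m_proj Y = v 0"
    using I(1) by (simp add: k0)
  have "((\<lambda>t. conj_transpose (k t) ** m_proj Y ** k t) has_vector_derivative
      conj_transpose (k 0) ** m_proj Y ** (k 0 ** \<eta>) + (conj_transpose (k 0) ** 0 + conj_transpose (k 0 ** \<eta>) ** m_proj Y) ** k 0) (at 0)"
    by (intro mat5.mult.has_vector_derivative \<eta>(2) conj_transpose_deriv[OF \<eta>(2)]
        has_vector_derivative_const)
  then have "((\<lambda>t. conj_transpose (k t) ** m_proj Y ** k t) has_vector_derivative lie_bracket (v 0) \<eta>) (at 0)"
    using hh_su5[OF \<eta>(1)]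
    by (simp add: k0 Yv lie_bracket_def su5_iff mat5.mult.zero_right mat5.mult.minus_left)
  then have "(v has_vector_derivative lie_bracket (v 0) \<eta>) (at 0)"
    by (rule has_vector_derivative_transform_within_open[OF _ I(2,1)]) (simp add: v)
  then have "v' 0 = lie_bracket (v 0) \<eta>"
    using gv(4)[OF I(1)] vector_derivative_unique_at by blast
  then have "L (lie_bracket (r *\<^sub>R X) \<eta>) = m_proj (lie_bracket (L (r *\<^sub>R X)) (r *\<^sub>R X))"
    using gv(6)[OF I(1)] by (simp add: v0)
  then have "r *\<^sub>R L (lie_bracket X \<eta>) = r *\<^sub>R (r *\<^sub>R m_proj (lie_bracket (L X) X))"
    by (simp add: lie_bracket_scaleR_left lie_bracket_scaleR_right linear_cmul[OF linear_L] m_proj_scaleR)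
  then have "L (lie_bracket X \<eta>) = r *\<^sub>R m_proj (lie_bracket (L X) X)"
    by (rule scaleR_left_imp_eq[rotated]) (use r in simp)
  \<comment> \<open>The geodesic equation is quadratic in the velocity and the bracket with
    \<open>\<eta>\<close> is linear in it, so one factor \<open>r\<close> has to be divided out; the
    sign comes from swapping the bracket.\<close>
  then have "L (lie_bracket ((- 1 / r) *\<^sub>R \<eta>) X) = m_proj (lie_bracket (L X) X)"
    using r lie_bracket_swap[of \<eta> X]
    by (simp add: lie_bracket_scaleR_left linear_cmul[OF linear_L] linear_neg[OF linear_L] del: scaleR_minus_left)
  moreover have "(- 1 / r) *\<^sub>R \<eta> \<in> \<hh>"
    using \<eta>(1) subspace_hh subspace_scale by blast
  ultimately show ?thesis
    using that by blast
qed

text \<open>The charts at different times are chosen independently, so the representatives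
  \<open>G t\<close> need not form a differentiable curve. Hence \<open>J\<close> and
  \<open>\<phi>\<close> are built so as not to depend on the representative, and near each time they
  are rewritten in the single chart centred there, where they can be differentiated.\<close>

lemma normal_geodesic_orbit:
  assumes L: "\<And>X. X \<in> \<mm> \<Longrightarrow> L X = X"
  shows "geodesic_orbit B"
  unfolding geodesic_orbit_def
proof (intro allI impI, elim conjE)
  fix I c
  assume geo: "geodesic B I c" and I0: "0 \<in> I"
  have I: "open I" "is_interval I"
    using geo by (auto simp: geodesic_def)
  define Ch where "Ch t0 g \<epsilon> x x' x'' \<longleftrightarrow> g \<in> SU5 \<and> \<epsilon> > 0 \<and> ball t0 \<epsilon> \<subseteq> I \<and> x t0 = 0 \<and>
    (\<forall>t\<in>ball t0 \<epsilon>. x t \<in> \<mm> \<and> c t = exp_chart g (x t) \<and>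
       (x has_vector_derivative x' t) (at t) \<and> (x' has_vector_derivative x'' t) (at t)) \<and>
    (\<forall>z\<in>\<mm>. covariant_acceleration (chart_metric B g) (x t0) (x' t0) (x'' t0) z = 0)"
    for t0 g \<epsilon> and x x' x'' :: "real \<Rightarrow> cmat5"
  have "\<forall>t0\<in>I. \<exists>g \<epsilon> x x' x''. Ch t0 g \<epsilon> x x' x''"
    using geo unfolding geodesic_def Ch_def by blast
  then obtain G E x x' x'' where Ch: "\<And>t0. t0 \<in> I \<Longrightarrow> Ch t0 (G t0) (E t0) (x t0) (x' t0) (x'' t0)"
    by metis
  have G: "G t \<in> SU5" "E t > 0" "ball t (E t) \<subseteq> I" "x t t = 0" if "t \<in> I" for t
    using Ch[OF that] unfolding Ch_def by blast+
  have x: "x t s \<in> \<mm>" "c s = left_coset (G t ** mexp (x t s))" "(x t has_vector_derivative x' t s) (at s)"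
    "(x' t has_vector_derivative x'' t s) (at s)" if "t \<in> I" "s \<in> ball t (E t)" for t s
    using Ch[OF that(1)] that(2) unfolding Ch_def exp_chart_def by blast+
  have x'm: "x' t s \<in> \<mm>" if "t \<in> I" "s \<in> ball t (E t)" for t s
    by (rule mm_has_vector_derivative[OF x(3)[OF that] open_ball that(2) x(1)[OF that(1)]])
  have x''m: "x'' t s \<in> \<mm>" if "t \<in> I" "s \<in> ball t (E t)" for t s
    by (rule mm_has_vector_derivative[OF x(4)[OF that] open_ball that(2) x'm[OF that(1)]])
  have t_in: "t \<in> ball t (E t)" if "t \<in> I" for t
    using G(2)[OF that] by simp
  have c: "c t = left_coset (G t)" if "t \<in> I" for t
    using x(2)[OF that t_in[OF that]] G(4)[OF that] by simp
  \<comment> \<open>For the normal metric the bracket in the geodesic equation is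
    \<open>[U, U] = 0\<close>, so the acceleration vanishes in centred coordinates.\<close>
  have x''0: "x'' t t = 0" if t: "t \<in> I" for t
  proof -
    have "\<forall>z\<in>\<mm>. covariant_acceleration (chart_metric B (G t)) 0 (x' t t) (x'' t t) z = 0"
      using Ch[OF t] G(4)[OF t] unfolding Ch_def by metis
    then have "L (x'' t t) = m_proj (lie_bracket (L (x' t t)) (x' t t))"
      using covariant_acceleration_zero_iff[OF G(1)[OF t] x'm[OF t t_in[OF t]] x''m[OF t t_in[OF t]]] by simp
    then show ?thesis
      by (simp add: L x'm[OF t t_in[OF t]] x''m[OF t t_in[OF t]] lie_bracket_self m_proj_zero)
  qed
  define J where "J t = G t ** x' t t ** conj_transpose (G t)" for t
  define a where "a t s = G t ** mexp (x t s)" for t s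
  define M where "M t s = m_proj (log_dex (x t s) (x' t s))" for t s
  have aS: "a t s \<in> SU5" if "t \<in> I" "s \<in> ball t (E t)" for t s
    using x(1)[OF that] G(1)[OF that(1)] by (simp add: a_def mexp_SU5 mm_su5)
  \<comment> \<open>Changing the representative from \<open>a t s\<close> to \<open>G s\<close>
    conjugates the horizontal velocity by \<open>k\<close>, and the outer factors of
    \<open>J\<close> absorb exactly this.\<close>
  have J: "J s = a t s ** M t s ** conj_transpose (a t s)" if t: "t \<in> I" and s: "s \<in> ball t (E t)" for t s
  proof -
    have sI: "s \<in> I"
      using G(3)[OF t] s by blast
    define S where "S = ball t (E t) \<inter> ball s (E s)"
    have S: "open S" "s \<in> S"
      using s G(2)[OF sI] by (auto simp: S_def)
    note c1 = chart_curve[OF G(1)[OF t] x(3)[OF t s] mm_su5[OF x(1)[OF t s]]]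
    note c2 = chart_curve[OF G(1)[OF sI] x(3)[OF sI t_in[OF sI]] mm_su5[OF x(1)[OF sI t_in[OF sI]]]]
    define k where "k = conj_transpose (a t s) ** G s"
    have "m_proj (conj_transpose (G s ** mexp (x s s)) ** (G s ** mat5.dex (x s s) (x' s s)))
        = conj_transpose k ** m_proj (conj_transpose (G t ** mexp (x t s)) ** (G t ** mat5.dex (x t s) (x' t s))) ** k"
    proof (rule m_proj_lift_transition[OF c1(1) c2(1) S])
      fix r
      assume r: "r \<in> S"
      show "G t ** mexp (x t r) \<in> SU5" "G s ** mexp (x s r) \<in> SU5"
        using aS[of t r] aS[of s r] t sI r by (auto simp: S_def a_def)
      show "left_coset (G t ** mexp (x t r)) = left_coset (G s ** mexp (x s r))"
        using x(2)[of t r] x(2)[of s r] t sI r by (auto simp: S_def)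
    qed (simp add: k_def a_def G(4)[OF sI])
    then have "x' s s = conj_transpose k ** M t s ** k"
      using x'm[OF sI t_in[OF sI]] by (simp add: c1(2) M_def G(4)[OF sI] mm_iff SU5_cancel(1)[OF G(1)[OF sI]])
    moreover have "G s ** conj_transpose k = a t s" "k ** conj_transpose (G s) = conj_transpose (a t s)"
      by (simp_all add: k_def conj_transpose_mult SU5_inverse[OF G(1)[OF sI]] SU5_cancel[OF G(1)[OF sI]] matrix_mul_assoc)
    ultimately show ?thesis
      by (simp add: J_def) (metis matrix_mul_assoc)
  qed
  have aD: "(a t has_vector_derivative G t ** x' t t) (at t)" if t: "t \<in> I" for t
    using chart_curve(1)[OF G(1)[OF t] x(3)[OF t t_in[OF t]] mm_su5[OF x(1)[OF t t_in[OF t]]]]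
    by (simp add: a_def[abs_def] G(4)[OF t])
  have JD: "(J has_vector_derivative 0) (at t)" if t: "t \<in> I" for t
  proof -
    note ti = t_in[OF t]
    have MD: "(M t has_vector_derivative m_proj (x'' t t - (1/2) *\<^sub>R lie_bracket (x' t t) (x' t t))) (at t)"
      unfolding M_def[abs_def]
      by (intro m_proj_deriv log_dex_has_vector_derivative x[OF t ti] G(4)[OF t])
    \<comment> \<open>As \<open>M t\<close> is stationary at \<open>t\<close>, the two remaining
      terms are \<open>G x' x' G^*\<close> and its negative, because \<open>x'\<close> is
      skew-Hermitian.\<close>
    have "((\<lambda>s. a t s ** M t s ** conj_transpose (a t s)) has_vector_derivative
       a t t ** M t t ** conj_transpose (G t ** x' t t) +
       (a t t ** m_proj (x'' t t - (1/2) *\<^sub>R lie_bracket (x' t t) (x' t t)) + (G t ** x' t t) ** M t t) ** conj_transpose (a t t)) (at t)"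
      by (intro mat5.mult.has_vector_derivative MD aD[OF t] conj_transpose_deriv)
    moreover have "M t t = x' t t" "a t t = G t"
      using x'm[OF t ti] by (simp_all add: M_def a_def G(4)[OF t] mm_iff)
    moreover have "conj_transpose (x' t t) = - x' t t"
      using mm_su5[OF x'm[OF t ti]] by (simp add: su5_iff)
    ultimately have "((\<lambda>s. a t s ** M t s ** conj_transpose (a t s)) has_vector_derivative 0) (at t)"
      by (simp add: x''0[OF t] lie_bracket_self m_proj_zero mat5.mult.zero_right conj_transpose_mult
          mat5.mult.minus_left mat5.mult.minus_right matrix_mul_assoc)
    then show ?thesis
      by (rule has_vector_derivative_transform_within_open[OF _ open_ball ti]) (simp add: J[OF t])
  qed
  have Jc: "J t = J 0" if "t \<in> I" for t
    by (rule vector_derivative_zero_imp_eq_on[OF I I0 that JD])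
  define X where "X = J 0"
  have X: "X \<in> su5"
    unfolding X_def J_def using su5_Ad[OF G(1)[OF I0]] mm_su5[OF x'm[OF I0 t_in[OF I0]]] by blast
  define N where "N t = mexp (t *\<^sub>R - X) ** G t" for t
  have NS: "N t \<in> SU5" if "t \<in> I" for t
    using X G(1)[OF that] unfolding N_def
    by (intro SU5_mult mexp_SU5 subspace_scale[OF subspace_su5] subspace_neg[OF subspace_su5])
  define \<phi> where "\<phi> t = (N t ** E11, N t ** P2 ** conj_transpose (N t))" for t
  have \<phi>D: "(\<phi> has_vector_derivative 0) (at t)" if t: "t \<in> I" for t
  proof -
    \<comment> \<open>A differentiable representative of the coset of \<open>N s\<close> for
      \<open>s\<close> near \<open>t\<close>. Its derivative at \<open>t\<close> vanishes because
      \<open>X = J t\<close>, that is, \<open>X G = G x'\<close>.\<close>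
    define n where "n s = mexp (s *\<^sub>R - X) ** a t s" for s
    have e: "((\<lambda>s. mexp (s *\<^sub>R - X)) has_vector_derivative mexp (t *\<^sub>R - X) ** - X) (at t)"
    proof -
      have "- X ** mexp (t *\<^sub>R - X) = mexp (t *\<^sub>R - X) ** - X"
        unfolding mexp_eq_ex
        by (rule mat5.ex_commute[symmetric]) (simp add: mat5.mult.scaleR_left mat5.mult.scaleR_right mat5.mult.minus_left mat5.mult.minus_right)
      then show ?thesis
        using mat5.ex_scaleR_deriv[of "-X" t] by (simp add: mexp_eq_ex)
    qed
    have "(n has_vector_derivative mexp (t *\<^sub>R - X) ** (G t ** x' t t) + mexp (t *\<^sub>R - X) ** - X ** a t t) (at t)"
      unfolding n_def[abs_def] by (rule mat5.mult.has_vector_derivative[OF e aD[OF t]])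
    moreover have "X ** a t t = G t ** x' t t"
      using Jc[OF t] SU5_cancel(4)[OF G(1)[OF t], of "G t ** x' t t"]
      by (simp add: X_def[symmetric] J_def[of t] a_def G(4)[OF t])
    ultimately have n: "(n has_vector_derivative 0) (at t)"
      by (simp add: mat5.mult.minus_left mat5.mult.minus_right flip: matrix_mul_assoc)
    have "((\<lambda>s. (n s ** E11, n s ** P2 ** conj_transpose (n s))) has_vector_derivative
        (0 ** E11, n t ** P2 ** conj_transpose 0 + 0 ** P2 ** conj_transpose (n t))) (at t)"
      by (intro has_vector_derivative_Pair mat5.mult.has_vector_derivative n
          mult_left_deriv
          conj_transpose_deriv)
    then have "((\<lambda>s. (n s ** E11, n s ** P2 ** conj_transpose (n s))) has_vector_derivative 0) (at t)"
      by (simp add: mat5.mult.zero_left mat5.mult.zero_right zero_prod_def)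
    then show ?thesis
    proof (rule has_vector_derivative_transform_within_open[OF _ open_ball t_in[OF t]])
      fix s
      assume s: "s \<in> ball t (E t)"
      then have sI: "s \<in> I"
        using G(3)[OF t] by blast
      have nS: "n s \<in> SU5"
        using X aS[OF t s] unfolding n_def
        by (intro SU5_mult mexp_SU5 subspace_scale[OF subspace_su5] subspace_neg[OF subspace_su5])
      have "left_coset (a t s) = left_coset (G s)"
        using x(2)[OF t s] c[OF sI] by (simp add: a_def)
      then have "left_coset (n s) = left_coset (N s)"
        by (metis n_def N_def translate_left_coset)
      then show "(n s ** E11, n s ** P2 ** conj_transpose (n s)) = \<phi> s"
        using left_coset_eqD[OF nS NS[OF sI]] by (simp add: \<phi>_def)
    qed
  qed
  have \<phi>: "\<phi> t = \<phi> 0" if "t \<in> I" for t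
    by (rule vector_derivative_zero_imp_eq_on[OF I I0 that \<phi>D])
  show "\<exists>X\<in>su5. \<forall>t\<in>I. c t = translate (mexp (t *\<^sub>R X)) (c 0)"
  proof (rule bexI[OF _ X], rule ballI)
    fix t
    assume t: "t \<in> I"
    have "left_coset (N t) = left_coset (N 0)"
      using \<phi>[OF t] by (intro left_coset_eqI NS t I0) (simp_all add: \<phi>_def)
    also have "N 0 = G 0"
      by (simp add: N_def)
    finally have "translate (mexp (t *\<^sub>R X)) (left_coset (N t)) = translate (mexp (t *\<^sub>R X)) (c 0)"
      using c[OF I0] by simp
    moreover have "mexp (t *\<^sub>R X) ** N t = G t"
      using mat5.ex_minus(2)[of "t *\<^sub>R X"] by (simp add: N_def mexp_eq_ex matrix_mul_assoc)
    ultimately show "c t = translate (mexp (t *\<^sub>R X)) (c 0)"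
      using c[OF t] by (simp add: translate_left_coset)
  qed
qed

end

subsection \<open>Invariant metrics\<close>

text \<open>A complex coordinate \<open>z\<close> on the real plane spanned by
  \<open>e_mat a b\<close> and \<open>f_mat a b\<close>: in it, diagonal elements of
  \<open>\<hh>\<close> act as multiplication by imaginary numbers.\<close>

definition root_vec :: "5 \<Rightarrow> 5 \<Rightarrow> complex \<Rightarrow> cmat5" where
  "root_vec a b z = (\<chi> i j. of_bool (i = a \<and> j = b) * z - of_bool (i = b \<and> j = a) * cnj z)"

lemma root_vec_entry:
  "root_vec a b z $ i $ j = of_bool (i = a \<and> j = b) * z - of_bool (i = b \<and> j = a) * cnj z"
  by (simp add: root_vec_def)

lemma cmat5_eqI: "(\<And>i j. A $ i $ j = B $ i $ j) \<Longrightarrow> A = (B :: cmat5)"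
  by (simp add: vec_eq_iff)

lemma root_vec_scaleR: "root_vec a b (c *\<^sub>R z) = c *\<^sub>R root_vec a b z"
  by (rule cmat5_eqI)
    (simp only: root_vec_entry vector_scaleR_component complex_cnj_scaleR scaleR_diff_right mult_scaleR_right)

lemma root_vec_add: "root_vec a b (y + z) = root_vec a b y + root_vec a b z"
  by (rule cmat5_eqI)
    (simp only: root_vec_entry vector_add_component complex_cnj_add distrib_left add_diff_add)

lemma cnj_root_vec_entry: "cnj (root_vec a b z $ j $ i) = - root_vec a b z $ i $ j"
proof -
  have c: "(j = a \<and> i = b) = (i = b \<and> j = a)" "(j = b \<and> i = a) = (i = a \<and> j = b)"
    by auto
  have "cnj (of_bool P * z - of_bool Q * cnj z) = - (of_bool Q * z - of_bool P * cnj z)" for P Q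
    by (cases P; cases Q) simp_all
  then show ?thesis
    unfolding root_vec_entry c by simp
qed

lemma root_vec_span:
  assumes "(of_nat a :: 5) \<noteq> of_nat b"
  shows "root_vec (of_nat a) (of_nat b) z = Re z *\<^sub>R e_mat a b + Im z *\<^sub>R f_mat a b"
proof -
  have "a \<noteq> b"
    using assms by auto
  then show ?thesis
    using assms by (auto simp: vec_eq_iff root_vec_entry e_mat_entry f_mat_entry complex_eq_iff)
qed

lemma w_vec_entry: "w_vec $ i $ j = (if i = j then (if i = 1 then 4 * \<i> else - \<i>) else 0)"
  using exhaust_5[of i] exhaust_5[of j] by (auto simp: w_vec_def f_mat_entry scaleR_conv_of_real)

lemma w_vec_mm: "w_vec \<in> \<mm>"
  by (simp add: mm_iff vec_eq_iff forall_5 m_proj_entry w_vec_entry block_def complex_eq_iff)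

definition root_planes :: "(5 \<times> 5) set" where
  "root_planes = {(1, 2), (1, 3), (1, 4), (1, 5), (2, 4), (2, 5), (3, 4), (3, 5)}"

lemma root_vec_mm:
  assumes "(a, b) \<in> root_planes"
  shows "root_vec a b z \<in> \<mm>"
proof -
  have ab: "block a \<noteq> block b"
    using assms by (auto simp: root_planes_def block_def)
  have "m_proj (root_vec a b z) $ i $ j = root_vec a b z $ i $ j" for i j
  proof (cases "block i = block j")
    case True
    then have "\<not> (i = a \<and> j = b)" "\<not> (i = b \<and> j = a)" "\<not> (1 = a \<and> 1 = b)" "\<not> (1 = b \<and> 1 = a)"
      using ab by auto
    then show ?thesis
      using True by (simp only: m_proj_entry root_vec_entry of_bool_eq) simp
  next
    case False
    then show ?thesis
      by (simp add: m_proj_entry cnj_root_vec_entry)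
  qed
  then show ?thesis
    by (simp add: mm_iff vec_eq_iff)
qed

lemma mm_entry:
  assumes "X \<in> \<mm>"
  shows "cnj (X $ j $ i) = - X $ i $ j" "block i = block j \<Longrightarrow> i \<noteq> j \<Longrightarrow> X $ i $ j = 0"
    "i \<noteq> 1 \<Longrightarrow> X $ i $ i = - \<i> * of_real (Im (X$1$1) / 4)" "X $ 1 $ 1 = \<i> * of_real (Im (X$1$1))"
proof -
  have m: "X $ i $ j = m_proj X $ i $ j" for i j
    using assms by (simp add: mm_iff)
  show "cnj (X $ j $ i) = - X $ i $ j"
    using mm_su5[OF assms] skew_entry by (auto simp: su5_iff)
  show "block i = block j \<Longrightarrow> i \<noteq> j \<Longrightarrow> X $ i $ j = 0"
    using m[of i j] by (simp add: m_proj_entry)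
  show "i \<noteq> 1 \<Longrightarrow> X $ i $ i = - \<i> * of_real (Im (X$1$1) / 4)"
    using m[of i i] by (simp add: m_proj_entry)
  show "X $ 1 $ 1 = \<i> * of_real (Im (X$1$1))"
    using m[of 1 1] by (simp add: m_proj_entry)
qed

lemma sum_root_planes:
  "(\<Sum>(a, b)\<in>root_planes. f a b) = f 1 2 + f 1 3 + f 1 4 + f 1 5 + f 2 4 + f 2 5 + f 3 4 + f 3 5"
  by (simp add: root_planes_def add.assoc)

lemma mm_decomp:
  assumes X: "X \<in> \<mm>"
  shows "X = (Im (X$1$1) / 4) *\<^sub>R w_vec + (\<Sum>(a, b)\<in>root_planes. root_vec a b (X $ a $ b))"
proof -
  note e = mm_entry[OF X]
  have d: "X$2$2 = - \<i> * of_real (Im (X$1$1) / 4)" "X$3$3 = - \<i> * of_real (Im (X$1$1) / 4)"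
    "X$4$4 = - \<i> * of_real (Im (X$1$1) / 4)" "X$5$5 = - \<i> * of_real (Im (X$1$1) / 4)"
    "X$2$3 = 0" "X$3$2 = 0" "X$4$5 = 0" "X$5$4 = 0"
    using e(3)[of 2] e(3)[of 3] e(3)[of 4] e(3)[of 5] e(2)[of 2 3] e(2)[of 3 2] e(2)[of 4 5] e(2)[of 5 4]
    by (simp_all add: block_def)
  have r: "Re (X$1$1) = 0"
    using arg_cong[OF e(4), of Re] by simp
  show ?thesis
    unfolding sum_root_planes vec_eq_iff forall_5
    by (simp add: root_vec_entry w_vec_entry d e(1)) (simp add: complex_eq_iff r)
qed

lemma Q_form_w_vec:
  assumes "X \<in> \<mm>"
  shows "Q_form w_vec X = 5 * Im (X$1$1)"
proof -
  note e = mm_entry[OF assms]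
  have d: "X$2$2 = - \<i> * of_real (Im (X$1$1) / 4)" "X$3$3 = - \<i> * of_real (Im (X$1$1) / 4)"
    "X$4$4 = - \<i> * of_real (Im (X$1$1) / 4)" "X$5$5 = - \<i> * of_real (Im (X$1$1) / 4)"
    using e(3)[of 2] e(3)[of 3] e(3)[of 4] e(3)[of 5] by simp_all
  show ?thesis
    by (simp add: Q_form_def trace_def sum_5 matrix_mult_entry_5 w_vec_entry d)
qed

lemma Q_form_root_vec:
  assumes "a \<noteq> b" "X \<in> \<mm>"
  shows "Q_form (root_vec a b z) X = 2 * Re (z * cnj (X $ a $ b))"
proof -
  have r: "root_vec a b z $ i $ j \<bullet> Y = (if j = b then (if i = a then z \<bullet> Y else 0) else 0)
      - (if j = a then (if i = b then cnj z \<bullet> Y else 0) else 0)" for i j Y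
    using assms(1) by (simp add: root_vec_entry of_bool_def)
  have "Q_form (root_vec a b z) X = root_vec a b z \<bullet> X"
    using assms mm_su5 by (intro Q_form_inner) (auto simp: su5_iff)
  also have "\<dots> = z \<bullet> X $ a $ b - cnj z \<bullet> X $ b $ a"
    unfolding inner_vec_def r by (simp add: sum_subtractf sum.delta)
  also have "X $ b $ a = - cnj (X $ a $ b)"
    using mm_entry(1)[OF assms(2), of a b] by simp
  finally show ?thesis
    by (simp add: inner_complex_def)
qed

section \<open>Action of diagonal elements and rotations of \<open>\<hh>\<close> on the root
  planes\<close>

definition diag_mat :: "(5 \<Rightarrow> real) \<Rightarrow> cmat5" where
  "diag_mat \<theta> = (\<chi> i j. if i = j then \<i> * of_real (\<theta> i) else 0)"

lemma diag_mat_bracket_entry: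
  "lie_bracket (diag_mat \<theta>) X $ i $ j = \<i> * of_real (\<theta> i - \<theta> j) * X $ i $ j"
proof -
  have "(diag_mat \<theta> ** X) $ i $ j = \<i> * of_real (\<theta> i) * X $ i $ j"
    by (simp add: matrix_matrix_mult_def diag_mat_def if_distrib[of "\<lambda>x. x * _"] cong: if_cong)
  moreover have "(X ** diag_mat \<theta>) $ i $ j = X $ i $ j * (\<i> * of_real (\<theta> j))"
    by (simp add: matrix_matrix_mult_def diag_mat_def if_distrib[of "\<lambda>x. _ * x"] cong: if_cong)
  ultimately show ?thesis
    by (simp add: lie_bracket_def algebra_simps)
qed

lemma diag_mat_root_vec:
  "lie_bracket (diag_mat \<theta>) (root_vec a b z) = root_vec a b (\<i> * of_real (\<theta> a - \<theta> b) * z)"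
proof -
  have *: "x * (of_bool P * z - of_bool Q * cnj z) = of_bool P * (c * z) - of_bool Q * cnj (c * z)"
    if "P \<Longrightarrow> x = c" "Q \<Longrightarrow> x = cnj c" for P Q x c
    using that by (cases P; cases Q) (auto simp: right_diff_distrib)
  show ?thesis
    by (rule cmat5_eqI, unfold diag_mat_bracket_entry root_vec_entry, rule *) (auto simp: complex_eq_iff)
qed

lemma diag_mat_hh:
  assumes "\<theta> 1 = 0" "\<theta> 2 + \<theta> 3 + \<theta> 4 + \<theta> 5 = 0"
  shows "diag_mat \<theta> \<in> \<hh>"
proof -
  have "complex_of_real (\<theta> 2) + of_real (\<theta> 3) + of_real (\<theta> 4) + of_real (\<theta> 5) = 0"
    using assms(2) by (metis of_real_add of_real_0)
  then have "trace (diag_mat \<theta>) = 0"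
    using assms(1) by (simp add: trace_def sum_5 diag_mat_def flip: distrib_left)
  moreover have "conj_transpose (diag_mat \<theta>) = - diag_mat \<theta>"
    by (simp add: vec_eq_iff diag_mat_def)
  ultimately show ?thesis
    using assms(1) by (simp add: hh_iff su5_iff mult_E11_eq_0_iff commute_P2_iff diag_mat_def)
qed

lemma e_mat_hh: "e_mat 2 3 \<in> \<hh>" "e_mat 4 5 \<in> \<hh>"
  unfolding \<hh>_def by (auto intro: span_base)

lemma e_mat_bracket_entry:
  "lie_bracket (e_mat 2 3) X $ i $ j = (if i = 2 then X$3$j else if i = 3 then - X$2$j else 0)
     - (if j = 3 then X$i$2 else if j = 2 then - X$i$3 else 0)"
  "lie_bracket (e_mat 4 5) X $ i $ j = (if i = 4 then X$5$j else if i = 5 then - X$4$j else 0)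
     - (if j = 5 then X$i$4 else if j = 4 then - X$i$5 else 0)"
  by (simp_all add: lie_bracket_def matrix_mult_entry_5 e_mat_entry)

lemma e_mat_root_vec:
  "lie_bracket (e_mat 2 3) (root_vec 1 2 z) = - root_vec 1 3 z"
  "lie_bracket (e_mat 2 3) (root_vec 1 3 z) = root_vec 1 2 z"
  "lie_bracket (e_mat 4 5) (root_vec 1 4 z) = - root_vec 1 5 z"
  "lie_bracket (e_mat 4 5) (root_vec 1 5 z) = root_vec 1 4 z"
  "lie_bracket (e_mat 2 3) (root_vec 2 4 z) = - root_vec 3 4 z"
  "lie_bracket (e_mat 2 3) (root_vec 3 4 z) = root_vec 2 4 z"
  "lie_bracket (e_mat 4 5) (root_vec 2 4 z) = - root_vec 2 5 z"
  "lie_bracket (e_mat 4 5) (root_vec 2 5 z) = root_vec 2 4 z"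
  "lie_bracket (e_mat 4 5) (root_vec 3 4 z) = - root_vec 3 5 z"
  "lie_bracket (e_mat 4 5) (root_vec 3 5 z) = root_vec 3 4 z"
  unfolding vec_eq_iff forall_5
  by (simp_all only: e_mat_bracket_entry vector_uminus_component) (simp_all add: root_vec_entry)

text \<open>An inner product at the base point, with invariance under the isotropy group in
  infinitesimal form; this much determines it up to four scalars.\<close>

locale invariant_inner_product =
  fixes \<beta> :: "cmat5 \<Rightarrow> cmat5 \<Rightarrow> real"
  assumes \<beta>: "bounded_bilinear \<beta>"
    and \<beta>_sym: "X \<in> \<mm> \<Longrightarrow> Y \<in> \<mm> \<Longrightarrow> \<beta> X Y = \<beta> Y X"
    and \<beta>_pos: "X \<in> \<mm> \<Longrightarrow> X \<noteq> 0 \<Longrightarrow> \<beta> X X > 0"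
    and \<beta>_bracket: "a \<in> \<hh> \<Longrightarrow> X \<in> \<mm> \<Longrightarrow> Y \<in> \<mm> \<Longrightarrow> \<beta> (lie_bracket a X) Y + \<beta> X (lie_bracket a Y) = 0"
begin

sublocale \<beta>: bounded_bilinear \<beta>
  by (rule \<beta>)

text \<open>An element of the Cartan subalgebra of \<open>\<hh>\<close> whose squared eigenvalues separate the root planes.\<close>

definition \<theta> :: "5 \<Rightarrow> real" where
  "\<theta> i = (if i = 1 then 0 else if i = 2 then 1 else if i = 3 then 10 else if i = 4 then - 4 else - 7)"

text \<open>Over the planes in their listed order the absolute differences are 1, 10, 4, 7, 5, 8,
  14, 17. The values of \<open>\<theta>\<close> add up to 0, as membership in \<open>\<hh>\<close>
  demands.\<close>

lemma \<theta>_separates: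
  assumes "(a, b) \<in> root_planes"
  shows "\<theta> a \<noteq> \<theta> b"
    "(c, d) \<in> root_planes \<Longrightarrow> (a, b) \<noteq> (c, d) \<Longrightarrow> (\<theta> a - \<theta> b)\<^sup>2 \<noteq> (\<theta> c - \<theta> d)\<^sup>2"
proof -
  have t: "\<theta> 1 = 0" "\<theta> 2 = 1" "\<theta> 3 = 10" "\<theta> 4 = - 4" "\<theta> 5 = - 7"
    by (simp_all add: \<theta>_def)
  have A: "\<forall>(a, b)\<in>root_planes. \<theta> a \<noteq> \<theta> b"
    unfolding root_planes_def by (simp only: ball_simps prod.case t) simp
  have B: "\<forall>(a, b)\<in>root_planes. \<forall>(c, d)\<in>root_planes. (a, b) \<noteq> (c, d) \<longrightarrow> (\<theta> a - \<theta> b)\<^sup>2 \<noteq> (\<theta> c - \<theta> d)\<^sup>2"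
    unfolding root_planes_def by (simp only: ball_simps prod.case t) simp
  show "\<theta> a \<noteq> \<theta> b"
    using bspec[OF A assms] by simp
  show "(\<theta> a - \<theta> b)\<^sup>2 \<noteq> (\<theta> c - \<theta> d)\<^sup>2" if "(c, d) \<in> root_planes" "(a, b) \<noteq> (c, d)"
    using bspec[OF bspec[OF B assms, unfolded prod.case] that(1)] that(2) by simp
qed

lemma diag_\<theta>_hh: "diag_mat \<theta> \<in> \<hh>"
  by (rule diag_mat_hh) (simp_all add: \<theta>_def)

text \<open>The bracket with the diagonal element is skew for \<open>\<beta>\<close>, so its square
  is symmetric, and eigenvectors of a symmetric map for different eigenvalues are
  orthogonal.\<close>

lemma \<beta>_orthogonal:
  assumes "X \<in> \<mm>" "Y \<in> \<mm>" and X: "lie_bracket (diag_mat \<theta>) (lie_bracket (diag_mat \<theta>) X) = - x *\<^sub>R X"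
    and Y: "lie_bracket (diag_mat \<theta>) (lie_bracket (diag_mat \<theta>) Y) = - y *\<^sub>R Y" and "x \<noteq> y"
  shows "\<beta> X Y = 0"
proof -
  let ?D = "lie_bracket (diag_mat \<theta>)"
  have "\<beta> (?D (?D X)) Y = - \<beta> (?D X) (?D Y)" "\<beta> (?D X) (?D Y) = - \<beta> X (?D (?D Y))"
    using assms(1,2) \<beta>_bracket[OF diag_\<theta>_hh] bracket_hh_mm[OF diag_\<theta>_hh]
    by (simp_all add: eq_neg_iff_add_eq_0)
  then have "x * \<beta> X Y = y * \<beta> X Y"
    by (simp add: X Y \<beta>.scaleR_left \<beta>.scaleR_right \<beta>.minus_left \<beta>.minus_right)
  then show ?thesis
    using \<open>x \<noteq> y\<close> by simp
qed

lemma diag_\<theta>_twice_root_vec: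
  "lie_bracket (diag_mat \<theta>) (lie_bracket (diag_mat \<theta>) (root_vec a b z)) = - ((\<theta> a - \<theta> b)\<^sup>2) *\<^sub>R root_vec a b z"
proof -
  have "\<i> * of_real (\<theta> a - \<theta> b) * (\<i> * of_real (\<theta> a - \<theta> b) * z) = (- ((\<theta> a - \<theta> b)\<^sup>2)) *\<^sub>R z"
    by (simp add: scaleR_conv_of_real power2_eq_square algebra_simps)
  then show ?thesis
    by (simp add: diag_mat_root_vec root_vec_scaleR[symmetric] del: scaleR_minus_left)
qed

lemma diag_\<theta>_twice_w_vec:
  "lie_bracket (diag_mat \<theta>) (lie_bracket (diag_mat \<theta>) w_vec) = - 0 *\<^sub>R w_vec"
  by (simp add: vec_eq_iff diag_mat_bracket_entry w_vec_entry)

text \<open>On one plane the diagonal element acts as a nonzero multiple of multiplication by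
  \<open>\<i>\<close>. Skewness then makes the vectors of 1 and \<open>\<i>\<close> orthogonal and
  of equal length, so \<open>\<beta>\<close> is a multiple of the Euclidean product.\<close>

lemma \<beta>_same_plane:
  assumes p: "(a, b) \<in> root_planes"
  shows "\<beta> (root_vec a b y) (root_vec a b z) = \<beta> (root_vec a b 1) (root_vec a b 1) * Re (y * cnj z)"
proof -
  let ?r = "root_vec a b"
  have "\<beta> (?r (\<i> * of_real (\<theta> a - \<theta> b) * y)) (?r z) + \<beta> (?r y) (?r (\<i> * of_real (\<theta> a - \<theta> b) * z)) = 0" for y z
    using \<beta>_bracket[OF diag_\<theta>_hh root_vec_mm[OF p] root_vec_mm[OF p], of y z] by (simp add: diag_mat_root_vec)
  moreover have "?r (\<i> * of_real (\<theta> a - \<theta> b) * y) = (\<theta> a - \<theta> b) *\<^sub>R ?r (\<i> * y)" for y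
    by (subst root_vec_scaleR[symmetric]) (simp add: scaleR_conv_of_real mult_ac)
  ultimately have "(\<theta> a - \<theta> b) * (\<beta> (?r (\<i> * y)) (?r z) + \<beta> (?r y) (?r (\<i> * z))) = 0" for y z
    by (simp add: \<beta>.scaleR_left \<beta>.scaleR_right distrib_left)
  then have J: "\<beta> (?r (\<i> * y)) (?r z) + \<beta> (?r y) (?r (\<i> * z)) = 0" for y z
    using \<theta>_separates(1)[OF p] by simp
  have s: "\<beta> (?r \<i>) (?r 1) = \<beta> (?r 1) (?r \<i>)"
    by (intro \<beta>_sym root_vec_mm p)
  have m: "?r (-1) = - ?r 1"
    using root_vec_scaleR[of a b "-1" 1] by simp
  have 1: "\<beta> (?r \<i>) (?r 1) = 0" "\<beta> (?r 1) (?r \<i>) = 0" "\<beta> (?r \<i>) (?r \<i>) = \<beta> (?r 1) (?r 1)"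
    using J[of 1 1] J[of 1 \<i>] s by (simp_all add: m \<beta>.minus_right)
  have r: "?r z = Re z *\<^sub>R ?r 1 + Im z *\<^sub>R ?r \<i>" for z
  proof -
    have "z = Re z *\<^sub>R 1 + Im z *\<^sub>R \<i>"
      by (simp add: complex_eq_iff)
    then show ?thesis
      by (metis root_vec_add root_vec_scaleR)
  qed
  have "\<beta> (?r y) (?r z) = \<beta> (Re y *\<^sub>R ?r 1 + Im y *\<^sub>R ?r \<i>) (Re z *\<^sub>R ?r 1 + Im z *\<^sub>R ?r \<i>)"
    by (rule arg_cong2[OF r r])
  also have "\<dots> = \<beta> (?r 1) (?r 1) * (Re y * Re z + Im y * Im z)"
    by (simp add: \<beta>.add_left \<beta>.add_right \<beta>.scaleR_left \<beta>.scaleR_right 1 algebra_simps)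
  finally show ?thesis
    by simp
qed

text \<open>Only the component of \<open>Y\<close> in the same plane is seen. The divisor 2 is
  \<open>Q_form\<close> of \<open>root_vec a b 1\<close> with itself.\<close>

lemma \<beta>_root_vec:
  assumes p: "(a, b) \<in> root_planes" and Y: "Y \<in> \<mm>"
  shows "\<beta> (root_vec a b z) Y = \<beta> (root_vec a b 1) (root_vec a b 1) / 2 * Q_form (root_vec a b z) Y"
proof -
  have ab: "a \<noteq> b"
    using p by (auto simp: root_planes_def)
  have w: "\<beta> (root_vec a b z) w_vec = 0"
    by (rule \<beta>_orthogonal[OF root_vec_mm[OF p] w_vec_mm diag_\<theta>_twice_root_vec diag_\<theta>_twice_w_vec])
      (use \<theta>_separates(1)[OF p] in simp)
  have o: "\<beta> (root_vec a b z) (root_vec c d y) = 0" if q: "(c, d) \<in> root_planes" "(c, d) \<noteq> (a, b)" for c d y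
    by (rule \<beta>_orthogonal[OF root_vec_mm[OF p] root_vec_mm[OF q(1)] diag_\<theta>_twice_root_vec diag_\<theta>_twice_root_vec])
      (use \<theta>_separates(2)[OF p q(1)] q(2) in auto)
  have f: "finite root_planes"
    by (simp add: root_planes_def)
  have "\<beta> (root_vec a b z) Y = (\<Sum>(c, d)\<in>root_planes. \<beta> (root_vec a b z) (root_vec c d (Y $ c $ d)))"
    by (subst mm_decomp[OF Y])
      (simp add: \<beta>.add_right \<beta>.scaleR_right w \<beta>.sum_right case_prod_beta)
  also have "\<dots> = \<beta> (root_vec a b z) (root_vec a b (Y $ a $ b))"
    using o by (subst sum.remove[OF f p]) (auto intro!: sum.neutral)
  also have "\<dots> = \<beta> (root_vec a b 1) (root_vec a b 1) / 2 * Q_form (root_vec a b z) Y"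
    by (simp add: \<beta>_same_plane[OF p, of z "Y $ a $ b"] Q_form_root_vec[OF ab Y])
  finally show ?thesis .
qed

text \<open>The divisor 20 is \<open>Q_form w_vec w_vec = 16 + 4\<close>.\<close>

lemma \<beta>_w_vec:
  assumes Y: "Y \<in> \<mm>"
  shows "\<beta> w_vec Y = \<beta> w_vec w_vec / 20 * Q_form w_vec Y"
proof -
  have o: "\<beta> w_vec (root_vec c d y) = 0" if q: "(c, d) \<in> root_planes" for c d y
    by (rule \<beta>_orthogonal[OF w_vec_mm root_vec_mm[OF q] diag_\<theta>_twice_w_vec diag_\<theta>_twice_root_vec])
      (use \<theta>_separates(1)[OF q] in simp)
  have "(\<Sum>(c, d)\<in>root_planes. \<beta> w_vec (root_vec c d (Y $ c $ d))) = 0"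
    using o by (intro sum.neutral) auto
  then have "\<beta> w_vec Y = (Im (Y$1$1) / 4) * \<beta> w_vec w_vec"
    by (subst mm_decomp[OF Y])
      (simp add: \<beta>.add_right \<beta>.scaleR_right \<beta>.sum_right case_prod_beta)
  then show ?thesis
    by (simp add: Q_form_w_vec[OF Y])
qed

lemma \<beta>_rotate:
  assumes "a \<in> \<hh>" "X \<in> \<mm>" "Y \<in> \<mm>" "lie_bracket a X = - Y" "lie_bracket a Y = X"
  shows "\<beta> Y Y = \<beta> X X"
  using \<beta>_bracket[OF assms(1-3)] by (simp add: assms(4,5) \<beta>.minus_left)

lemma block_scale_form:
  obtains d a b c where "d > 0" "a > 0" "b > 0" "c > 0"
    "\<And>X Y. X \<in> \<mm> \<Longrightarrow> Y \<in> \<mm> \<Longrightarrow> \<beta> X Y = Q_form (block_scale d a b c X) Y"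
proof -
  define l where "l i j = \<beta> (root_vec i j 1) (root_vec i j 1) / 2" for i j
  have p: "(1, 2) \<in> root_planes" "(1, 3) \<in> root_planes" "(1, 4) \<in> root_planes" "(1, 5) \<in> root_planes"
    "(2, 4) \<in> root_planes" "(2, 5) \<in> root_planes" "(3, 4) \<in> root_planes" "(3, 5) \<in> root_planes"
    by (auto simp: root_planes_def)
  \<comment> \<open>\<open>e_mat 2 3\<close> and \<open>e_mat 4 5\<close> rotate planes of one
    \<open>\<mm>ij\<close> into each other, which joins the two planes of \<open>\<mm>01\<close>,
    the two of \<open>\<mm>02\<close> and the four of \<open>\<mm>12\<close>.\<close>
  have eq: "l 1 3 = l 1 2" "l 1 5 = l 1 4" "l 3 4 = l 2 4" "l 2 5 = l 2 4" "l 3 5 = l 3 4"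
    unfolding l_def
    using \<beta>_rotate[OF e_mat_hh(1) p(1,2)[THEN root_vec_mm] e_mat_root_vec(1,2)]
      \<beta>_rotate[OF e_mat_hh(2) p(3,4)[THEN root_vec_mm] e_mat_root_vec(3,4)]
      \<beta>_rotate[OF e_mat_hh(1) p(5,7)[THEN root_vec_mm] e_mat_root_vec(5,6)]
      \<beta>_rotate[OF e_mat_hh(2) p(5,6)[THEN root_vec_mm] e_mat_root_vec(7,8)]
      \<beta>_rotate[OF e_mat_hh(2) p(7,8)[THEN root_vec_mm] e_mat_root_vec(9,10)]
    by simp_all
  let ?L = "block_scale (\<beta> w_vec w_vec / 20) (l 1 2) (l 1 4) (l 2 4)"
  have Lr: "?L (root_vec i j z) = l i j *\<^sub>R root_vec i j z" if "(i, j) \<in> root_planes" for i j z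
  proof -
    have "coef (\<beta> w_vec w_vec / 20) (l 1 2) (l 1 4) (l 2 4) i j = l i j"
      using that eq by (auto simp: root_planes_def coef_def block_def)
    then show ?thesis
      using coef_sym[of _ _ _ _ i j] by (auto simp: vec_eq_iff block_scale_entry root_vec_entry scaleR_diff_right)
  qed
  have Lw: "?L w_vec = (\<beta> w_vec w_vec / 20) *\<^sub>R w_vec"
    by (simp add: vec_eq_iff block_scale_entry w_vec_entry coef_def)
  have form: "\<beta> X Y = Q_form (?L X) Y" if X: "X \<in> \<mm>" and Y: "Y \<in> \<mm>" for X Y
  proof -
    let ?t = "Im (X$1$1) / 4"
    have \<beta>l: "\<beta> (root_vec i j z) Y = l i j * Q_form (root_vec i j z) Y" if "(i, j) \<in> root_planes" for i j z
      unfolding l_def by (rule \<beta>_root_vec[OF that Y])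
    have "\<beta> X Y = ?t * \<beta> w_vec Y + (\<Sum>(i, j)\<in>root_planes. \<beta> (root_vec i j (X $ i $ j)) Y)"
      by (subst mm_decomp[OF X]) (simp add: \<beta>.add_left \<beta>.scaleR_left \<beta>.sum_left case_prod_beta)
    also have "\<dots> = ?t * Q_form (?L w_vec) Y + (\<Sum>(i, j)\<in>root_planes. Q_form (?L (root_vec i j (X $ i $ j))) Y)"
      by (intro arg_cong2[where f = "(+)"] sum.cong)
        (auto simp: \<beta>_w_vec[OF Y] \<beta>l Lw Lr Q_form_scaleR_left)
    also have "\<dots> = Q_form (?L (?t *\<^sub>R w_vec + (\<Sum>(i, j)\<in>root_planes. root_vec i j (X $ i $ j)))) Y"
      by (simp add: block_scale_add block_scale_scaleR linear_sum[OF linear_block_scale] Q_form_add_left Q_form_scaleR_left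
          bounded_bilinear.sum_left[OF bounded_bilinear_Q_form] case_prod_beta)
    finally show ?thesis
      using mm_decomp[OF X] by simp
  qed
  have lpos: "l i j > 0" if "(i, j) \<in> root_planes" for i j
  proof -
    have "root_vec i j 1 $ i $ j = 1"
      using that by (auto simp: root_planes_def root_vec_entry)
    then have "root_vec i j 1 \<noteq> 0"
      by force
    then show ?thesis
      using \<beta>_pos[OF root_vec_mm[OF that]] by (simp add: l_def)
  qed
  have wpos: "\<beta> w_vec w_vec / 20 > 0"
  proof -
    have "w_vec $ 1 $ 1 \<noteq> 0"
      by (simp add: w_vec_entry)
    then have "w_vec \<noteq> 0"
      by force
    then show ?thesis
      using \<beta>_pos[OF w_vec_mm] by simp
  qed
  show ?thesis
    by (rule that[OF wpos lpos[OF p(1)] lpos[OF p(3)] lpos[OF p(5)] form])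
qed

end

subsection \<open>Geodesic orbit metrics\<close>

text \<open>Translations reduce the metric to the base point, and well-definedness there is
  invariance under conjugation by the isotropy group; differentiating along
  \<open>mexp (t a)\<close> gives the infinitesimal form. Composing with \<open>m_proj\<close> makes
  the form bilinear on all matrices.\<close>

lemma invariant_metric_block_scale:
  assumes B: "invariant_metric B"
  obtains d a b c where "d > 0" "a > 0" "b > 0" "c > 0"
    "\<And>g X Y. g \<in> SU5 \<Longrightarrow> X \<in> \<mm> \<Longrightarrow> Y \<in> \<mm> \<Longrightarrow> B g X Y = Q_form (block_scale d a b c X) Y"
proof -
  define \<beta> where "\<beta> X Y = B (mat 1) (m_proj X) (m_proj Y)" for X Y
  have ip: "inner_product_on \<mm> (B (mat 1))"
    using B SU5_one unfolding invariant_metric_def by blast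
  have B_add: "B (mat 1) (X + Y) Z = B (mat 1) X Z + B (mat 1) Y Z"
    if "X \<in> \<mm>" "Y \<in> \<mm>" "Z \<in> \<mm>" for X Y Z
    using ip that unfolding inner_product_on_def by blast
  have B_scale: "B (mat 1) (r *\<^sub>R X) Y = r * B (mat 1) X Y"
    and B_sym: "B (mat 1) X Y = B (mat 1) Y X" if "X \<in> \<mm>" "Y \<in> \<mm>" for X Y r
    using ip that unfolding inner_product_on_def by blast+
  have B_pos: "B (mat 1) X X > 0" if "X \<in> \<mm>" "X \<noteq> 0" for X
    using ip that unfolding inner_product_on_def by blast
  have \<beta>_mm: "\<beta> X Y = B (mat 1) X Y" if "X \<in> \<mm>" "Y \<in> \<mm>" for X Y
    using that by (simp add: \<beta>_def mm_iff)
  have \<beta>_sym: "\<beta> X Y = \<beta> Y X" for X Y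
    unfolding \<beta>_def by (intro B_sym m_proj_mm)
  have "linear (\<beta> X)" for X
  proof (rule linearI)
    fix Y Z r
    have "\<beta> (Y + Z) X = \<beta> Y X + \<beta> Z X" "\<beta> (r *\<^sub>R Y) X = r * \<beta> Y X"
      by (simp_all add: \<beta>_def m_proj_add m_proj_scaleR B_add B_scale m_proj_mm)
    then show "\<beta> X (Y + Z) = \<beta> X Y + \<beta> X Z" "\<beta> X (r *\<^sub>R Y) = r *\<^sub>R \<beta> X Y"
      by (simp_all add: \<beta>_sym[of X])
  qed
  moreover from this have "linear (\<lambda>X. \<beta> X Y)" for Y
    using \<beta>_sym[of _ Y] by simp
  ultimately have bil: "bounded_bilinear \<beta>"
    using bilinear_conv_bounded_bilinear[of \<beta>] by (simp add: bilinear_def)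
  have B_SU: "B g X Y = B (mat 1) X Y" if "g \<in> SU5" "X \<in> \<mm>" "Y \<in> \<mm>" for g X Y
  proof -
    have "B (g ** mat 1) X Y = B (mat 1) X Y"
      using B SU5_one that unfolding invariant_metric_def by blast
    then show ?thesis
      by simp
  qed
  have Ad: "\<beta> (conj_transpose h ** X ** h) (conj_transpose h ** Y ** h) = \<beta> X Y"
    if h: "h \<in> SU2U2" and XY: "X \<in> \<mm>" "Y \<in> \<mm>" for h X Y
  proof -
    have hS: "h \<in> SU5"
      by (rule SU2U2_SU5[OF h])
    have m: "conj_transpose h ** Z ** h \<in> \<mm>" if "Z \<in> \<mm>" for Z
      using mm_Ad[OF SU2U2_conj_transpose[OF h] that] by simp
    have c: "conjugate_by (matrix_inv h) Z = conj_transpose h ** Z ** h" for Z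
      using hS by (simp add: conjugate_by_def matrix_inv_SU5)
    have "B (mat 1 ** h) (conjugate_by (matrix_inv h) X) (conjugate_by (matrix_inv h) Y) = B (mat 1) X Y"
      using B SU5_one h XY unfolding invariant_metric_def by blast
    then show ?thesis
      using m XY by (simp add: c \<beta>_mm B_SU[OF hS])
  qed
  interpret \<beta>: invariant_inner_product \<beta>
  proof (rule invariant_inner_product.intro)
    show "bounded_bilinear \<beta>"
      by (rule bil)
    show "\<beta> X Y = \<beta> Y X" for X Y
      by (rule \<beta>_sym)
    show "\<beta> X X > 0" if "X \<in> \<mm>" "X \<noteq> 0" for X
      using B_pos[OF that] that by (simp add: \<beta>_mm)
    show "\<beta> (lie_bracket a X) Y + \<beta> X (lie_bracket a Y) = 0" if a: "a \<in> \<hh>" and XY: "X \<in> \<mm>" "Y \<in> \<mm>" for a X Y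
    proof -
      define h where "h t = mexp (t *\<^sub>R a)" for t
      have h: "h t \<in> SU2U2" for t
        unfolding h_def by (intro mexp_hh subspace_scale[OF subspace_hh] a)
      have hD: "(h has_vector_derivative a) (at 0)"
        using mat5.ex_scaleR_deriv[of a 0] by (simp add: h_def[abs_def] mexp_eq_ex)
      have "((\<lambda>t. conj_transpose (h t)) has_vector_derivative conj_transpose a) (at 0)"
        by (rule conj_transpose_deriv[OF hD])
      then have hcD: "((\<lambda>t. conj_transpose (h t)) has_vector_derivative - a) (at 0)"
        using hh_su5[OF a] by (simp add: su5_iff)
      have h0: "h 0 = mat 1"
        by (simp add: h_def)
      have D: "((\<lambda>t. conj_transpose (h t) ** Z ** h t) has_vector_derivative - lie_bracket a Z) (at 0)" for Z
        using mat5.mult.has_vector_derivative[OF mat5.mult.has_vector_derivative[OF hcD has_vector_derivative_const[of Z]] hD]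
        by (simp add: h0 lie_bracket_def mat5.mult.zero_right mat5.mult.minus_left)
      have "((\<lambda>t. \<beta> (conj_transpose (h t) ** X ** h t) (conj_transpose (h t) ** Y ** h t)) has_vector_derivative
          \<beta> (conj_transpose (h 0) ** X ** h 0) (- lie_bracket a Y) + \<beta> (- lie_bracket a X) (conj_transpose (h 0) ** Y ** h 0)) (at 0)"
        by (rule bounded_bilinear.has_vector_derivative[OF bil D D])
      moreover have "((\<lambda>t. \<beta> (conj_transpose (h t) ** X ** h t) (conj_transpose (h t) ** Y ** h t)) has_vector_derivative 0) (at 0)"
        by (simp add: Ad[OF h XY])
      ultimately have "\<beta> X (- lie_bracket a Y) + \<beta> (- lie_bracket a X) Y = 0"
        using vector_derivative_unique_at by (fastforce simp: h0)
      then show ?thesis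
        by (simp add: bounded_bilinear.minus_left[OF bil] bounded_bilinear.minus_right[OF bil])
    qed
  qed
  show ?thesis
  proof (rule \<beta>.block_scale_form, goal_cases)
    case (1 d a b c)
    show ?case
      by (rule that[OF 1(1-4)]) (metis B_SU \<beta>_mm 1(5))
  qed
qed

lemma metric_operator_block_scale:
  assumes "d \<noteq> 0" "a \<noteq> 0" "b \<noteq> 0" "c \<noteq> 0"
    and "\<And>g X Y. g \<in> SU5 \<Longrightarrow> X \<in> \<mm> \<Longrightarrow> Y \<in> \<mm> \<Longrightarrow> B g X Y = Q_form (block_scale d a b c X) Y"
  shows "metric_operator (block_scale d a b c) (block_scale (1/d) (1/a) (1/b) (1/c)) B"
  by unfold_locales (use assms in \<open>auto simp: block_scale_add block_scale_scaleR block_scale_mm block_scale_inverse Q_form_block_scale\<close>)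

section \<open>Identification of \<open>Lambda\<close> with a block scaling\<close>

lemma block_scale_nn: "U \<in> \<nn> \<Longrightarrow> block_scale d a b c U = d *\<^sub>R U"
proof -
  have "block_scale d a b c w_vec = d *\<^sub>R w_vec"
    by (rule cmat5_eqI) (simp add: block_scale_entry w_vec_entry coef_def)
  then show "U \<in> \<nn> \<Longrightarrow> block_scale d a b c U = d *\<^sub>R U"
    by (auto simp: \<nn>_def span_singleton block_scale_scaleR)
qed

lemma block_scale_pp:
  assumes "V \<in> \<pp>"
  shows "block_scale d 1 1 1 V = V"
proof -
  let ?S = "{X. block_scale d 1 1 1 X = X}"
  have S: "subspace ?S"
    by (auto simp: subspace_def block_scale_add block_scale_scaleR block_scale_zero)
  have c: "coef d 1 1 1 i j = 1" if "(i, j) \<in> root_planes" for i j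
    using that by (auto simp: root_planes_def coef_def block_def)
  have r: "block_scale d 1 1 1 (root_vec i j z) = root_vec i j z" if "(i, j) \<in> root_planes" for i j z
    using c[OF that] coef_sym[of d 1 1 1 i j]
    by (intro cmat5_eqI) (auto simp: block_scale_entry root_vec_entry)
  have g: "e_mat i j \<in> ?S \<and> f_mat i j \<in> ?S" if "(of_nat i, of_nat j) \<in> root_planes" for i j
  proof -
    have "(of_nat i :: 5) \<noteq> of_nat j"
      using that by (auto simp: root_planes_def)
    then have "e_mat i j = root_vec (of_nat i) (of_nat j) 1" "f_mat i j = root_vec (of_nat i) (of_nat j) \<i>"
      by (simp_all add: root_vec_span)
    then show ?thesis
      using r[OF that] by simp
  qed
  have m: "\<mm>01 \<subseteq> ?S" "\<mm>02 \<subseteq> ?S" "\<mm>12 \<subseteq> ?S"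
    unfolding \<mm>01_def \<mm>02_def \<mm>12_def
    using g[of 1 2] g[of 1 3] g[of 1 4] g[of 1 5] g[of 2 4] g[of 2 5] g[of 3 4] g[of 3 5]
    by (intro span_minimal S; simp add: root_planes_def)+
  obtain X Y Z where "V = X + Y + Z" "X \<in> \<mm>01" "Y \<in> \<mm>02" "Z \<in> \<mm>12"
    using assms by (auto simp: \<pp>_def)
  moreover from this have "block_scale d 1 1 1 X = X" "block_scale d 1 1 1 Y = Y" "block_scale d 1 1 1 Z = Z"
    using m by blast+
  ultimately show ?thesis
    by (simp add: block_scale_add)
qed

lemma root_vec_span_5:
  "root_vec 1 2 z = Re z *\<^sub>R e_mat 1 2 + Im z *\<^sub>R f_mat 1 2"
  "root_vec 1 3 z = Re z *\<^sub>R e_mat 1 3 + Im z *\<^sub>R f_mat 1 3"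
  "root_vec 1 4 z = Re z *\<^sub>R e_mat 1 4 + Im z *\<^sub>R f_mat 1 4"
  "root_vec 1 5 z = Re z *\<^sub>R e_mat 1 5 + Im z *\<^sub>R f_mat 1 5"
  "root_vec 2 4 z = Re z *\<^sub>R e_mat 2 4 + Im z *\<^sub>R f_mat 2 4"
  "root_vec 2 5 z = Re z *\<^sub>R e_mat 2 5 + Im z *\<^sub>R f_mat 2 5"
  "root_vec 3 4 z = Re z *\<^sub>R e_mat 3 4 + Im z *\<^sub>R f_mat 3 4"
  "root_vec 3 5 z = Re z *\<^sub>R e_mat 3 5 + Im z *\<^sub>R f_mat 3 5"
  using root_vec_span[of 1 2 z] root_vec_span[of 1 3 z] root_vec_span[of 1 4 z] root_vec_span[of 1 5 z]
    root_vec_span[of 2 4 z] root_vec_span[of 2 5 z] root_vec_span[of 3 4 z] root_vec_span[of 3 5 z]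
  by simp_all

lemma mm_nn_pp:
  assumes "X \<in> \<mm>"
  obtains U V where "U \<in> \<nn>" "V \<in> \<pp>" "X = U + V"
proof -
  let ?r = "\<lambda>i j. root_vec i j (X $ i $ j)"
  have "?r 1 2 + ?r 1 3 \<in> \<mm>01" "?r 1 4 + ?r 1 5 \<in> \<mm>02" "?r 2 4 + ?r 2 5 + (?r 3 4 + ?r 3 5) \<in> \<mm>12"
    unfolding \<mm>01_def \<mm>02_def \<mm>12_def root_vec_span_5
    by (intro span_add span_scale span_base; simp)+
  then have "(?r 1 2 + ?r 1 3) + (?r 1 4 + ?r 1 5) + (?r 2 4 + ?r 2 5 + (?r 3 4 + ?r 3 5)) \<in> \<pp>"
    unfolding \<pp>_def by blast
  moreover have "(Im (X$1$1) / 4) *\<^sub>R w_vec \<in> \<nn>"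
    unfolding \<nn>_def by (intro span_scale span_base) simp
  ultimately show ?thesis
    using that mm_decomp[OF assms] unfolding sum_root_planes by (simp add: add.assoc)
qed

text \<open>On each decomposition of \<open>X\<close> the map \<open>block_scale\<close> evaluates
  to \<open>\<mu> U + V\<close>, so all decompositions give the same value; this settles the
  definite description.\<close>

lemma Lambda_eq:
  assumes "X \<in> \<mm>"
  shows "Lambda \<mu> X = block_scale \<mu> 1 1 1 X"
  unfolding Lambda_def
proof (rule the_equality)
  have *: "block_scale \<mu> 1 1 1 (U + V) = \<mu> *\<^sub>R U + V" if "U \<in> \<nn>" "V \<in> \<pp>" for U V
    using that by (simp add: block_scale_add block_scale_nn block_scale_pp)
  obtain U V where "U \<in> \<nn>" "V \<in> \<pp>" "X = U + V"
    using mm_nn_pp[OF assms] .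
  then show "\<exists>U\<in>\<nn>. \<exists>V\<in>\<pp>. X = U + V \<and> block_scale \<mu> 1 1 1 X = \<mu> *\<^sub>R U + V"
    using * by blast
  show "Z = block_scale \<mu> 1 1 1 X" if "\<exists>U\<in>\<nn>. \<exists>V\<in>\<pp>. X = U + V \<and> Z = \<mu> *\<^sub>R U + V" for Z
    using that * by auto
qed

lemma metric_operator_Lambda:
  assumes "\<mu> > 0"
  shows "metric_operator (block_scale \<mu> 1 1 1) (block_scale (1/\<mu>) (1/1) (1/1) (1/1)) (metric_of_endomorphism (Lambda \<mu>))"
  by (rule metric_operator_block_scale) (use assms in \<open>auto simp: metric_of_endomorphism_def Lambda_eq\<close>)

text \<open>Brackets with \<open>\<hh>\<close> preserve each \<open>\<mm>ij\<close>, whereas the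
  bracket of two different ones lies in the third. For \<open>X\<close> with components in two of
  them, the right-hand side of the geodesic condition is a difference of two scalars times a vector
  of the third, where the left-hand side has no component.\<close>

lemma geodesic_orbit_block_scale_eq:
  assumes pos: "d > 0" "a > 0" "b > 0" "c > 0"
    and B: "\<And>g X Y. g \<in> SU5 \<Longrightarrow> X \<in> \<mm> \<Longrightarrow> Y \<in> \<mm> \<Longrightarrow> B g X Y = Q_form (block_scale d a b c X) Y"
    and go: "geodesic_orbit B"
  shows "a = b" "a = c"
proof -
  let ?L = "block_scale d a b c"
  interpret metric_operator ?L "block_scale (1/d) (1/a) (1/b) (1/c)" B
    by (rule metric_operator_block_scale) (use pos B in auto)
  have p: "(1, 2) \<in> root_planes" "(1, 4) \<in> root_planes" "(2, 4) \<in> root_planes"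
    by (auto simp: root_planes_def)
  have L: "?L (root_vec 1 2 1) = a *\<^sub>R root_vec 1 2 1" "?L (root_vec 1 4 1) = b *\<^sub>R root_vec 1 4 1"
    "?L (root_vec 2 4 1) = c *\<^sub>R root_vec 2 4 1"
    unfolding vec_eq_iff forall_5 by (simp_all add: block_scale_entry root_vec_entry coef_def block_def)
  have br: "lie_bracket (root_vec 1 2 1) (root_vec 1 4 1) = - root_vec 2 4 1"
    "lie_bracket (root_vec 1 2 1) (root_vec 2 4 1) = root_vec 1 4 1"
    unfolding vec_eq_iff forall_5 lie_bracket_def
    by (simp_all add: matrix_mult_entry_5 root_vec_entry)
  show "a = b"
  proof -
    let ?X = "root_vec 1 2 1 + root_vec 1 4 1"
    have "?X \<in> \<mm>"
      by (intro subspace_add[OF subspace_mm] root_vec_mm p)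
    then obtain h where h: "h \<in> \<hh>" "?L (lie_bracket h ?X) = m_proj (lie_bracket (?L ?X) ?X)"
      using geodesic_orbit_imp[OF go] by blast
    have "lie_bracket (?L ?X) ?X = (b - a) *\<^sub>R root_vec 2 4 1"
      using br(1) lie_bracket_swap[of "root_vec 1 4 1" "root_vec 1 2 1"]
      by (simp add: block_scale_add L lie_bracket_add_left lie_bracket_add_right lie_bracket_scaleR_left
          lie_bracket_scaleR_right lie_bracket_self algebra_simps)
    then have "?L (lie_bracket h ?X) $ 2 $ 4 = (b - a) *\<^sub>R root_vec 2 4 1 $ 2 $ 4"
      using h(2) root_vec_mm[OF p(3), of 1] by (simp add: m_proj_scaleR mm_iff)
    moreover have "?L (lie_bracket h ?X) $ 2 $ 4 = 0"
      by (simp add: block_scale_entry lie_bracket_def matrix_mult_entry_5 root_vec_entry hh_entry[OF h(1)])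
    ultimately show ?thesis
      by (simp add: root_vec_entry)
  qed
  show "a = c"
  proof -
    let ?X = "root_vec 1 2 1 + root_vec 2 4 1"
    have "?X \<in> \<mm>"
      by (intro subspace_add[OF subspace_mm] root_vec_mm p)
    then obtain h where h: "h \<in> \<hh>" "?L (lie_bracket h ?X) = m_proj (lie_bracket (?L ?X) ?X)"
      using geodesic_orbit_imp[OF go] by blast
    have "lie_bracket (?L ?X) ?X = (a - c) *\<^sub>R root_vec 1 4 1"
      using br(2) lie_bracket_swap[of "root_vec 2 4 1" "root_vec 1 2 1"]
      by (simp add: block_scale_add L lie_bracket_add_left lie_bracket_add_right lie_bracket_scaleR_left
          lie_bracket_scaleR_right lie_bracket_self algebra_simps)
    then have "?L (lie_bracket h ?X) $ 1 $ 4 = (a - c) *\<^sub>R root_vec 1 4 1 $ 1 $ 4"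
      using h(2) root_vec_mm[OF p(2), of 1] by (simp add: m_proj_scaleR mm_iff)
    moreover have "?L (lie_bracket h ?X) $ 1 $ 4 = 0"
      by (simp add: block_scale_entry lie_bracket_def matrix_mult_entry_5 root_vec_entry hh_entry[OF h(1)])
    ultimately show ?thesis
      by (simp add: root_vec_entry)
  qed
qed

text \<open>The equations satisfied by an element of \<open>\<hh>\<close> that stabilises \<open>e_mat 2 4 + 2 *\<^sub>R e_mat 3 5\<close> and acts on
  \<open>e_mat 1 2 + e_mat 1 3\<close> as the scalar \<open>5 (\<mu> - 1) \<i>\<close>: the distinct singular values of the former force
  the element to be diagonal, and then its trace is \<open>4 \<cdot> 5 (1 - \<mu>) \<i>\<close>.\<close>

lemma stabiliser_scalar_trivial:
  assumes h: "h \<in> \<hh>"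
    and 1: "- (h$2$2 + h$3$2) = 5 * of_real (\<mu> - 1) * \<i>" "- (h$2$3 + h$3$3) = 5 * of_real (\<mu> - 1) * \<i>"
    and 2: "h$2$2 = h$4$4" "2 * h$2$3 = h$4$5" "h$3$2 = 2 * h$5$4" "h$3$3 = h$5$5"
  shows "\<mu> = 1"
proof -
  note e = hh_entry[OF h]
  have "h$3$2 = - cnj (h$2$3)" "h$5$4 = - cnj (h$4$5)"
    using e(11)[of 2 3] e(11)[of 4 5] by simp_all
  then have "cnj (h$2$3) = 4 * cnj (h$2$3)"
    using 2(3) by (simp flip: 2(2))
  then have "h$2$3 = 0"
    by simp
  moreover from this have "h$3$2 = 0"
    using \<open>h$3$2 = - cnj (h$2$3)\<close> by simp
  ultimately have "h$2$2 = - (5 * of_real (\<mu> - 1) * \<i>)" "h$3$3 = - (5 * of_real (\<mu> - 1) * \<i>)"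
    using 1 by (simp_all add: neg_eq_iff_add_eq_0 add_eq_0_iff)
  then have "of_real (\<mu> - 1) * \<i> = 0"
    using e(12) by (simp flip: 2)
  then show ?thesis
    by simp
qed

theorem mainTheorem1:
  "(\<forall>B. invariant_metric B \<and> geodesic_orbit B \<longrightarrow>
      (\<exists>c>0. \<exists>\<mu>>0. \<forall>X\<in>\<mm>. metric_endomorphism B X = c *\<^sub>R Lambda \<mu> X)) \<and>
   (\<forall>\<mu>>0. geodesic_orbit (metric_of_endomorphism (Lambda \<mu>)) \<longleftrightarrow>
      (\<forall>X01\<in>\<mm>01. \<forall>X02\<in>\<mm>02. \<forall>X12\<in>\<mm>12. \<exists>a\<in>\<hh>.
         lie_bracket a X01 + (5 * (1 - \<mu>)) *\<^sub>R bar X01 = 0 \<and>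
         lie_bracket a X02 + (5 * (1 - \<mu>)) *\<^sub>R bar X02 = 0 \<and>
         lie_bracket a X12 = 0))"
proof (intro conjI allI impI)
  fix B
  assume "invariant_metric B \<and> geodesic_orbit B"
  then have inv: "invariant_metric B" and go: "geodesic_orbit B"
    by auto
  obtain d a b c where pos: "d > 0" "a > 0" "b > 0" "c > 0"
    and B: "\<And>g X Y. g \<in> SU5 \<Longrightarrow> X \<in> \<mm> \<Longrightarrow> Y \<in> \<mm> \<Longrightarrow> B g X Y = Q_form (block_scale d a b c X) Y"
    by (rule invariant_metric_block_scale[OF inv]; blast)
  have eq: "b = a" "c = a"
    using geodesic_orbit_block_scale_eq[OF pos B go] by auto
  show "\<exists>c>0. \<exists>\<mu>>0. \<forall>X\<in>\<mm>. metric_endomorphism B X = c *\<^sub>R Lambda \<mu> X"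
  proof (intro exI conjI ballI)
    show "a > 0" "d / a > 0"
      using pos by auto
    fix X
    assume X: "X \<in> \<mm>"
    have "metric_endomorphism B X = block_scale d a a a X"
      unfolding metric_endomorphism_def
    proof (rule the_equality)
      show "block_scale d a a a X \<in> \<mm> \<and> (\<forall>Y\<in>\<mm>. B (mat 1) X Y = Q_form (block_scale d a a a X) Y)"
        using X B by (simp add: block_scale_mm eq)
      fix Z
      assume "Z \<in> \<mm> \<and> (\<forall>Y\<in>\<mm>. B (mat 1) X Y = Q_form Z Y)"
      then show "Z = block_scale d a a a X"
        using X B by (intro mm_eqI) (auto simp: block_scale_mm eq)
    qed
    also have "\<dots> = a *\<^sub>R block_scale (d / a) 1 1 1 X"
      using pos by (simp add: vec_eq_iff block_scale_entry coef_def)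
    finally show "metric_endomorphism B X = a *\<^sub>R Lambda (d / a) X"
      using X by (simp add: Lambda_eq)
  qed
next
  fix \<mu> :: real
  assume \<mu>: "\<mu> > 0"
  let ?L = "block_scale \<mu> 1 1 1"
  interpret metric_operator ?L "block_scale (1/\<mu>) (1/1) (1/1) (1/1)" "metric_of_endomorphism (Lambda \<mu>)"
    by (rule metric_operator_Lambda[OF \<mu>])
  let ?cond = "\<forall>X01\<in>\<mm>01. \<forall>X02\<in>\<mm>02. \<forall>X12\<in>\<mm>12. \<exists>a\<in>\<hh>.
         lie_bracket a X01 + (5 * (1 - \<mu>)) *\<^sub>R bar X01 = 0 \<and>
         lie_bracket a X02 + (5 * (1 - \<mu>)) *\<^sub>R bar X02 = 0 \<and>
         lie_bracket a X12 = 0"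
  have "geodesic_orbit (metric_of_endomorphism (Lambda \<mu>)) \<longleftrightarrow> \<mu> = 1"
  proof
    assume go: "geodesic_orbit (metric_of_endomorphism (Lambda \<mu>))"
    \<comment> \<open>The \<open>w_vec\<close> summand makes \<open>\<mu>\<close> visible:
      \<open>[L X, X] = (\<mu> - 1) [w, X]\<close>. Since
      \<open>[w, e_mat 1 j] = 5 f_mat 1 j\<close> and \<open>w\<close> commutes with
      \<open>\<mm>12\<close>, the element \<open>h\<close> must act by the scalar
      \<open>5 (\<mu> - 1) \<i>\<close> on the first row of the \<open>\<mm>01\<close>-part and
      stabilise the \<open>\<mm>12\<close>-part.\<close>
    define X where "X = w_vec + (root_vec 1 2 1 + root_vec 1 3 1) + (root_vec 2 4 1 + root_vec 3 5 2)"
    have "X \<in> \<mm>"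
      unfolding X_def by (intro subspace_add[OF subspace_mm] root_vec_mm w_vec_mm) (auto simp: root_planes_def)
    then obtain h where h: "h \<in> \<hh>" "?L (lie_bracket h X) = m_proj (lie_bracket (?L X) X)"
      using geodesic_orbit_imp[OF go] by blast
    note e = hh_entry[OF h(1)]
    have X: "X $ i $ j = w_vec $ i $ j + (root_vec 1 2 1 $ i $ j + root_vec 1 3 1 $ i $ j) + (root_vec 2 4 1 $ i $ j + root_vec 3 5 2 $ i $ j)" for i j
      by (simp add: X_def)
    have *: "lie_bracket h X $ i $ j = m_proj (lie_bracket (?L X) X) $ i $ j" if "block i \<noteq> block j" for i j
      using that by (simp add: block_scale_entry coef_def flip: h(2))
    have LX: "?L X = X + (\<mu> - 1) *\<^sub>R w_vec"
      unfolding vec_eq_iff forall_5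
      by (simp add: block_scale_entry X root_vec_entry w_vec_entry coef_def block_def complex_eq_iff)
    have "lie_bracket (?L X) X = (\<mu> - 1) *\<^sub>R lie_bracket w_vec X"
      by (simp add: LX lie_bracket_add_left lie_bracket_scaleR_left lie_bracket_self)
    then have **: "lie_bracket h X $ i $ j = (\<mu> - 1) *\<^sub>R m_proj (lie_bracket w_vec X) $ i $ j" if "block i \<noteq> block j" for i j
      using *[OF that] by (simp add: m_proj_scaleR)
    note simps = lie_bracket_def matrix_mult_entry_5 X root_vec_entry w_vec_entry
    have "lie_bracket h X $ 1 $ 2 = - (h$2$2 + h$3$2)" "lie_bracket h X $ 1 $ 3 = - (h$2$3 + h$3$3)"
      "lie_bracket h X $ 2 $ 4 = h$2$2 - h$4$4" "lie_bracket h X $ 2 $ 5 = 2 * h$2$3 - h$4$5"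
      "lie_bracket h X $ 3 $ 4 = h$3$2 - 2 * h$5$4" "lie_bracket h X $ 3 $ 5 = 2 * h$3$3 - 2 * h$5$5"
      by (simp_all add: simps e)
    moreover have "m_proj (lie_bracket w_vec X) $ 1 $ 2 = 5 * \<i>" "m_proj (lie_bracket w_vec X) $ 1 $ 3 = 5 * \<i>"
      "m_proj (lie_bracket w_vec X) $ 2 $ 4 = 0" "m_proj (lie_bracket w_vec X) $ 2 $ 5 = 0"
      "m_proj (lie_bracket w_vec X) $ 3 $ 4 = 0" "m_proj (lie_bracket w_vec X) $ 3 $ 5 = 0"
      by (simp_all add: simps m_proj_entry block_def)
    ultimately show "\<mu> = 1"
      using **[of 1 2] **[of 1 3] **[of 2 4] **[of 2 5] **[of 3 4] **[of 3 5]
      by (intro stabiliser_scalar_trivial[OF h(1)]) (simp_all add: block_def scaleR_conv_of_real mult_ac)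
  next
    assume "\<mu> = 1"
    then show "geodesic_orbit (metric_of_endomorphism (Lambda \<mu>))"
      by (intro normal_geodesic_orbit) (simp add: vec_eq_iff block_scale_entry coef_def)
  qed
  moreover have "?cond \<longleftrightarrow> \<mu> = 1"
  proof
    assume cond: ?cond
    let ?X = "e_mat 1 2 + e_mat 1 3" and ?Y = "e_mat 2 4 + 2 *\<^sub>R e_mat 3 5"
    have "?X \<in> \<mm>01" "0 \<in> \<mm>02" "?Y \<in> \<mm>12"
      unfolding \<mm>01_def \<mm>02_def \<mm>12_def by (intro span_add span_scale span_base span_zero; simp)+
    then obtain h where h: "h \<in> \<hh>" and X: "lie_bracket h ?X + (5 * (1 - \<mu>)) *\<^sub>R bar ?X = 0"
      and Y: "lie_bracket h ?Y = 0"
      using cond by blast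
    note e = hh_entry[OF h]
    have s: "{1..5::nat} = {1, 2, 3, 4, 5}" "{Suc 0..<2} = {1}" "{Suc 0..<3} = {1, 2}"
      "{Suc 0..<4} = {1, 2, 3}" "{Suc 0..<5} = {1, 2, 3, 4}"
      by auto
    \<comment> \<open>\<open>bar\<close> multiplies the entries above the diagonal by
      \<open>\<i>\<close>. On \<open>\<mm>01\<close> and \<open>\<mm>02\<close> it is the bracket
      with \<open>w_vec\<close> divided by 5, so the equations for \<open>h\<close> are the same as
      in the geodesic test.\<close>
    have bar: "bar ?X = f_mat 1 2 + f_mat 1 3"
      unfolding bar_def s(1) by (simp add: s(2-) e_mat_entry)
    have x: "lie_bracket h ?X $ i $ j + (5 * (1 - \<mu>)) *\<^sub>R (f_mat 1 2 $ i $ j + f_mat 1 3 $ i $ j) = 0" for i j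
      using arg_cong[OF X[unfolded bar], of "\<lambda>M. M $ i $ j"] by simp
    have y: "lie_bracket h ?Y $ i $ j = 0" for i j
      by (simp add: Y)
    have "lie_bracket h ?X $ 1 $ 2 = - (h$2$2 + h$3$2)" "lie_bracket h ?X $ 1 $ 3 = - (h$2$3 + h$3$3)"
      "lie_bracket h ?Y $ 2 $ 4 = h$2$2 - h$4$4" "lie_bracket h ?Y $ 2 $ 5 = 2 *\<^sub>R h$2$3 - h$4$5"
      "lie_bracket h ?Y $ 3 $ 4 = h$3$2 - 2 *\<^sub>R h$5$4" "lie_bracket h ?Y $ 3 $ 5 = 2 *\<^sub>R (h$3$3 - h$5$5)"
      by (simp_all add: lie_bracket_def matrix_mult_entry_5 e_mat_entry e complex_eq_iff)
    moreover have "- (h$2$2 + h$3$2) = 5 * of_real (\<mu> - 1) * \<i>" "- (h$2$3 + h$3$3) = 5 * of_real (\<mu> - 1) * \<i>"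
      using x[of 1 2] x[of 1 3] calculation(1,2)
      by (simp_all add: f_mat_entry complex_eq_iff)
    ultimately show "\<mu> = 1"
      using y[of 2 4] y[of 2 5] y[of 3 4] y[of 3 5]
      by (intro stabiliser_scalar_trivial[OF h]) (simp_all add: scaleR_conv_of_real)
  next
    assume "\<mu> = 1"
    then show ?cond
      using subspace_0[OF subspace_hh] by (auto intro!: bexI[of _ 0] simp: lie_bracket_zero_left)
  qed
  ultimately show "geodesic_orbit (metric_of_endomorphism (Lambda \<mu>)) \<longleftrightarrow> ?cond"
    by blast
qed

end
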